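(* Let $m,l,n\ge1$. Write the generators of $\mathscr A^{[m+l]}$ as $a_{\alpha\beta}$ with $\alpha\in[1,n]^m$, $\beta\in[1,n]^l$. Then the map $$\Delta:\mathscr A^{[m+l]}\longrightarrow\mathscr A^{[m+1]}\otimes\mathscr A^{[1+l]},\qquad \Delta(a_{\alpha\beta})=\sum_{j=1}^{n}a_{\alpha j}\otimes a_{j\beta},$$ is an algebra homomorphism. Moreover, for all $1\le r\le n$ and all $I=I_1\times\cdots\times I_m$, $J=J_1\times\cdots\times J_l$ with $I_s,J_t$ $r$-element subsets of $[1,n]$, $$\Delta(\xi(I\times J))=\sum_{K}\xi(I\times K)\otimes\xi(K\times J),$$ where $K$ runs over all $r$-element subsets of $[1,n]$. In particular, $$\Delta(\mathrm{Det}_q(\mathscr A^{[m+l]}))=\mathrm{Det}_q(\mathscr A^{[m+1]})\otimes\mathrm{Det}_q(\mathscr A^{[l+1]}).$$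
   Context: $q$ is a nonzero complex number; $F$ is the ground field, an extension field of $\mathbb C$; $[1,n]=\{1,\ldots,n\}$; $\ell(\sigma)$ is the number of inversions; $[r]_p=1+p+\cdots+p^{r-1}$, $[r]_p!=[1]_p\cdots[r]_p$. Quantum hypermatrix algebra: for $M\ge1$, $\mathscr A^{[M]}=\mathscr A_q^{[M]}$ is the unital associative $F$-algebra generated by $a_{i_1\ldots i_M}$ ($1\le i_s\le n$). For $1\le k\le M$ and $\alpha=(j_1,\ldots,j_{k-1},j_{k+1},\ldots,j_M)$ write $a^{(k)}_{i\alpha}=a_{j_1\ldots j_{k-1}ij_{k+1}\ldots j_M}$. The defining relations are, for every $k$ and every $J=I_1\times\cdots\times I_{M-1}\subset[1,n]^{M-1}$ with all $|I_s|=2$, $$\sum_{\alpha\sqcup\beta=J}(-q)^{\mathrm{inv}(\alpha,\beta)}a^{(k)}_{i\alpha}a^{(k)}_{i\beta}=0,\qquad \sum_{\alpha\sqcup\beta=J}(-q)^{\mathrm{inv}(\alpha,\beta)}a^{(k)}_{j\alpha}a^{(k)}_{i\beta}=-q\sum_{\alpha\sqcup\beta=J}(-q)^{\mathrm{inv}(\alpha,\beta)}a^{(k)}_{i\alpha}a^{(k)}_{j\beta}\quad(i<j),$$ where the sums run over pairs $(\alpha,\beta)$ with $\{\alpha_s,\beta_s\}=I_s$ for all $s$, and $\mathrm{inv}(\alpha,\beta)=|\{s:\alpha_s>\beta_s\}|$. Quantum minor hyperdeterminants: for $r$-element subsets $I_s=\{i^s_1<\cdots<i^s_r\}$ of $[1,n]$,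 $1\le s\le M$, $$\xi(I_1\times\cdots\times I_M)=\xi(I_1,\ldots,I_M)=\sum_{\sigma_2,\ldots,\sigma_M\in S_r}(-q)^{\sum_{s=2}^M\ell(\sigma_s)}\prod_{p=1}^{r}a_{i^1_p,\,i^2_{\sigma_2(p)},\ldots,\,i^M_{\sigma_M(p)}}$$ (products in the order $p=1,\ldots,r$). Quantum hyperdeterminant: $\mathrm{Det}_q(\mathscr A^{[M]})=\xi([1,n],\ldots,[1,n])$, i.e. $\sum_{\sigma_2,\ldots,\sigma_M\in S_n}(-q)^{\sum_{s\ge2}\ell(\sigma_s)}\prod_{i=1}^na_{i,\sigma_2(i),\ldots,\sigma_M(i)}$; for generic $q$ (with $[n]_{q^2}!\neq0$) this is the same element as $\frac1{[n]_{q^2}!}\sum_{\sigma_1,\ldots,\sigma_M\in S_n}(-q)^{\sum_s\ell(\sigma_s)}\prod_{i=1}^{n}a_{\sigma_1(i),\ldots,\sigma_M(i)}$. *)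

theory Defs
  imports
    Complex_Main
    "HOL-Library.Poly_Mapping"
    "HOL-Combinatorics.Permutations"
    "HOL-Algebra.Module"
    "HOL-Algebra.QuotRing"
begin

section \<open>Algebras over a field\<close>

text \<open>
  The ground field is a type \<open>'f :: field\<close>. An associative unital (not necessarily commutative)
  algebra over it is represented by a record of type \<open>('f, 'a) module\<close>, i.e. a ring
  together with a scalar multiplication.
\<close>

definition alg_hom ::
  "('f::field, 'a, 'c) module_scheme \<Rightarrow> ('f, 'b, 'd) module_scheme \<Rightarrow> ('a \<Rightarrow> 'b) set" where
  "alg_hom A B =
     {h \<in> ring_hom A B. \<forall>c. \<forall>x\<in>carrier A. h (c \<odot>\<^bsub>A\<^esub> x) = c \<odot>\<^bsub>B\<^esub> h x}"

definition monoid_alg :: "('a, 'c) monoid_scheme \<Rightarrow> ('f::field, 'a \<Rightarrow>\<^sub>0 'f) module" where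
  "monoid_alg G =
     \<lparr>carrier = {f. Poly_Mapping.keys f \<subseteq> carrier G},
      mult = (\<lambda>f g. \<Sum>x\<in>Poly_Mapping.keys f. \<Sum>y\<in>Poly_Mapping.keys g.
                Poly_Mapping.single (x \<otimes>\<^bsub>G\<^esub> y) (Poly_Mapping.lookup f x * Poly_Mapping.lookup g y)),
      one = Poly_Mapping.single \<one>\<^bsub>G\<^esub> 1,
      zero = 0,
      add = (+),
      smult = (\<lambda>c. Poly_Mapping.map ((*) c))\<rparr>"

text \<open>The quotient by a two-sided ideal: the factor ring with the induced scalar multiplication.\<close>

definition alg_quot ::
  "('f::field, 'a, 'c) module_scheme \<Rightarrow> 'a set \<Rightarrow> ('f, 'a set) module" where
  "alg_quot A I =
     \<lparr>carrier = carrier (A Quot I),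
      mult = mult (A Quot I),
      one = one (A Quot I),
      zero = zero (A Quot I),
      add = add (A Quot I),
      smult = (\<lambda>c X. \<Union>x\<in>X. I +>\<^bsub>A\<^esub> (c \<odot>\<^bsub>A\<^esub> x))\<rparr>"

text \<open>
  The tensor product \<open>A \<otimes> B\<close> over the ground field is the vector space on the basis
  \<open>carrier A \<times> carrier B\<close> modulo the bilinearity relations, with product
  \<open>(a \<otimes> b)(a' \<otimes> b') = aa' \<otimes> bb'\<close>. Before passing to the quotient this is the
  monoid algebra of the product of the multiplicative monoids of \<open>A\<close> and \<open>B\<close>; in it, the linear
  span of the bilinearity relations is a two-sided ideal, hence equals the ideal generated by them.
\<close>

definition tensor_rels ::
  "('f::field, 'a, 'c) module_scheme \<Rightarrow> ('f, 'b, 'd) module_scheme \<Rightarrow> ('a \<times> 'b \<Rightarrow>\<^sub>0 'f) set" where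
  "tensor_rels A B =
     {Poly_Mapping.single (a \<oplus>\<^bsub>A\<^esub> a', b) 1 - Poly_Mapping.single (a, b) 1 - Poly_Mapping.single (a', b) 1
        | a a' b. a \<in> carrier A \<and> a' \<in> carrier A \<and> b \<in> carrier B} \<union>
     {Poly_Mapping.single (a, b \<oplus>\<^bsub>B\<^esub> b') 1 - Poly_Mapping.single (a, b) 1 - Poly_Mapping.single (a, b') 1
        | a b b'. a \<in> carrier A \<and> b \<in> carrier B \<and> b' \<in> carrier B} \<union>
     {Poly_Mapping.single (c \<odot>\<^bsub>A\<^esub> a, b) 1 - Poly_Mapping.single (a, b) c
        | c a b. a \<in> carrier A \<and> b \<in> carrier B} \<union>
     {Poly_Mapping.single (a, c \<odot>\<^bsub>B\<^esub> b) 1 - Poly_Mapping.single (a, b) c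
        | c a b. a \<in> carrier A \<and> b \<in> carrier B}"

definition tensor_ideal ::
  "('f::field, 'a, 'c) module_scheme \<Rightarrow> ('f, 'b, 'd) module_scheme \<Rightarrow> ('a \<times> 'b \<Rightarrow>\<^sub>0 'f) set" where
  "tensor_ideal A B = Idl\<^bsub>monoid_alg (A \<times>\<times> B)\<^esub> (tensor_rels A B)"

definition tensor_alg ::
  "('f::field, 'a, 'c) module_scheme \<Rightarrow> ('f, 'b, 'd) module_scheme \<Rightarrow>
     ('f, ('a \<times> 'b \<Rightarrow>\<^sub>0 'f) set) module" where
  "tensor_alg A B = alg_quot (monoid_alg (A \<times>\<times> B)) (tensor_ideal A B)"

definition tensor ::
  "('f::field, 'a, 'c) module_scheme \<Rightarrow> ('f, 'b, 'd) module_scheme \<Rightarrow> 'a \<Rightarrow> 'b \<Rightarrow>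
     ('a \<times> 'b \<Rightarrow>\<^sub>0 'f) set" where
  "tensor A B a b =
     tensor_ideal A B +>\<^bsub>monoid_alg (A \<times>\<times> B)\<^esub> Poly_Mapping.single (a, b) 1"

definition word_monoid :: "'x set \<Rightarrow> 'x list monoid" where
  "word_monoid X = \<lparr>carrier = lists X, mult = (@), one = []\<rparr>"

definition free_alg :: "'x set \<Rightarrow> ('f::field, 'x list \<Rightarrow>\<^sub>0 'f) module" where
  "free_alg X = monoid_alg (word_monoid X)"


section \<open>Quantum hypermatrix algebras\<close>

text \<open>
  The multi-index \<open>(i\<^sub>1, \<dots>, i\<^sub>M)\<close> is the list \<open>[i\<^sub>1, \<dots>, i\<^sub>M]\<close>, so juxtaposition \<open>\<alpha>\<beta>\<close> of
  multi-indices is \<open>\<alpha> @ \<beta>\<close>. Entries are counted from 1, positions within a list from 0.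
\<close>

definition multi_indices :: "nat \<Rightarrow> nat \<Rightarrow> nat list set" where
  "multi_indices n M = {\<alpha>. length \<alpha> = M \<and> set \<alpha> \<subseteq> {1..n}}"

text \<open>\<open>insert_at k i \<alpha>\<close> is the multi-index of \<open>a\<^sup>(\<^sup>k\<^sup>+\<^sup>1\<^sup>)\<^bsub>i\<alpha>\<^esub>\<close>.\<close>

definition insert_at :: "nat \<Rightarrow> nat \<Rightarrow> nat list \<Rightarrow> nat list" where
  "insert_at k i \<alpha> = take k \<alpha> @ i # drop k \<alpha>"

definition inv_pair :: "nat list \<Rightarrow> nat list \<Rightarrow> nat" where
  "inv_pair \<alpha> \<beta> = card {s. s < length \<alpha> \<and> \<alpha> ! s > \<beta> ! s}"

text \<open>The pairs \<open>(\<alpha>, \<beta>)\<close> with \<open>\<alpha> \<squnion> \<beta> = I\<^sub>1 \<times> \<dots> \<times> I\<^sub>N\<close>, where \<open>J = [I\<^sub>1, \<dots>, I\<^sub>N]\<close>.\<close>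

definition splittings :: "nat set list \<Rightarrow> (nat list \<times> nat list) set" where
  "splittings J =
     {(\<alpha>, \<beta>). length \<alpha> = length J \<and> length \<beta> = length J \<and>
               (\<forall>s<length J. {\<alpha> ! s, \<beta> ! s} = J ! s)}"

text \<open>
  The element \<open>\<Sum> (-q)\<^bsup>inv(\<alpha>,\<beta>)\<^esup> a\<^sup>(\<^sup>k\<^sup>+\<^sup>1\<^sup>)\<^bsub>i\<alpha>\<^esub> a\<^sup>(\<^sup>k\<^sup>+\<^sup>1\<^sup>)\<^bsub>j\<beta>\<^esub>\<close> of the free algebra,
  the sum being over the splittings of \<open>J\<close>.
\<close>

definition quad_sum ::
  "'f::field \<Rightarrow> nat \<Rightarrow> nat set list \<Rightarrow> nat \<Rightarrow> nat \<Rightarrow> (nat list list \<Rightarrow>\<^sub>0 'f)" where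
  "quad_sum q k J i j =
     (\<Sum>(\<alpha>, \<beta>)\<in>splittings J.
        Poly_Mapping.single [insert_at k i \<alpha>, insert_at k j \<beta>] ((- q) ^ inv_pair \<alpha> \<beta>))"

definition pair_boxes :: "nat \<Rightarrow> nat \<Rightarrow> nat set list set" where
  "pair_boxes n N = {J. length J = N \<and> (\<forall>S\<in>set J. S \<subseteq> {1..n} \<and> card S = 2)}"

definition hyp_rels :: "'f::field \<Rightarrow> nat \<Rightarrow> nat \<Rightarrow> (nat list list \<Rightarrow>\<^sub>0 'f) set" where
  "hyp_rels q n M =
     {quad_sum q k J i i
        | k J i. k < M \<and> J \<in> pair_boxes n (M - 1) \<and> i \<in> {1..n}} \<union>
     {quad_sum q k J j i - (- q) \<odot>\<^bsub>free_alg (multi_indices n M)\<^esub> quad_sum q k J i j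
        | k J i j. k < M \<and> J \<in> pair_boxes n (M - 1) \<and> i \<in> {1..n} \<and> j \<in> {1..n} \<and> i < j}"

definition hyp_ideal :: "'f::field \<Rightarrow> nat \<Rightarrow> nat \<Rightarrow> (nat list list \<Rightarrow>\<^sub>0 'f) set" where
  "hyp_ideal q n M = Idl\<^bsub>free_alg (multi_indices n M)\<^esub> (hyp_rels q n M)"

definition hyp_alg ::
  "'f::field \<Rightarrow> nat \<Rightarrow> nat \<Rightarrow> ('f, (nat list list \<Rightarrow>\<^sub>0 'f) set) module" where
  "hyp_alg q n M = alg_quot (free_alg (multi_indices n M)) (hyp_ideal q n M)"

text \<open>The generator \<open>a\<^bsub>\<alpha>\<^esub>\<close> of \<open>hyp_alg q n M\<close>, where \<open>M\<close> is the length of \<open>\<alpha>\<close>.\<close>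

definition hyp_gen :: "'f::field \<Rightarrow> nat \<Rightarrow> nat list \<Rightarrow> (nat list list \<Rightarrow>\<^sub>0 'f) set" where
  "hyp_gen q n \<alpha> =
     hyp_ideal q n (length \<alpha>) +>\<^bsub>free_alg (multi_indices n (length \<alpha>))\<^esub> Poly_Mapping.single [\<alpha>] 1"


section \<open>Minor hyperdeterminants\<close>

definition inversions :: "nat \<Rightarrow> (nat \<Rightarrow> nat) \<Rightarrow> nat" where
  "inversions r \<sigma> = card {(a, b). a < b \<and> b < r \<and> \<sigma> a > \<sigma> b}"

definition perm_lists :: "nat \<Rightarrow> nat \<Rightarrow> (nat \<Rightarrow> nat) list set" where
  "perm_lists r N = {\<sigma>s. length \<sigma>s = N \<and> (\<forall>\<sigma>\<in>set \<sigma>s. \<sigma> permutes {..<r})}"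

text \<open>
  For \<open>Is = [I\<^sub>1, \<dots>, I\<^sub>M]\<close> a list of \<open>r\<close>-element sets, \<open>hyp_minor q n r Is\<close> is
  \<open>\<xi>(I\<^sub>1, \<dots>, I\<^sub>M)\<close>. The list \<open>\<sigma>s\<close> is \<open>[\<sigma>\<^sub>2, \<dots>, \<sigma>\<^sub>M]\<close> and \<open>id\<close> stands for the absent \<open>\<sigma>\<^sub>1\<close>;
  permutations act on \<open>{0, \<dots>, r - 1}\<close> instead of \<open>{1, \<dots>, r}\<close>, matching list positions.
\<close>

definition hyp_minor ::
  "'f::field \<Rightarrow> nat \<Rightarrow> nat \<Rightarrow> nat set list \<Rightarrow> (nat list list \<Rightarrow>\<^sub>0 'f) set" where
  "hyp_minor q n r Is =
     (let A = hyp_alg q n (length Is) in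
      \<Oplus>\<^bsub>A\<^esub>\<sigma>s\<in>perm_lists r (length Is - 1).
        (- q) ^ sum_list (map (inversions r) \<sigma>s) \<odot>\<^bsub>A\<^esub>
          foldr (mult A)
            (map (\<lambda>p. hyp_gen q n (map2 (\<lambda>I \<sigma>. sorted_list_of_set I ! \<sigma> p) Is (id # \<sigma>s))) [0..<r])
            \<one>\<^bsub>A\<^esub>)"

definition hyp_det :: "'f::field \<Rightarrow> nat \<Rightarrow> nat \<Rightarrow> (nat list list \<Rightarrow>\<^sub>0 'f) set" where
  "hyp_det q n M = hyp_minor q n n (replicate M {1..n})"

definition subsets_of_card :: "nat \<Rightarrow> nat \<Rightarrow> nat set set" where
  "subsets_of_card n r = {K. K \<subseteq> {1..n} \<and> card K = r}"

end

theory Submission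
  imports Defs
begin

text \<open>
  The comultiplication exists because the matrix product of two families satisfying the
  hypermatrix relations satisfies them again. Given families \<open>\<phi>\<close> of order \<open>m + 1\<close> and \<open>\<psi>\<close> of
  order \<open>1 + l\<close>, put \<open>\<Phi>(\<gamma>\<delta>) = (\<Sum>u. \<phi>(\<gamma>u) \<otimes> \<psi>(u\<delta>))\<close> and consider the quadratic sum of \<open>\<Phi>\<close>
  over a box \<open>J' \<times> J''\<close> in a direction \<open>k\<close> among the first \<open>m\<close> ones, for the entries \<open>i, j\<close>.
  It separates as \<open>\<Sum>u v. P(u, v) \<otimes> R(u, v)\<close>, where \<open>R(u, v)\<close> is the quadratic sum of \<open>\<psi>\<close> over
  \<open>J''\<close> in its first direction. The relations for \<open>\<psi>\<close> say \<open>R(u, u) = 0\<close> and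
  \<open>R(v, u) = -q R(u, v)\<close> for \<open>u < v\<close>, so the sum collapses to
  \<open>\<Sum>u<v. (P(u, v) - q P(v, u)) \<otimes> R(u, v)\<close>; and \<open>P(u, v) - q P(v, u)\<close> is the quadratic sum of
  \<open>\<phi>\<close> over the larger box \<open>J' \<times> {u, v}\<close>. The relations of \<open>\<phi>\<close> in direction \<open>k\<close> therefore
  pass to \<open>\<Phi>\<close>. For a direction among the last \<open>l\<close> ones the two factors exchange their roles.
  This is \<open>hyp_family_convolve\<close>; with the universal property \<open>hyp_alg_universal\<close> it yields
  \<open>\<Delta>\<close>.

  The formula for minors is a Cauchy-Binet argument. Expanding the minor of \<open>\<Phi>\<close> gives
  \<open>\<Sum>k. P(k) \<otimes> R(k)\<close> over all sequences \<open>k = (k\<^sub>1, \<dots>, k\<^sub>r)\<close>, where \<open>k\<close> is the row of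
  last indices in \<open>P\<close> and of first indices in \<open>R\<close>. Collecting the permutations defining \<open>R\<close> in
  classes modulo an adjacent transposition in each coordinate exhibits the quadratic sums of
  \<open>\<psi>\<close> as factors, so \<open>R\<close> is \<open>q\<close>-alternating (\<open>row_minor_alternating\<close>): it vanishes if two
  adjacent entries agree, and swapping an ascent multiplies it by \<open>-q\<close>. Hence only sequences
  without repetition contribute. Such a sequence is the increasing enumeration of a set \<open>K\<close>
  rearranged by a permutation \<open>\<sigma>\<close>, and for it \<open>R(k) = (-q)\<^sup>\<ell>\<^sup>(\<^sup>\<sigma>\<^sup>) \<xi>(K \<times> J)\<close>. Summing the
  weighted first factors over \<open>\<sigma>\<close> produces \<open>\<xi>(I \<times> K)\<close>, which is \<open>minor_convolve\<close>. The
  formula for determinants is the case in which \<open>{1..n}\<close> is the only possible \<open>K\<close>.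

  Of the tensor product these arguments use only that it is a bilinear, multiplicative and
  unital pairing of algebras. They are carried out for any such pairing (locale
  \<open>alg_pairing\<close>), where exchanging the factors is again a pairing.
\<close>

section \<open>Finite sums in abelian monoids\<close>

lemma (in abelian_monoid) finsum_cartesian:
  assumes "finite A" "finite B" "\<And>a b. a \<in> A \<Longrightarrow> b \<in> B \<Longrightarrow> f a b \<in> carrier G"
  shows "(\<Oplus>p\<in>A \<times> B. f (fst p) (snd p)) = (\<Oplus>a\<in>A. \<Oplus>b\<in>B. f a b)"
  using assms(1,3)
proof (induction A rule: finite_induct)
  case empty
  then show ?case by simp
next
  case (insert x A)
  have "insert x A \<times> B = Pair x ` B \<union> A \<times> B" by auto
  moreover have "(\<Oplus>p\<in>Pair x ` B \<union> A \<times> B. f (fst p) (snd p))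
      = (\<Oplus>p\<in>Pair x ` B. f (fst p) (snd p)) \<oplus> (\<Oplus>p\<in>A \<times> B. f (fst p) (snd p))"
    by (rule finsum_Un_disjoint) (use insert assms(2) in auto)
  moreover have "(\<Oplus>p\<in>Pair x ` B. f (fst p) (snd p)) = (\<Oplus>b\<in>B. f x b)"
    using insert.prems by (subst finsum_reindex) (auto simp: inj_on_def)
  moreover have "(\<Oplus>a\<in>insert x A. \<Oplus>b\<in>B. f a b)
      = (\<Oplus>b\<in>B. f x b) \<oplus> (\<Oplus>a\<in>A. \<Oplus>b\<in>B. f a b)"
    by (rule finsum_insert) (use insert in auto)
  ultimately show ?case using insert.IH insert.prems by simp
qed

lemma (in abelian_monoid) finsum_bij:
  assumes "bij_betw h A B" "\<And>b. b \<in> B \<Longrightarrow> f b \<in> carrier G"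
  shows "(\<Oplus>b\<in>B. f b) = (\<Oplus>a\<in>A. f (h a))"
proof -
  have "B = h ` A" "inj_on h A" using assms(1) by (auto simp: bij_betw_def)
  then show ?thesis using assms(2) by (auto intro!: finsum_reindex)
qed

lemma (in abelian_monoid) finsum_swap:
  assumes "finite A" "finite B" "\<And>a b. a \<in> A \<Longrightarrow> b \<in> B \<Longrightarrow> f a b \<in> carrier G"
  shows "(\<Oplus>a\<in>A. \<Oplus>b\<in>B. f a b) = (\<Oplus>b\<in>B. \<Oplus>a\<in>A. f a b)"
proof -
  have "bij_betw prod.swap (B \<times> A) (A \<times> B)"
    by (rule bij_betwI[where g = prod.swap]) auto
  then have "(\<Oplus>p\<in>A \<times> B. f (fst p) (snd p)) = (\<Oplus>p\<in>B \<times> A. f (snd p) (fst p))"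
    using assms(3) by (subst finsum_bij[of prod.swap "B \<times> A" "A \<times> B"]) auto
  then show ?thesis
    using finsum_cartesian[of A B f] finsum_cartesian[of B A "\<lambda>b a. f a b"] assms by simp
qed

lemma (in abelian_monoid) finsum_one_element: "f x \<in> carrier G \<Longrightarrow> (\<Oplus>y\<in>{x}. f y) = f x"
  by simp

lemma (in abelian_monoid) finsum_support:
  assumes "finite B" "A \<subseteq> B" "\<And>b. b \<in> B \<Longrightarrow> f b \<in> carrier G"
    "\<And>b. b \<in> B - A \<Longrightarrow> f b = \<zero>"
  shows "(\<Oplus>b\<in>B. f b) = (\<Oplus>a\<in>A. f a)"
  using assms by (intro add.finprod_mono_neutral_cong_right) auto

text \<open>
  The common source of all distributive laws below: scalar multiplication, one-sided
  multiplication, homomorphisms and pairings are additive maps.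
\<close>

lemma additive_finsum:
  assumes "abelian_monoid A" "abelian_monoid B"
    and h: "h \<in> carrier A \<rightarrow> carrier B" "h \<zero>\<^bsub>A\<^esub> = \<zero>\<^bsub>B\<^esub>"
      "\<And>x y. x \<in> carrier A \<Longrightarrow> y \<in> carrier A \<Longrightarrow> h (x \<oplus>\<^bsub>A\<^esub> y) = h x \<oplus>\<^bsub>B\<^esub> h y"
    and f: "\<And>s. s \<in> S \<Longrightarrow> f s \<in> carrier A"
  shows "h (\<Oplus>\<^bsub>A\<^esub>s\<in>S. f s) = (\<Oplus>\<^bsub>B\<^esub>s\<in>S. h (f s))"
proof -
  interpret A: abelian_monoid A by fact
  interpret B: abelian_monoid B by fact
  show ?thesis
  proof (cases "finite S")
    case True
    then show ?thesis using f
    proof (induction S rule: finite_induct)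
      case empty
      then show ?case using h by simp
    next
      case (insert x S)
      have "h (f s) \<in> carrier B" if "s \<in> insert x S" for s using insert.prems h that by blast
      then show ?case using insert h by (simp add: Pi_def)
    qed
  next
    case False
    then show ?thesis using h by (simp add: A.finsum_infinite B.finsum_infinite)
  qed
qed

section \<open>Unital algebras and their homomorphisms\<close>

locale unital_alg = ring A for A :: "('f::field, 'a, 'c) module_scheme" (structure) +
  assumes smult_closed [simp, intro]: "x \<in> carrier A \<Longrightarrow> c \<odot> x \<in> carrier A"
    and smult_add_left: "x \<in> carrier A \<Longrightarrow> (c + d) \<odot> x = c \<odot> x \<oplus> d \<odot> x"
    and smult_add_right: "\<lbrakk>x \<in> carrier A; y \<in> carrier A\<rbrakk> \<Longrightarrow> c \<odot> (x \<oplus> y) = c \<odot> x \<oplus> c \<odot> y"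
    and smult_smult: "x \<in> carrier A \<Longrightarrow> c \<odot> (d \<odot> x) = (c * d) \<odot> x"
    and smult_1 [simp]: "x \<in> carrier A \<Longrightarrow> 1 \<odot> x = x"
    and smult_mult_left: "\<lbrakk>x \<in> carrier A; y \<in> carrier A\<rbrakk> \<Longrightarrow> (c \<odot> x) \<otimes> y = c \<odot> (x \<otimes> y)"
    and smult_mult_right: "\<lbrakk>x \<in> carrier A; y \<in> carrier A\<rbrakk> \<Longrightarrow> x \<otimes> (c \<odot> y) = c \<odot> (x \<otimes> y)"
begin

lemma smult_zero_right [simp]: "c \<odot> \<zero> = \<zero>"
proof -
  have "c \<odot> \<zero> \<oplus> c \<odot> \<zero> = c \<odot> \<zero>" using smult_add_right[of \<zero> \<zero> c] by simp
  then show ?thesis by (metis add.l_cancel_one' smult_closed zero_closed)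
qed

lemma smult_zero_left [simp]:
  assumes "x \<in> carrier A"
  shows "0 \<odot> x = \<zero>"
proof -
  have "0 \<odot> x \<oplus> 0 \<odot> x = 0 \<odot> x" using smult_add_left[of x 0 0] assms by simp
  then show ?thesis by (metis add.l_cancel_one' smult_closed assms)
qed

lemma smult_uminus: "x \<in> carrier A \<Longrightarrow> c \<odot> (\<ominus> x) = \<ominus> (c \<odot> x)"
  using smult_add_right[of "\<ominus> x" x c] by (intro minus_equality[symmetric]) (auto simp: l_neg)

lemma smult_minus:
  "\<lbrakk>x \<in> carrier A; y \<in> carrier A\<rbrakk> \<Longrightarrow> c \<odot> (x \<ominus> y) = c \<odot> x \<ominus> c \<odot> y"
  by (simp add: a_minus_def smult_add_right smult_uminus)

lemma smult_finsum:
  assumes "\<And>s. s \<in> S \<Longrightarrow> f s \<in> carrier A"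
  shows "c \<odot> (\<Oplus>s\<in>S. f s) = (\<Oplus>s\<in>S. c \<odot> f s)"
  by (rule additive_finsum) (use assms in \<open>auto simp: smult_add_right abelian_monoid_axioms\<close>)

definition lprod :: "'a list \<Rightarrow> 'a" where
  "lprod xs = foldr (\<otimes>) xs \<one>"

lemma lprod_Nil [simp]: "lprod [] = \<one>"
  and lprod_Cons [simp]: "lprod (x # xs) = x \<otimes> lprod xs"
  by (simp_all add: lprod_def)

lemma lprod_closed [simp, intro]: "set xs \<subseteq> carrier A \<Longrightarrow> lprod xs \<in> carrier A"
  by (induction xs) auto

lemma lprod_append:
  "\<lbrakk>set xs \<subseteq> carrier A; set ys \<subseteq> carrier A\<rbrakk> \<Longrightarrow> lprod (xs @ ys) = lprod xs \<otimes> lprod ys"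
  by (induction xs) (auto simp: m_assoc)

lemma finsum_mult_distrib_left:
  assumes "\<And>s. s \<in> S \<Longrightarrow> f s \<in> carrier A" "x \<in> carrier A"
  shows "x \<otimes> (\<Oplus>s\<in>S. f s) = (\<Oplus>s\<in>S. x \<otimes> f s)"
  by (rule additive_finsum) (use assms in \<open>auto simp: r_distr abelian_monoid_axioms\<close>)

lemma finsum_mult_distrib_right:
  assumes "\<And>s. s \<in> S \<Longrightarrow> f s \<in> carrier A" "x \<in> carrier A"
  shows "(\<Oplus>s\<in>S. f s) \<otimes> x = (\<Oplus>s\<in>S. f s \<otimes> x)"
  by (rule additive_finsum[where h = "\<lambda>y. y \<otimes> x"])
    (use assms in \<open>auto simp: l_distr abelian_monoid_axioms\<close>)

text \<open>
  Expanding a product of sums: a choice of one summand from each factor is a list of indices.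
\<close>

lemma lprod_finsum:
  assumes "finite X" "\<And>p j. p \<in> set ps \<Longrightarrow> j \<in> X \<Longrightarrow> f p j \<in> carrier A"
  shows "lprod (map (\<lambda>p. \<Oplus>j\<in>X. f p j) ps)
    = (\<Oplus>ks\<in>{ks. length ks = length ps \<and> set ks \<subseteq> X}. lprod (map2 f ps ks))"
  using assms(2)
proof (induction ps)
  case Nil
  have "{ks. length ks = length [] \<and> set ks \<subseteq> X} = {[]}" by auto
  then show ?case by (simp add: finsum_singleton[where i = "[]" and A = "{[]}" and f = "\<lambda>_. \<one>", simplified])
next
  case (Cons p ps)
  let ?L = "\<lambda>qs. {ks. length ks = length qs \<and> set ks \<subseteq> X}"
  have fin: "finite (?L ps)"
    using finite_lists_length_eq[OF assms(1), of "length ps"] by (simp add: conj_commute)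
  have cl: "lprod (map2 f ps ks) \<in> carrier A" if "ks \<in> ?L ps" for ks
  proof (rule lprod_closed, rule subsetI)
    fix y assume "y \<in> set (map2 f ps ks)"
    then obtain p' k where "(p', k) \<in> set (zip ps ks)" "y = f p' k" by auto
    then have "p' \<in> set ps" "k \<in> set ks" "y = f p' k"
      by (auto dest: set_zip_leftD set_zip_rightD)
    then show "y \<in> carrier A" using that Cons.prems by auto
  qed
  have bij: "bij_betw (\<lambda>(j, ks). j # ks) (X \<times> ?L ps) (?L (p # ps))"
    by (rule bij_betwI[where g = "\<lambda>ks. (hd ks, tl ks)"]) (auto simp: length_Suc_conv)
  have "(\<Oplus>ks\<in>?L (p # ps). lprod (map2 f (p # ps) ks))
      = (\<Oplus>x\<in>X \<times> ?L ps. f p (fst x) \<otimes> lprod (map2 f ps (snd x)))"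
  proof (subst finsum_bij[OF bij])
    show "lprod (map2 f (p # ps) ks) \<in> carrier A" if "ks \<in> ?L (p # ps)" for ks
    proof -
      obtain k ks' where "ks = k # ks'" "k \<in> X" "ks' \<in> ?L ps"
        using \<open>ks \<in> ?L (p # ps)\<close> by (auto simp: length_Suc_conv)
      then show ?thesis using cl[of ks'] Cons.prems by auto
    qed
  qed (use cl Cons.prems in \<open>auto intro!: finsum_cong'\<close>)
  also have "\<dots> = (\<Oplus>j\<in>X. \<Oplus>ks\<in>?L ps. f p j \<otimes> lprod (map2 f ps ks))"
    using finsum_cartesian[OF assms(1) fin, of "\<lambda>j ks. f p j \<otimes> lprod (map2 f ps ks)"]
      cl Cons.prems by auto
  also have "\<dots> = (\<Oplus>j\<in>X. f p j \<otimes> (\<Oplus>ks\<in>?L ps. lprod (map2 f ps ks)))"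
    using cl Cons.prems by (intro finsum_cong' finsum_mult_distrib_left[symmetric]) auto
  also have "\<dots> = (\<Oplus>j\<in>X. f p j) \<otimes> (\<Oplus>ks\<in>?L ps. lprod (map2 f ps ks))"
    using cl Cons.prems by (subst finsum_mult_distrib_right) auto
  finally show ?case using Cons by simp
qed

end

lemma alg_homD:
  assumes "h \<in> alg_hom A B"
  shows "h \<in> carrier A \<rightarrow> carrier B"
    "\<And>x y. \<lbrakk>x \<in> carrier A; y \<in> carrier A\<rbrakk> \<Longrightarrow> h (x \<otimes>\<^bsub>A\<^esub> y) = h x \<otimes>\<^bsub>B\<^esub> h y"
    "\<And>x y. \<lbrakk>x \<in> carrier A; y \<in> carrier A\<rbrakk> \<Longrightarrow> h (x \<oplus>\<^bsub>A\<^esub> y) = h x \<oplus>\<^bsub>B\<^esub> h y"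
    "h \<one>\<^bsub>A\<^esub> = \<one>\<^bsub>B\<^esub>"
    "\<And>c x. x \<in> carrier A \<Longrightarrow> h (c \<odot>\<^bsub>A\<^esub> x) = c \<odot>\<^bsub>B\<^esub> h x"
  using assms by (auto simp: alg_hom_def ring_hom_def)

locale alg_homomorphism = A: unital_alg A + B: unital_alg B
  for A :: "('f::field, 'a, 'c) module_scheme" and B :: "('f, 'b, 'd) module_scheme" +
  fixes h
  assumes hom: "h \<in> alg_hom A B"
begin

lemma hom_in [simp, intro]: "x \<in> carrier A \<Longrightarrow> h x \<in> carrier B"
  using alg_homD(1)[OF hom] by auto

lemmas hom_simps = alg_homD(2-5)[OF hom]

lemma hom_zero [simp]: "h \<zero>\<^bsub>A\<^esub> = \<zero>\<^bsub>B\<^esub>"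
  using hom_simps(4)[of "\<zero>\<^bsub>A\<^esub>" 0] by simp

lemma hom_finsum:
  assumes "\<And>s. s \<in> S \<Longrightarrow> f s \<in> carrier A"
  shows "h (\<Oplus>\<^bsub>A\<^esub>s\<in>S. f s) = (\<Oplus>\<^bsub>B\<^esub>s\<in>S. h (f s))"
  by (rule additive_finsum) (use assms in \<open>auto simp: hom_simps A.abelian_monoid_axioms B.abelian_monoid_axioms\<close>)

lemma hom_lprod:
  "set xs \<subseteq> carrier A \<Longrightarrow> h (A.lprod xs) = B.lprod (map h xs)"
  by (induction xs) (auto simp: hom_simps)

end

section \<open>Monoid algebras\<close>

abbreviation "single \<equiv> Poly_Mapping.single"
abbreviation "keys \<equiv> Poly_Mapping.keys"
abbreviation "lookup \<equiv> Poly_Mapping.lookup"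

lemma sum_singles: "(\<Sum>x\<in>keys f. single x (lookup f x)) = f"
proof (rule poly_mapping_eqI)
  fix k
  show "lookup (\<Sum>x\<in>keys f.
      single x (lookup f x)) k = lookup f k"
    by (cases "k \<in> keys f")
      (auto simp: lookup_sum lookup_single when_def in_keys_iff)
qed

text \<open>
  All identities between biadditive expressions in the monoid algebra are verified on basis
  elements by this induction, which keeps track of the support.
\<close>

lemma poly_mapping_span_induct [consumes 1, case_names zero add single]:
  fixes f :: "'x \<Rightarrow>\<^sub>0 'f::ring_1"
  assumes "keys f \<subseteq> X" and "P 0"
    and add: "\<And>f g. \<lbrakk>keys f \<subseteq> X; keys g \<subseteq> X; P f; P g\<rbrakk> \<Longrightarrow> P (f + g)"
    and single: "\<And>x c. x \<in> X \<Longrightarrow> P (single x c)"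
  shows "P f"
proof -
  have "keys (\<Sum>x\<in>S. single x (lookup f x)) \<subseteq> X \<and>
      P (\<Sum>x\<in>S. single x (lookup f x))" if "finite S" "S \<subseteq> X" for S
    using that
  proof (induction S rule: finite_induct)
    case empty
    then show ?case using \<open>P 0\<close> by simp
  next
    case (insert x S)
    then show ?case
      using keys_add[of "single x (lookup f x)"
          "\<Sum>x\<in>S. single x (lookup f x)"]
      by (auto intro!: add single split: if_splits)
  qed
  from this[of "keys f"] assms(1) show ?thesis by (simp add: sum_singles)
qed

lemma lookup_map_scale [simp]:
  "lookup (Poly_Mapping.map ((*) (c::'f::field)) f) k = c * lookup f k"
  by (simp add: Poly_Mapping.map.rep_eq when_def)

lemma monoid_alg_simps [simp]:
  "carrier (monoid_alg G) = {f. keys f \<subseteq> carrier G}"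
  "add (monoid_alg G) = (+)" "zero (monoid_alg G) = 0"
  "one (monoid_alg G) = single \<one>\<^bsub>G\<^esub> 1"
  "smult (monoid_alg G) c f = Poly_Mapping.map ((*) c) f"
  by (simp_all add: monoid_alg_def)

text \<open>
  The supports in the definition of the product vary with the factors; additivity becomes
  visible after enlarging them to a common finite set.
\<close>

lemma monoid_alg_mult_superset:
  assumes "finite S" "finite S'" "keys f \<subseteq> S" "keys g \<subseteq> S'"
  shows "f \<otimes>\<^bsub>monoid_alg G\<^esub> g = (\<Sum>x\<in>S. \<Sum>y\<in>S'.
    single (x \<otimes>\<^bsub>G\<^esub> y) (lookup f x * lookup g y))"
proof -
  let ?s = "\<lambda>x y. single (x \<otimes>\<^bsub>G\<^esub> y) (lookup f x * lookup g y)"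
  have "f \<otimes>\<^bsub>monoid_alg G\<^esub> g = (\<Sum>x\<in>keys f. \<Sum>y\<in>keys g. ?s x y)"
    by (simp add: monoid_alg_def)
  also have "\<dots> = (\<Sum>x\<in>keys f. \<Sum>y\<in>S'. ?s x y)"
    using assms by (intro sum.cong sum.mono_neutral_left) (auto simp: in_keys_iff)
  also have "\<dots> = (\<Sum>x\<in>S. \<Sum>y\<in>S'. ?s x y)"
    using assms by (intro sum.mono_neutral_left) (auto simp: in_keys_iff)
  finally show ?thesis .
qed

lemma monoid_alg_mult_add_left:
  "(f + f') \<otimes>\<^bsub>monoid_alg G\<^esub> g = f \<otimes>\<^bsub>monoid_alg G\<^esub> g + f' \<otimes>\<^bsub>monoid_alg G\<^esub> g"
proof -
  let ?S = "keys f \<union> keys f'"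
  show ?thesis
    by (subst (1 2 3) monoid_alg_mult_superset[of ?S "keys g"])
      (use keys_add[of f f'] in \<open>auto simp: lookup_add distrib_right single_add sum.distrib\<close>)
qed

lemma monoid_alg_mult_add_right:
  "g \<otimes>\<^bsub>monoid_alg G\<^esub> (f + f') = g \<otimes>\<^bsub>monoid_alg G\<^esub> f + g \<otimes>\<^bsub>monoid_alg G\<^esub> f'"
proof -
  let ?S = "keys f \<union> keys f'"
  show ?thesis
    by (subst (1 2 3) monoid_alg_mult_superset[of "keys g" ?S])
      (use keys_add[of f f'] in \<open>auto simp: lookup_add distrib_left single_add sum.distrib\<close>)
qed

lemma monoid_alg_mult_single [simp]:
  "single x a \<otimes>\<^bsub>monoid_alg G\<^esub> single y b
    = single (x \<otimes>\<^bsub>G\<^esub> y) (a * b)"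
  by (subst monoid_alg_mult_superset[of "{x}" "{y}"]) auto

lemma monoid_alg_mult_zero [simp]:
  "0 \<otimes>\<^bsub>monoid_alg G\<^esub> f = 0" "f \<otimes>\<^bsub>monoid_alg G\<^esub> 0 = 0"
  by (simp_all add: monoid_alg_def)

lemma keys_uminus [simp]: "keys (- f) = keys (f :: 'x \<Rightarrow>\<^sub>0 'f::ring_1)"
  by (auto simp: in_keys_iff)

lemma keys_sum_subset:
  "(\<And>s. s \<in> S \<Longrightarrow> keys (f s) \<subseteq> X) \<Longrightarrow> keys (\<Sum>s\<in>S. f s) \<subseteq> X"
  by (induction S rule: infinite_finite_induct) (auto dest!: subsetD[OF keys_add])

lemma keys_scale_subset: "keys (Poly_Mapping.map ((*) (c::'f::field)) f) \<subseteq> keys f"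
  by (auto simp: in_keys_iff)

lemma map_scale_zero [simp]: "Poly_Mapping.map ((*) (c::'f::field)) 0 = 0"
  by (rule poly_mapping_eqI) simp

lemma map_scale_add: "Poly_Mapping.map ((*) (c::'f::field)) (f + g)
    = Poly_Mapping.map ((*) c) f + Poly_Mapping.map ((*) c) g"
  by (rule poly_mapping_eqI) (simp add: lookup_add distrib_left)

lemma unital_alg_monoid_alg:
  assumes "monoid G"
  shows "unital_alg (monoid_alg G :: ('f::field, 'a \<Rightarrow>\<^sub>0 'f) module)"
proof -
  interpret G: monoid G by fact
  let ?M = "monoid_alg G :: ('f, 'a \<Rightarrow>\<^sub>0 'f) module"
  note distrib = monoid_alg_mult_add_left monoid_alg_mult_add_right
  have closed: "f \<otimes>\<^bsub>?M\<^esub> g \<in> carrier ?M" if "f \<in> carrier ?M" "g \<in> carrier ?M" for f g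
  proof -
    have "f \<otimes>\<^bsub>?M\<^esub> g = (\<Sum>x\<in>keys f. \<Sum>y\<in>keys g.
        single (x \<otimes>\<^bsub>G\<^esub> y) (lookup f x * lookup g y))"
      by (rule monoid_alg_mult_superset) auto
    also have "keys \<dots> \<subseteq> carrier G"
      using that by (intro keys_sum_subset) auto
    finally show ?thesis by simp
  qed
  have one_left: "\<one>\<^bsub>?M\<^esub> \<otimes>\<^bsub>?M\<^esub> f = f" and one_right: "f \<otimes>\<^bsub>?M\<^esub> \<one>\<^bsub>?M\<^esub> = f" if "f \<in> carrier ?M" for f
    using that[simplified] by (induction rule: poly_mapping_span_induct) (simp_all add: distrib)
  have assoc: "(f \<otimes>\<^bsub>?M\<^esub> g) \<otimes>\<^bsub>?M\<^esub> h = f \<otimes>\<^bsub>?M\<^esub> (g \<otimes>\<^bsub>?M\<^esub> h)"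
    if fgh: "f \<in> carrier ?M" "g \<in> carrier ?M" "h \<in> carrier ?M" for f g h
    using fgh(1)[simplified]
  proof (induction rule: poly_mapping_span_induct)
    case (single x a)
    show ?case using fgh(2)[simplified]
    proof (induction rule: poly_mapping_span_induct)
      case (single y b)
      show ?case using fgh(3)[simplified]
        by (induction rule: poly_mapping_span_induct)
          (use \<open>x \<in> carrier G\<close> \<open>y \<in> carrier G\<close> in \<open>simp_all add: distrib G.m_assoc mult.assoc\<close>)
    qed (simp_all add: distrib)
  qed (simp_all add: distrib)
  have scale_left: "Poly_Mapping.map ((*) c) f \<otimes>\<^bsub>?M\<^esub> g = Poly_Mapping.map ((*) c) (f \<otimes>\<^bsub>?M\<^esub> g)"
    if fg: "f \<in> carrier ?M" "g \<in> carrier ?M" for c f g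
    using fg(1)[simplified]
  proof (induction rule: poly_mapping_span_induct)
    case (single x a)
    show ?case using fg(2)[simplified]
      by (induction rule: poly_mapping_span_induct) (simp_all add: distrib map_scale_add mult.assoc)
  qed (simp_all add: distrib map_scale_add)
  have scale_right: "f \<otimes>\<^bsub>?M\<^esub> Poly_Mapping.map ((*) c) g = Poly_Mapping.map ((*) c) (f \<otimes>\<^bsub>?M\<^esub> g)"
    if fg: "f \<in> carrier ?M" "g \<in> carrier ?M" for c f g
    using fg(1)[simplified]
  proof (induction rule: poly_mapping_span_induct)
    case (single x a)
    show ?case using fg(2)[simplified]
      by (induction rule: poly_mapping_span_induct) (simp_all add: distrib map_scale_add mult.left_commute)
  qed (simp_all add: distrib map_scale_add)
  have "abelian_group ?M"
  proof (rule abelian_groupI)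
    show "\<exists>g\<in>carrier ?M. g \<oplus>\<^bsub>?M\<^esub> f = \<zero>\<^bsub>?M\<^esub>" if "f \<in> carrier ?M" for f
      using that by (intro bexI[of _ "- f"]) auto
  qed (auto simp: algebra_simps dest!: subsetD[OF keys_add])
  moreover have "monoid ?M"
    by (rule monoidI) (use closed one_left one_right assoc in \<open>auto simp del: monoid_alg_simps(4)\<close>, simp)
  ultimately have "ring ?M"
    by (rule ringI) (simp_all add: distrib)
  then show ?thesis
  proof (rule unital_alg.intro, unfold_locales)
    fix c d :: 'f and f g
    assume "f \<in> carrier ?M"
    then show "c \<odot>\<^bsub>?M\<^esub> f \<in> carrier ?M" "1 \<odot>\<^bsub>?M\<^esub> f = f"
      "(c + d) \<odot>\<^bsub>?M\<^esub> f = c \<odot>\<^bsub>?M\<^esub> f \<oplus>\<^bsub>?M\<^esub> d \<odot>\<^bsub>?M\<^esub> f"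
      "c \<odot>\<^bsub>?M\<^esub> (d \<odot>\<^bsub>?M\<^esub> f) = (c * d) \<odot>\<^bsub>?M\<^esub> f"
      using keys_scale_subset[of c f]
      by (auto intro!: poly_mapping_eqI simp: lookup_add algebra_simps)
    show "c \<odot>\<^bsub>?M\<^esub> (f \<oplus>\<^bsub>?M\<^esub> g) = c \<odot>\<^bsub>?M\<^esub> f \<oplus>\<^bsub>?M\<^esub> c \<odot>\<^bsub>?M\<^esub> g"
      by (simp add: map_scale_add)
    assume "g \<in> carrier ?M"
    then show "(c \<odot>\<^bsub>?M\<^esub> f) \<otimes>\<^bsub>?M\<^esub> g = c \<odot>\<^bsub>?M\<^esub> (f \<otimes>\<^bsub>?M\<^esub> g)"
      "f \<otimes>\<^bsub>?M\<^esub> (c \<odot>\<^bsub>?M\<^esub> g) = c \<odot>\<^bsub>?M\<^esub> (f \<otimes>\<^bsub>?M\<^esub> g)"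
      using \<open>f \<in> carrier ?M\<close> scale_left scale_right by simp_all
  qed
qed

lemma monoid_alg_minus [simp]:
  assumes "monoid G" "f \<in> carrier (monoid_alg G)" "g \<in> carrier (monoid_alg G)"
  shows "f \<ominus>\<^bsub>monoid_alg G\<^esub> g = f - g"
proof -
  interpret unital_alg "monoid_alg G" by (rule unital_alg_monoid_alg) fact
  have "\<ominus>\<^bsub>monoid_alg G\<^esub> g = - g"
    by (rule minus_equality) (use assms in auto)
  then show ?thesis by (simp add: a_minus_def)
qed

context unital_alg
begin

text \<open>The linear extension of \<open>\<psi>\<close> from the basis of monoid elements.\<close>

definition monoid_lift :: "('w \<Rightarrow> 'a) \<Rightarrow> ('w \<Rightarrow>\<^sub>0 'f) \<Rightarrow> 'a" where
  "monoid_lift \<psi> f = (\<Oplus>w\<in>keys f. lookup f w \<odot> \<psi> w)"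

lemma monoid_lift_superset:
  assumes "finite S" "keys f \<subseteq> S" "\<And>w. w \<in> S \<Longrightarrow> \<psi> w \<in> carrier A"
  shows "monoid_lift \<psi> f = (\<Oplus>w\<in>S. lookup f w \<odot> \<psi> w)"
  unfolding monoid_lift_def
  by (rule finsum_support[symmetric]) (use assms in \<open>auto simp: in_keys_iff\<close>)

lemma monoid_lift_single [simp]:
  assumes "\<psi> x \<in> carrier A"
  shows "monoid_lift \<psi> (single x c) = c \<odot> \<psi> x"
  using assms by (subst monoid_lift_superset[of "{x}"])
    (auto simp: finsum_singleton[where i = x and A = "{x}" and f = "\<lambda>w. lookup (single x c) w \<odot> \<psi> w", simplified])

text \<open>
  The universal property of the monoid algebra. Multiplicativity is checked on pairs of basis
  elements, where it is that of \<open>\<psi>\<close>.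
\<close>

theorem monoid_lift_hom:
  assumes G: "monoid G" and \<psi>: "\<psi> \<in> hom G A" "\<psi> \<one>\<^bsub>G\<^esub> = \<one>"
  shows "monoid_lift \<psi> \<in> alg_hom (monoid_alg G) A"
proof -
  interpret G: monoid G by fact
  interpret M: unital_alg "monoid_alg G" by (rule unital_alg_monoid_alg) fact
  have \<psi>_in: "\<psi> w \<in> carrier A" if "w \<in> carrier G" for w
    using \<psi> that by (auto simp: hom_def)
  have closed: "monoid_lift \<psi> f \<in> carrier A" if "keys f \<subseteq> carrier G" for f
    unfolding monoid_lift_def using that \<psi>_in by (intro finsum_closed) auto
  have additive: "monoid_lift \<psi> (f + g) = monoid_lift \<psi> f \<oplus> monoid_lift \<psi> g"
    if fg: "keys f \<subseteq> carrier G" "keys g \<subseteq> carrier G" for f g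
  proof -
    let ?S = "keys f \<union> keys g"
    have S: "\<psi> w \<in> carrier A" if "w \<in> ?S" for w using \<psi>_in fg that by auto
    have "monoid_lift \<psi> (f + g) = (\<Oplus>w\<in>?S. lookup (f + g) w \<odot> \<psi> w)"
      "monoid_lift \<psi> f = (\<Oplus>w\<in>?S. lookup f w \<odot> \<psi> w)"
      "monoid_lift \<psi> g = (\<Oplus>w\<in>?S. lookup g w \<odot> \<psi> w)"
      using S keys_add[of f g] by (auto intro!: monoid_lift_superset)
    moreover have "(\<Oplus>w\<in>?S. lookup (f + g) w \<odot> \<psi> w) =
      (\<Oplus>w\<in>?S. lookup f w \<odot> \<psi> w \<oplus> lookup g w \<odot> \<psi> w)"
      using S by (intro finsum_cong') (auto simp: lookup_add smult_add_left)
    ultimately show ?thesis using S by (simp add: finsum_addf Pi_def)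
  qed
  have zero: "monoid_lift \<psi> 0 = \<zero>" by (simp add: monoid_lift_def)
  have mult: "monoid_lift \<psi> (f \<otimes>\<^bsub>monoid_alg G\<^esub> g) = monoid_lift \<psi> f \<otimes> monoid_lift \<psi> g"
    if fg: "keys f \<subseteq> carrier G" "keys g \<subseteq> carrier G" for f g
    using fg(1)
  proof (induction rule: poly_mapping_span_induct)
    case (single x a)
    show ?case using fg(2)
    proof (induction rule: poly_mapping_span_induct)
      case (single y b)
      then show ?case using \<psi> \<open>x \<in> carrier G\<close> \<psi>_in
        by (simp add: hom_def smult_mult_left smult_mult_right smult_smult mult.commute)
    next
      case (add g g')
      then show ?case using \<open>x \<in> carrier G\<close> \<psi>_in
          M.m_closed[of "single x a" g] M.m_closed[of "single x a" g']
        by (simp add: monoid_alg_mult_add_right assms additive closed r_distr)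
    qed (use \<open>x \<in> carrier G\<close> \<psi>_in in \<open>simp_all add: zero\<close>)
  next
    case (add f f')
    then show ?case using fg(2) M.m_closed[of f g] M.m_closed[of f' g]
      by (simp add: monoid_alg_mult_add_left additive closed l_distr)
  qed (use fg(2) closed in \<open>simp_all add: zero\<close>)
  have scale: "monoid_lift \<psi> (Poly_Mapping.map ((*) c) f) = c \<odot> monoid_lift \<psi> f"
    if "keys f \<subseteq> carrier G" for c f
    using that
  proof (induction rule: poly_mapping_span_induct)
    case (add f g)
    then show ?case using keys_scale_subset[of c f] keys_scale_subset[of c g]
      by (simp add: map_scale_add closed smult_add_right additive)
  qed (use \<psi>_in in \<open>simp_all add: zero smult_smult\<close>)
  show ?thesis
    using closed additive mult scale \<psi> by (auto simp: alg_hom_def ring_hom_def)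
qed

end

lemma (in unital_alg) alg_hom_monoid_alg_sum:
  assumes h: "h \<in> alg_hom (monoid_alg G) A" and G: "monoid G"
    and f: "\<And>s. s \<in> S \<Longrightarrow> f s \<in> carrier (monoid_alg G)"
  shows "h (\<Sum>s\<in>S. f s) = (\<Oplus>s\<in>S. h (f s))"
proof -
  interpret M: unital_alg "monoid_alg G" by (rule unital_alg_monoid_alg) fact
  interpret h: alg_homomorphism "monoid_alg G" A h by unfold_locales fact
  have "(\<Oplus>\<^bsub>monoid_alg G\<^esub>s\<in>S. f s) = (\<Sum>s\<in>S. f s)"
  proof (cases "finite S")
    case True
    then show ?thesis using f
      by (induction S rule: finite_induct) (auto simp: M.finsum_insert Pi_def)
  qed (simp add: M.finsum_infinite)
  then show ?thesis using h.hom_finsum[of S f] f by simp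
qed

section \<open>Quotient algebras\<close>

lemma alg_quot_simps [simp]:
  "carrier (alg_quot A I) = carrier (A Quot I)" "mult (alg_quot A I) = mult (A Quot I)"
  "one (alg_quot A I) = one (A Quot I)" "zero (alg_quot A I) = zero (A Quot I)"
  "add (alg_quot A I) = add (A Quot I)"
  by (simp_all add: alg_quot_def)

text \<open>
  The ring axioms concern only the fields that the record shares with the factor ring.
\<close>

lemma ring_alg_quot:
  assumes "ring (A Quot I)"
  shows "ring (alg_quot A I)"
proof -
  interpret Q: ring "A Quot I" by fact
  show ?thesis
  proof (rule ringI)
    show "abelian_group (alg_quot A I)"
    proof (rule abelian_groupI)
      show "\<exists>y\<in>carrier (alg_quot A I). y \<oplus>\<^bsub>alg_quot A I\<^esub> x = \<zero>\<^bsub>alg_quot A I\<^esub>"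
        if "x \<in> carrier (alg_quot A I)" for x
        by (rule bexI[of _ "\<ominus>\<^bsub>A Quot I\<^esub> x"]) (use that in \<open>simp_all add: Q.l_neg\<close>)
    qed (simp_all add: Q.a_ac)
    show "monoid (alg_quot A I)"
      by (rule monoidI) (auto simp: Q.m_assoc)
  qed (auto simp: Q.l_distr Q.r_distr)
qed

locale unital_alg_ideal = unital_alg A + ideal I A
  for A :: "('f::field, 'a, 'c) module_scheme" (structure) and I
begin

abbreviation "Q \<equiv> alg_quot A I"

text \<open>
  A two-sided ideal is a subspace, since \<open>c \<odot> x = (c \<odot> \<one>) \<otimes> x\<close>. This makes the induced
  scalar multiplication well defined.
\<close>

lemma smult_in_ideal:
  assumes "x \<in> I"
  shows "c \<odot> x \<in> I"
proof -
  have "x \<in> carrier A" using assms a_subset by auto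
  then have "c \<odot> x = (c \<odot> \<one>) \<otimes> x" by (simp add: smult_mult_left)
  then show ?thesis using I_l_closed[OF assms, of "c \<odot> \<one>"] by simp
qed

lemma coset_eq_iff:
  assumes "x \<in> carrier A" "y \<in> carrier A"
  shows "I +> x = I +> y \<longleftrightarrow> x \<ominus> y \<in> I"
  using quotient_eq_iff_same_a_r_cos[OF is_ideal] assms by simp

lemma carrier_quot: "carrier Q = (+>) I ` carrier A"
  by (auto simp: FactRing_def A_RCOSETS_def')

lemma proj_ring_hom: "(+>) I \<in> ring_hom A Q"
  using rcos_ring_hom by (simp add: ring_hom_def)

lemma proj_smult:
  assumes "x \<in> carrier A"
  shows "c \<odot>\<^bsub>Q\<^esub> (I +> x) = I +> (c \<odot> x)"
proof -
  have "I +> (c \<odot> y) = I +> (c \<odot> x)" if y: "y \<in> I +> x" for y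
  proof -
    have y_in: "y \<in> carrier A" using y assms a_subset by (auto simp: a_r_coset_def' subset_iff)
    then have "I +> y = I +> x" using a_repr_independence'[OF y] assms by simp
    then have "c \<odot> (y \<ominus> x) \<in> I" using assms y_in coset_eq_iff smult_in_ideal by blast
    moreover have "c \<odot> (y \<ominus> x) = c \<odot> y \<ominus> c \<odot> x"
      using assms y_in by (simp add: smult_minus)
    ultimately show ?thesis using coset_eq_iff y_in assms by simp
  qed
  moreover have "x \<in> I +> x" using assms a_rcos_self by blast
  ultimately have "(\<Union>y\<in>I +> x. I +> (c \<odot> y)) = I +> (c \<odot> x)" by blast
  then show ?thesis by (simp add: alg_quot_def)
qed

theorem proj_hom: "(+>) I \<in> alg_hom A Q"
  using proj_ring_hom proj_smult by (simp add: alg_hom_def)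

theorem unital_alg_quot: "unital_alg Q"
proof -
  note hom = ring_hom_memE[OF proj_ring_hom]
  interpret Qr: ring Q by (rule ring_alg_quot, rule quotient_is_ring)
  show ?thesis
  proof (rule unital_alg.intro, rule Qr.ring_axioms, unfold_locales)
    fix c d X assume "X \<in> carrier Q"
    then obtain x where x: "x \<in> carrier A" "X = I +> x" using carrier_quot by auto
    show "c \<odot>\<^bsub>Q\<^esub> X \<in> carrier Q" "1 \<odot>\<^bsub>Q\<^esub> X = X"
      "(c + d) \<odot>\<^bsub>Q\<^esub> X = c \<odot>\<^bsub>Q\<^esub> X \<oplus>\<^bsub>Q\<^esub> d \<odot>\<^bsub>Q\<^esub> X"
      "c \<odot>\<^bsub>Q\<^esub> (d \<odot>\<^bsub>Q\<^esub> X) = (c * d) \<odot>\<^bsub>Q\<^esub> X"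
      using x by (simp_all add: proj_smult hom(1) smult_add_left smult_smult
          del: alg_quot_simps flip: hom(3))
    fix Y assume "Y \<in> carrier Q"
    then obtain y where y: "y \<in> carrier A" "Y = I +> y" using carrier_quot by auto
    show "c \<odot>\<^bsub>Q\<^esub> (X \<oplus>\<^bsub>Q\<^esub> Y) = c \<odot>\<^bsub>Q\<^esub> X \<oplus>\<^bsub>Q\<^esub> c \<odot>\<^bsub>Q\<^esub> Y"
      "(c \<odot>\<^bsub>Q\<^esub> X) \<otimes>\<^bsub>Q\<^esub> Y = c \<odot>\<^bsub>Q\<^esub> (X \<otimes>\<^bsub>Q\<^esub> Y)"
      "X \<otimes>\<^bsub>Q\<^esub> (c \<odot>\<^bsub>Q\<^esub> Y) = c \<odot>\<^bsub>Q\<^esub> (X \<otimes>\<^bsub>Q\<^esub> Y)"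
      using x y by (simp_all add: proj_smult smult_add_right smult_mult_left smult_mult_right
          del: alg_quot_simps flip: hom(2,3))
  qed
qed

text \<open>
  The induced map evaluates \<open>h\<close> at a chosen representative; two representatives differ by an
  element of the ideal, on which \<open>h\<close> vanishes.
\<close>

theorem factor_through_quot:
  assumes B: "unital_alg B" and h: "h \<in> alg_hom A B" "\<And>x. x \<in> I \<Longrightarrow> h x = \<zero>\<^bsub>B\<^esub>"
  shows "\<exists>h'\<in>alg_hom Q B. \<forall>x\<in>carrier A. h' (I +> x) = h x"
proof -
  interpret B: unital_alg B by fact
  interpret h: alg_homomorphism A B h by unfold_locales fact
  note hom = ring_hom_memE[OF proj_ring_hom]
  define h' where "h' X = h (SOME x. x \<in> carrier A \<and> X = I +> x)" for X
  have h': "h' (I +> x) = h x" if x: "x \<in> carrier A" for x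
  proof -
    let ?y = "SOME y. y \<in> carrier A \<and> I +> x = I +> y"
    have y: "?y \<in> carrier A \<and> I +> x = I +> ?y" by (rule someI[of _ x]) (simp add: x)
    then have "x \<ominus> ?y \<in> I" using coset_eq_iff x by blast
    then have "h (x \<ominus> ?y) = \<zero>\<^bsub>B\<^esub>" by (rule h(2))
    moreover have "x = (x \<ominus> ?y) \<oplus> ?y" using x y by (simp add: minus_eq a_assoc l_neg)
    ultimately have "h x = h ?y"
      using x y h.hom_simps(2)[of "x \<ominus> ?y" ?y] by simp
    then show ?thesis by (simp add: h'_def)
  qed
  have "h' \<in> alg_hom Q B"
    unfolding alg_hom_def
  proof (intro CollectI conjI ring_hom_memI allI ballI)
    fix X assume "X \<in> carrier Q"
    then obtain x where x: "x \<in> carrier A" "X = I +> x" using carrier_quot by auto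
    show "h' X \<in> carrier B" using x h' by simp
    show "h' (c \<odot>\<^bsub>Q\<^esub> X) = c \<odot>\<^bsub>B\<^esub> h' X" for c using x h' by (simp add: proj_smult h.hom_simps)
    fix Y assume "Y \<in> carrier Q"
    then obtain y where y: "y \<in> carrier A" "Y = I +> y" using carrier_quot by auto
    show "h' (X \<otimes>\<^bsub>Q\<^esub> Y) = h' X \<otimes>\<^bsub>B\<^esub> h' Y" "h' (X \<oplus>\<^bsub>Q\<^esub> Y) = h' X \<oplus>\<^bsub>B\<^esub> h' Y"
      using x y h' by (simp_all add: h.hom_simps del: alg_quot_simps flip: hom(2,3))
  next
    show "h' \<one>\<^bsub>Q\<^esub> = \<one>\<^bsub>B\<^esub>"
      using h' by (simp add: h.hom_simps del: alg_quot_simps flip: hom(4))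
  qed
  then show ?thesis using h' by blast
qed

end

text \<open>The kernel is an ideal, so vanishing on generators is enough.\<close>

lemma alg_hom_zero_on_Idl:
  assumes A: "unital_alg A" and B: "unital_alg B" and h: "h \<in> alg_hom A B"
    and S: "S \<subseteq> carrier A" "\<And>x. x \<in> S \<Longrightarrow> h x = \<zero>\<^bsub>B\<^esub>" and x: "x \<in> Idl\<^bsub>A\<^esub> S"
  shows "h x = \<zero>\<^bsub>B\<^esub>"
proof -
  interpret A: unital_alg A by fact
  interpret B: unital_alg B by fact
  interpret h: ring_hom_ring A B h
    by (rule ring_hom_ringI2[OF A.ring_axioms B.ring_axioms]) (use h in \<open>simp add: alg_hom_def\<close>)
  have "S \<subseteq> a_kernel A B h" unfolding a_kernel_def' using S by blast
  then have "Idl\<^bsub>A\<^esub> S \<subseteq> a_kernel A B h"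
    by (rule A.genideal_minimal[OF h.kernel_is_ideal])
  then show ?thesis using x unfolding a_kernel_def' by blast
qed

section \<open>Pairings and the tensor product\<close>

locale alg_pairing = B: unital_alg B + C: unital_alg C + T: unital_alg T
  for B :: "('f::field, 'b, 'bx) module_scheme"
    and C :: "('f, 'c, 'cx) module_scheme"
    and T :: "('f, 't, 'tx) module_scheme" (structure) +
  fixes t :: "'b \<Rightarrow> 'c \<Rightarrow> 't"
  assumes closed [simp, intro]: "\<lbrakk>b \<in> carrier B; c \<in> carrier C\<rbrakk> \<Longrightarrow> t b c \<in> carrier T"
    and add_left: "\<lbrakk>b \<in> carrier B; b' \<in> carrier B; c \<in> carrier C\<rbrakk>
      \<Longrightarrow> t (b \<oplus>\<^bsub>B\<^esub> b') c = t b c \<oplus> t b' c"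
    and add_right: "\<lbrakk>b \<in> carrier B; c \<in> carrier C; c' \<in> carrier C\<rbrakk>
      \<Longrightarrow> t b (c \<oplus>\<^bsub>C\<^esub> c') = t b c \<oplus> t b c'"
    and smult_left: "\<lbrakk>b \<in> carrier B; c \<in> carrier C\<rbrakk> \<Longrightarrow> t (d \<odot>\<^bsub>B\<^esub> b) c = d \<odot> t b c"
    and smult_right: "\<lbrakk>b \<in> carrier B; c \<in> carrier C\<rbrakk> \<Longrightarrow> t b (d \<odot>\<^bsub>C\<^esub> c) = d \<odot> t b c"
    and mult: "\<lbrakk>b \<in> carrier B; b' \<in> carrier B; c \<in> carrier C; c' \<in> carrier C\<rbrakk>
      \<Longrightarrow> t b c \<otimes> t b' c' = t (b \<otimes>\<^bsub>B\<^esub> b') (c \<otimes>\<^bsub>C\<^esub> c')"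
    and one: "t \<one>\<^bsub>B\<^esub> \<one>\<^bsub>C\<^esub> = \<one>"
begin

lemma flip: "alg_pairing C B T (\<lambda>c b. t b c)"
  by unfold_locales (auto simp: add_left add_right smult_left smult_right mult one)

lemma zero_left [simp]: "c \<in> carrier C \<Longrightarrow> t \<zero>\<^bsub>B\<^esub> c = \<zero>"
  using smult_left[of "\<zero>\<^bsub>B\<^esub>" c 0] by simp

lemma zero_right [simp]: "b \<in> carrier B \<Longrightarrow> t b \<zero>\<^bsub>C\<^esub> = \<zero>"
  using smult_right[of b "\<zero>\<^bsub>C\<^esub>" 0] by simp

lemma finsum_left:
  assumes "\<And>s. s \<in> S \<Longrightarrow> f s \<in> carrier B" "c \<in> carrier C"
  shows "t (\<Oplus>\<^bsub>B\<^esub>s\<in>S. f s) c = (\<Oplus>s\<in>S. t (f s) c)"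
  by (rule additive_finsum[where h = "\<lambda>b. t b c"])
    (use assms in \<open>auto simp: add_left B.abelian_monoid_axioms T.abelian_monoid_axioms\<close>)

lemma finsum_right:
  assumes "\<And>s. s \<in> S \<Longrightarrow> f s \<in> carrier C" "b \<in> carrier B"
  shows "t b (\<Oplus>\<^bsub>C\<^esub>s\<in>S. f s) = (\<Oplus>s\<in>S. t b (f s))"
  by (rule additive_finsum)
    (use assms in \<open>auto simp: add_right C.abelian_monoid_axioms T.abelian_monoid_axioms\<close>)

lemma lprod:
  assumes "\<And>x. x \<in> set xs \<Longrightarrow> f x \<in> carrier B" "\<And>x. x \<in> set xs \<Longrightarrow> g x \<in> carrier C"
  shows "T.lprod (map (\<lambda>x. t (f x) (g x)) xs) = t (B.lprod (map f xs)) (C.lprod (map g xs))"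
  using assms
proof (induction xs)
  case (Cons x xs)
  have "B.lprod (map f xs) \<in> carrier B" "C.lprod (map g xs) \<in> carrier C"
    using Cons.prems by (auto intro!: B.lprod_closed C.lprod_closed)
  then show ?case using Cons by (simp add: mult)
qed (simp add: one)

end

text \<open>
  Each relation generating the tensor ideal makes one of the bilinearity laws hold between
  cosets. Multiplicativity and the unit law already hold before passing to the quotient, where
  the basis elements multiply as in the product monoid.
\<close>

theorem alg_pairing_tensor:
  assumes "unital_alg B" "unital_alg C"
  shows "alg_pairing B C (tensor_alg B C) (tensor B C)"
proof -
  interpret B: unital_alg B by fact
  interpret C: unital_alg C by fact
  let ?M = "monoid_alg (B \<times>\<times> C)"
  let ?s = "\<lambda>b c. single (b, c)"
  have mon: "monoid (B \<times>\<times> C)"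
    by (rule DirProd_monoid) unfold_locales
  interpret M: unital_alg ?M by (rule unital_alg_monoid_alg) fact
  have s_in: "?s b c d \<in> carrier ?M" if "b \<in> carrier B" "c \<in> carrier C" for b c d
    using that by (auto simp: DirProd_def)
  have rels: "tensor_rels B C \<subseteq> carrier ?M"
  proof -
    have minus: "f - g \<in> carrier ?M" if "f \<in> carrier ?M" "g \<in> carrier ?M" for f g
      using M.minus_closed[OF that] monoid_alg_minus[OF mon that] by simp
    show ?thesis
      unfolding tensor_rels_def
      by (intro Un_least subsetI; elim CollectE exE conjE; simp only:; intro minus s_in) auto
  qed
  interpret I: ideal "tensor_ideal B C" ?M
    unfolding tensor_ideal_def by (rule M.genideal_ideal[OF rels])
  interpret Q: unital_alg_ideal ?M "tensor_ideal B C" by unfold_locales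
  interpret T: unital_alg "tensor_alg B C"
    unfolding tensor_alg_def by (rule Q.unital_alg_quot)
  have in_ideal: "r \<in> tensor_ideal B C" if "r \<in> tensor_rels B C" for r
    using M.genideal_self[OF rels] that by (auto simp: tensor_ideal_def)
  interpret proj: alg_homomorphism ?M "tensor_alg B C" "(+>\<^bsub>?M\<^esub>) (tensor_ideal B C)"
    by unfold_locales (simp add: tensor_alg_def Q.proj_hom)
  let ?p = "(+>\<^bsub>?M\<^esub>) (tensor_ideal B C)"
  have eqI: "?p f = ?p g" if "f \<in> carrier ?M" "g \<in> carrier ?M" "f - g \<in> tensor_rels B C" for f g
    using that in_ideal Q.coset_eq_iff[OF that(1,2)] monoid_alg_minus[OF mon that(1,2)] by simp
  have p_s: "?p (?s b c d) = d \<odot>\<^bsub>tensor_alg B C\<^esub> tensor B C b c" if "b \<in> carrier B" "c \<in> carrier C" for b c d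
    using proj.hom_simps(4)[OF s_in[OF that], of d 1] by (simp add: tensor_def)
  have p_s2: "?p (?s b c 1 + ?s b' c' 1) = tensor B C b c \<oplus>\<^bsub>tensor_alg B C\<^esub> tensor B C b' c'"
    if "b \<in> carrier B" "c \<in> carrier C" "b' \<in> carrier B" "c' \<in> carrier C" for b c b' c'
    using proj.hom_simps(2)[OF s_in[OF that(1,2)] s_in[OF that(3,4)], of 1 1] by (simp add: tensor_def)
  show ?thesis
  proof unfold_locales
    fix b c d assume bc: "b \<in> carrier B" "c \<in> carrier C"
    show "tensor B C b c \<in> carrier (tensor_alg B C)"
      using bc s_in by (simp add: tensor_def proj.hom_in)
    have "?s (d \<odot>\<^bsub>B\<^esub> b) c 1 - ?s b c d \<in> tensor_rels B C"
      unfolding tensor_rels_def using bc by blast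
    then have "?p (?s (d \<odot>\<^bsub>B\<^esub> b) c 1) = ?p (?s b c d)"
      by (intro eqI s_in B.smult_closed C.smult_closed bc)
    then show "tensor B C (d \<odot>\<^bsub>B\<^esub> b) c = d \<odot>\<^bsub>tensor_alg B C\<^esub> tensor B C b c"
      using p_s[OF bc, of d] by (simp add: tensor_def)
    have "?s b (d \<odot>\<^bsub>C\<^esub> c) 1 - ?s b c d \<in> tensor_rels B C"
      unfolding tensor_rels_def using bc by blast
    then have "?p (?s b (d \<odot>\<^bsub>C\<^esub> c) 1) = ?p (?s b c d)"
      by (intro eqI s_in B.smult_closed C.smult_closed bc)
    then show "tensor B C b (d \<odot>\<^bsub>C\<^esub> c) = d \<odot>\<^bsub>tensor_alg B C\<^esub> tensor B C b c"
      using p_s[OF bc, of d] by (simp add: tensor_def)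
    fix b' assume b': "b' \<in> carrier B"
    have "?s (b \<oplus>\<^bsub>B\<^esub> b') c 1 - ?s b c 1 - ?s b' c 1 \<in> tensor_rels B C"
      unfolding tensor_rels_def using bc b' by blast
    moreover have "?s b c 1 + ?s b' c 1 \<in> carrier ?M"
      using M.a_closed[OF s_in s_in] bc b' by simp
    ultimately have "?p (?s (b \<oplus>\<^bsub>B\<^esub> b') c 1) = ?p (?s b c 1 + ?s b' c 1)"
      by (intro eqI s_in B.a_closed C.a_closed bc b') (simp_all add: diff_diff_eq)
    then show "tensor B C (b \<oplus>\<^bsub>B\<^esub> b') c = tensor B C b c \<oplus>\<^bsub>tensor_alg B C\<^esub> tensor B C b' c"
      using p_s2[OF bc b' bc(2)] by (simp add: tensor_def)
    fix c' assume c': "c' \<in> carrier C"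
    show "tensor B C b c \<otimes>\<^bsub>tensor_alg B C\<^esub> tensor B C b' c' = tensor B C (b \<otimes>\<^bsub>B\<^esub> b') (c \<otimes>\<^bsub>C\<^esub> c')"
      unfolding tensor_def
      by (subst proj.hom_simps(1)[symmetric]) (use bc b' c' s_in in \<open>auto simp: DirProd_def\<close>)
  next
    fix b c c' assume bc: "b \<in> carrier B" "c \<in> carrier C" "c' \<in> carrier C"
    have "?s b (c \<oplus>\<^bsub>C\<^esub> c') 1 - ?s b c 1 - ?s b c' 1 \<in> tensor_rels B C"
      unfolding tensor_rels_def using bc by blast
    moreover have "?s b c 1 + ?s b c' 1 \<in> carrier ?M"
      using M.a_closed[OF s_in s_in] bc by simp
    ultimately have "?p (?s b (c \<oplus>\<^bsub>C\<^esub> c') 1) = ?p (?s b c 1 + ?s b c' 1)"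
      by (intro eqI s_in B.a_closed C.a_closed bc) (simp_all add: diff_diff_eq)
    then show "tensor B C b (c \<oplus>\<^bsub>C\<^esub> c') = tensor B C b c \<oplus>\<^bsub>tensor_alg B C\<^esub> tensor B C b c'"
      using p_s2[OF bc(1,2) bc(1,3)] by (simp add: tensor_def)
  next
    show "tensor B C \<one>\<^bsub>B\<^esub> \<one>\<^bsub>C\<^esub> = \<one>\<^bsub>tensor_alg B C\<^esub>"
      using proj.hom_simps(3) by (simp add: tensor_def DirProd_def)
  qed
qed

section \<open>The hypermatrix relations and the algebra they define\<close>

lemma monoid_word_monoid: "monoid (word_monoid X)"
  by (rule monoidI) (auto simp: word_monoid_def)

lemma unital_alg_free_alg: "unital_alg (free_alg X)"
  unfolding free_alg_def by (rule unital_alg_monoid_alg[OF monoid_word_monoid])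

lemma single_in_free_alg: "set w \<subseteq> X \<Longrightarrow> single w c \<in> carrier (free_alg X)"
  by (auto simp: free_alg_def word_monoid_def)

lemma (in unital_alg) free_alg_universal:
  assumes \<phi>: "\<And>x. x \<in> X \<Longrightarrow> \<phi> x \<in> carrier A"
  shows "\<exists>h\<in>alg_hom (free_alg X) A. \<forall>x\<in>X. h (single [x] 1) = \<phi> x"
proof
  have cl: "lprod (map \<phi> w) \<in> carrier A" if "w \<in> lists X" for w
    using that \<phi> by (intro lprod_closed) auto
  show "monoid_lift (\<lambda>w. lprod (map \<phi> w)) \<in> alg_hom (free_alg X) A"
    unfolding free_alg_def
  proof (rule monoid_lift_hom[OF monoid_word_monoid])
    show "(\<lambda>w. lprod (map \<phi> w)) \<in> hom (word_monoid X) A"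
      unfolding hom_def using \<phi> cl by (auto simp: word_monoid_def intro!: lprod_append)
  qed (simp add: word_monoid_def)
  show "\<forall>x\<in>X. monoid_lift (\<lambda>w. lprod (map \<phi> w)) (single [x] 1) = \<phi> x"
    using \<phi> by simp
qed

lemma finite_splittings:
  assumes "\<And>S. S \<in> set J \<Longrightarrow> finite S"
  shows "finite (splittings J)"
proof -
  let ?L = "{xs. set xs \<subseteq> \<Union>(set J) \<and> length xs = length J}"
  have "splittings J \<subseteq> ?L \<times> ?L"
  proof (clarsimp simp: splittings_def, intro conjI subsetI)
    fix \<alpha> \<beta> x assume *: "length \<alpha> = length J" "length \<beta> = length J" "\<forall>s<length J. {\<alpha> ! s, \<beta> ! s} = J ! s"
    { assume "x \<in> set \<alpha>"
      then obtain s where "s < length J" "x = \<alpha> ! s" using * by (auto simp: in_set_conv_nth)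
      then have "x \<in> J ! s" using * by auto
      then show "x \<in> \<Union>(set J)" using nth_mem[OF \<open>s < length J\<close>] by blast }
    { assume "x \<in> set \<beta>"
      then obtain s where "s < length J" "x = \<beta> ! s" using * by (auto simp: in_set_conv_nth)
      then have "x \<in> J ! s" using * by auto
      then show "x \<in> \<Union>(set J)" using nth_mem[OF \<open>s < length J\<close>] by blast }
  qed
  moreover have "finite ?L" using assms by (intro finite_lists_length_eq) auto
  ultimately show ?thesis by (auto intro: finite_subset)
qed

lemma finite_pair_boxes: "\<lbrakk>J \<in> pair_boxes n N; S \<in> set J\<rbrakk> \<Longrightarrow> finite S"
  by (auto simp: pair_boxes_def intro: finite_subset)

lemma splittings_multi_indices:
  assumes "J \<in> pair_boxes n N" "(\<alpha>, \<beta>) \<in> splittings J"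
  shows "\<alpha> \<in> multi_indices n N" "\<beta> \<in> multi_indices n N"
proof -
  have len: "length J = N" "length \<alpha> = N" "length \<beta> = N"
    and sp: "\<And>s. s < N \<Longrightarrow> {\<alpha> ! s, \<beta> ! s} = J ! s"
    and J: "\<And>s. s < N \<Longrightarrow> J ! s \<subseteq> {1..n}"
    using assms by (auto simp: pair_boxes_def splittings_def)
  then have "\<alpha> ! s \<in> {1..n} \<and> \<beta> ! s \<in> {1..n}" if "s < N" for s
    using sp[OF that] J[OF that] by blast
  then show "\<alpha> \<in> multi_indices n N" "\<beta> \<in> multi_indices n N"
    using len unfolding multi_indices_def by (auto simp: in_set_conv_nth)
qed

lemma finite_multi_indices: "finite (multi_indices n r)"
proof -
  have "multi_indices n r = {xs. set xs \<subseteq> {1..n} \<and> length xs = r}" by (auto simp: multi_indices_def)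
  then show ?thesis by (simp add: finite_lists_length_eq)
qed

lemma insert_at_multi_indices:
  assumes "\<alpha> \<in> multi_indices n N" "i \<in> {1..n}"
  shows "insert_at k i \<alpha> \<in> multi_indices n (Suc N)"
  using assms set_take_subset[of k \<alpha>] set_drop_subset[of k \<alpha>]
  by (auto simp: multi_indices_def insert_at_def min_def)

lemma splittings_insert_at:
  assumes "J \<in> pair_boxes n (M - 1)" "p \<in> splittings J" "i \<in> {1..n}" "0 < M"
  shows "insert_at k i (fst p) \<in> multi_indices n M" "insert_at k i (snd p) \<in> multi_indices n M"
  using insert_at_multi_indices[OF _ assms(3), of _ "M - 1" k]
    splittings_multi_indices[OF assms(1), of "fst p" "snd p"] assms(2,4) by auto

context unital_alg
begin

text \<open>
  The \<open>q\<close>-weighted sum over the splittings of a box, separated from the quadratic monomials so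
  that a box can be cut into two factors (\<open>split_sum_append\<close> below).
\<close>

definition split_sum :: "'f \<Rightarrow> nat set list \<Rightarrow> (nat list \<Rightarrow> nat list \<Rightarrow> 'a) \<Rightarrow> 'a" where
  "split_sum q J G = (\<Oplus>p\<in>splittings J. (- q) ^ inv_pair (fst p) (snd p) \<odot> G (fst p) (snd p))"

definition quad :: "(nat list \<Rightarrow> 'a) \<Rightarrow> 'f \<Rightarrow> nat \<Rightarrow> nat set list \<Rightarrow> nat \<Rightarrow> nat \<Rightarrow> 'a" where
  "quad \<phi> q k J i j = split_sum q J (\<lambda>\<alpha> \<beta>. \<phi> (insert_at k i \<alpha>) \<otimes> \<phi> (insert_at k j \<beta>))"

text \<open>
  The defining relations of the hypermatrix algebra, stated for elements of an arbitrary algebra.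
\<close>

definition hyp_family :: "'f \<Rightarrow> nat \<Rightarrow> nat \<Rightarrow> (nat list \<Rightarrow> 'a) \<Rightarrow> bool" where
  "hyp_family q n M \<phi> \<longleftrightarrow> (\<forall>\<alpha>\<in>multi_indices n M. \<phi> \<alpha> \<in> carrier A) \<and>
     (\<forall>k<M. \<forall>J\<in>pair_boxes n (M - 1). \<forall>i\<in>{1..n}. quad \<phi> q k J i i = \<zero> \<and>
       (\<forall>j\<in>{1..n}. i < j \<longrightarrow> quad \<phi> q k J j i = (- q) \<odot> quad \<phi> q k J i j))"

lemma hyp_familyD:
  assumes "hyp_family q n M \<phi>"
  shows "\<And>\<alpha>. \<alpha> \<in> multi_indices n M \<Longrightarrow> \<phi> \<alpha> \<in> carrier A"
    "\<And>k J i. \<lbrakk>k < M; J \<in> pair_boxes n (M - 1); i \<in> {1..n}\<rbrakk> \<Longrightarrow> quad \<phi> q k J i i = \<zero>"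
    "\<And>k J i j. \<lbrakk>k < M; J \<in> pair_boxes n (M - 1); i \<in> {1..n}; j \<in> {1..n}; i < j\<rbrakk>
      \<Longrightarrow> quad \<phi> q k J j i = (- q) \<odot> quad \<phi> q k J i j"
  using assms by (auto simp: hyp_family_def)

lemma quad_closed:
  assumes "hyp_family q n M \<phi>" "0 < M" "J \<in> pair_boxes n (M - 1)" "i \<in> {1..n}" "j \<in> {1..n}"
  shows "quad \<phi> q k J i j \<in> carrier A"
  unfolding quad_def split_sum_def
  by (intro finsum_closed funcsetI smult_closed m_closed hyp_familyD(1)[OF assms(1)] splittings_insert_at)
    (use assms in auto)

lemma quad_cong:
  assumes "\<And>\<alpha>. \<alpha> \<in> multi_indices n M \<Longrightarrow> \<phi> \<alpha> = \<psi> \<alpha>" "\<And>\<alpha>. \<alpha> \<in> multi_indices n M \<Longrightarrow> \<psi> \<alpha> \<in> carrier A"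
    "0 < M" "J \<in> pair_boxes n (M - 1)" "i \<in> {1..n}" "j \<in> {1..n}"
  shows "quad \<phi> q k J i j = quad \<psi> q k J i j"
  unfolding quad_def split_sum_def
  by (rule finsum_cong') (use assms splittings_insert_at[OF assms(4)] in auto)

text \<open>
  A homomorphism from the free algebra evaluates the defining relations at the images of the
  generators. It is used both for the projection to the hypermatrix algebra and for the
  homomorphisms to be factored through it.
\<close>

lemma hom_quad_sum:
  assumes h: "h \<in> alg_hom (free_alg (multi_indices n M)) A"
    and J: "0 < M" "J \<in> pair_boxes n (M - 1)" "i \<in> {1..n}" "j \<in> {1..n}"
  shows "quad_sum q k J i j \<in> carrier (free_alg (multi_indices n M))"
    "h (quad_sum q k J i j) = quad (\<lambda>\<alpha>. h (single [\<alpha>] 1)) q k J i j"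
proof -
  let ?X = "multi_indices n M"
  let ?F = "free_alg ?X :: ('f, nat list list \<Rightarrow>\<^sub>0 'f) module"
  let ?s = "\<lambda>p. single [insert_at k i (fst p), insert_at k j (snd p)] ((- q) ^ inv_pair (fst p) (snd p))"
  interpret F: unital_alg ?F by (rule unital_alg_free_alg)
  interpret h: alg_homomorphism ?F A h by unfold_locales fact
  have qs: "quad_sum q k J i j = (\<Sum>p\<in>splittings J. ?s p)"
    by (simp add: quad_sum_def case_prod_beta)
  note ins = splittings_insert_at[OF J(2) _ _ J(1)]
  have s_in: "?s p \<in> carrier ?F" if "p \<in> splittings J" for p
    using ins[OF that] J by (intro single_in_free_alg) auto
  show "quad_sum q k J i j \<in> carrier ?F"
    unfolding qs using s_in unfolding free_alg_def by (simp add: keys_sum_subset)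
  have gen_in: "h (single [\<alpha>] 1) \<in> carrier A" if "\<alpha> \<in> ?X" for \<alpha>
    using that by (intro h.hom_in single_in_free_alg) simp
  have "h (quad_sum q k J i j) = (\<Oplus>p\<in>splittings J. h (?s p))"
    unfolding qs using alg_hom_monoid_alg_sum[OF h[unfolded free_alg_def] monoid_word_monoid, of _ ?s] s_in
    by (simp add: free_alg_def)
  also have "\<dots> = quad (\<lambda>\<alpha>. h (single [\<alpha>] 1)) q k J i j"
    unfolding quad_def split_sum_def
  proof (rule finsum_cong')
    fix p assume p: "p \<in> splittings J"
    let ?a = "single [insert_at k i (fst p)] (1::'f)"
    let ?b = "single [insert_at k j (snd p)] (1::'f)"
    have ab: "?a \<in> carrier ?F" "?b \<in> carrier ?F"
      using ins[OF p] J by (auto intro!: single_in_free_alg)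
    have "?s p = (- q) ^ inv_pair (fst p) (snd p) \<odot>\<^bsub>?F\<^esub> (?a \<otimes>\<^bsub>?F\<^esub> ?b)"
      by (simp add: free_alg_def word_monoid_def)
    then show "h (?s p) = (- q) ^ inv_pair (fst p) (snd p) \<odot> (h ?a \<otimes> h ?b)"
      using ab by (simp only: h.hom_simps F.m_closed)
  qed (use ins J in \<open>auto intro!: smult_closed m_closed gen_in simp del: atLeastAtMost_iff\<close>)
  finally show "h (quad_sum q k J i j) = quad (\<lambda>\<alpha>. h (single [\<alpha>] 1)) q k J i j" .
qed

end

locale hypermatrix_algebra =
  fixes q :: "'f::field" and n M :: nat
begin

abbreviation "F \<equiv> free_alg (multi_indices n M) :: ('f, nat list list \<Rightarrow>\<^sub>0 'f) module"
abbreviation "H \<equiv> hyp_alg q n M"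

sublocale F: unital_alg F by (rule unital_alg_free_alg)

text \<open>With the identity as homomorphism, \<open>hom_quad_sum\<close> places the relations in the carrier.\<close>

lemma id_hom: "id \<in> alg_hom F F" by (auto simp: alg_hom_def ring_hom_def)

lemma quad_sum_closed:
  "\<lbrakk>0 < M; J \<in> pair_boxes n (M - 1); i \<in> {1..n}; j \<in> {1..n}\<rbrakk> \<Longrightarrow> quad_sum q k J i j \<in> carrier F"
  by (rule F.hom_quad_sum(1)[OF id_hom])

lemma free_minus: "\<lbrakk>x \<in> carrier F; y \<in> carrier F\<rbrakk> \<Longrightarrow> x - y = x \<ominus>\<^bsub>F\<^esub> y"
  unfolding free_alg_def by (rule monoid_alg_minus[OF monoid_word_monoid, symmetric])

lemma hyp_rels_closed: "hyp_rels q n M \<subseteq> carrier F"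
proof -
  have "quad_sum q k J j i - (- q) \<odot>\<^bsub>F\<^esub> quad_sum q k J i j \<in> carrier F"
    if "k < M" "J \<in> pair_boxes n (M - 1)" "i \<in> {1..n}" "j \<in> {1..n}" for k J i j
    using that quad_sum_closed by (subst free_minus) auto
  then show ?thesis using quad_sum_closed by (auto simp: hyp_rels_def simp del: atLeastAtMost_iff)
qed

sublocale I: unital_alg_ideal F "hyp_ideal q n M"
  unfolding hyp_ideal_def
  by (intro unital_alg_ideal.intro F.unital_alg_axioms F.genideal_ideal hyp_rels_closed)

sublocale H: unital_alg H
  unfolding hyp_alg_def by (rule I.unital_alg_quot)

lemma proj_hom: "(+>\<^bsub>F\<^esub>) (hyp_ideal q n M) \<in> alg_hom F H"
  unfolding hyp_alg_def by (rule I.proj_hom)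

lemma hyp_gen_eq:
  "\<alpha> \<in> multi_indices n M \<Longrightarrow> hyp_gen q n \<alpha> = hyp_ideal q n M +>\<^bsub>F\<^esub> single [\<alpha>] 1"
  by (auto simp: hyp_gen_def multi_indices_def)

text \<open>
  Read from right to left, this produces homomorphisms on the quotient; read from left to right
  and applied to the projection, it shows that the generators satisfy the relations.
\<close>

lemma hom_hyp_rels_iff:
  assumes A: "unital_alg A" and h: "h \<in> alg_hom F A"
    and \<phi>: "\<And>\<alpha>. \<alpha> \<in> multi_indices n M \<Longrightarrow> h (single [\<alpha>] 1) = \<phi> \<alpha>"
  shows "(\<forall>x\<in>hyp_rels q n M. h x = \<zero>\<^bsub>A\<^esub>) \<longleftrightarrow> unital_alg.hyp_family A q n M \<phi>"
proof -
  interpret A: unital_alg A by fact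
  interpret h: alg_homomorphism F A h by unfold_locales fact
  have \<phi>_in: "\<phi> \<alpha> \<in> carrier A" if "\<alpha> \<in> multi_indices n M" for \<alpha>
    using \<phi>[OF that] h.hom_in[OF single_in_free_alg[of "[\<alpha>]" _ 1]] that by simp
  have quad: "h (quad_sum q k J i j) = A.quad \<phi> q k J i j"
    if "k < M" "J \<in> pair_boxes n (M - 1)" "i \<in> {1..n}" "j \<in> {1..n}" for k J i j
    using that A.hom_quad_sum(2)[OF h] A.quad_cong[OF \<phi> \<phi>_in] by simp
  have rel: "h (quad_sum q k J j i - (- q) \<odot>\<^bsub>F\<^esub> quad_sum q k J i j) = \<zero>\<^bsub>A\<^esub> \<longleftrightarrow>
      A.quad \<phi> q k J j i = (- q) \<odot>\<^bsub>A\<^esub> A.quad \<phi> q k J i j"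
    if *: "k < M" "J \<in> pair_boxes n (M - 1)" "i \<in> {1..n}" "j \<in> {1..n}" for k J i j
  proof -
    have M: "0 < M" using * by simp
    note cl = quad_sum_closed[OF M *(2)]
    let ?x = "quad_sum q k J j i" and ?y = "(- q) \<odot>\<^bsub>F\<^esub> quad_sum q k J i j"
    have in_F: "?x \<in> carrier F" "?y \<in> carrier F" using cl * by auto
    have "h ?x = h (?x \<ominus>\<^bsub>F\<^esub> ?y) \<oplus>\<^bsub>A\<^esub> h ?y"
      using in_F by (subst h.hom_simps(2)[symmetric]) (auto simp: F.minus_eq F.a_assoc F.l_neg)
    moreover have "h ?x = A.quad \<phi> q k J j i" "h ?y = (- q) \<odot>\<^bsub>A\<^esub> A.quad \<phi> q k J i j"
      using quad * in_F cl by (auto simp: h.hom_simps)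
    moreover have "h (?x \<ominus>\<^bsub>F\<^esub> ?y) \<in> carrier A" "h ?y \<in> carrier A" using in_F by auto
    ultimately show ?thesis
      using in_F by (simp only: free_minus) (metis A.add.r_cancel_one' A.l_zero)
  qed
  show ?thesis
  proof
    assume L: "\<forall>x\<in>hyp_rels q n M. h x = \<zero>\<^bsub>A\<^esub>"
    show "A.hyp_family q n M \<phi>"
      unfolding A.hyp_family_def
    proof (intro conjI ballI allI impI \<phi>_in)
      fix k J i assume *: "k < M" "J \<in> pair_boxes n (M - 1)" "i \<in> {1..n}"
      then have "quad_sum q k J i i \<in> hyp_rels q n M" unfolding hyp_rels_def by blast
      then show "A.quad \<phi> q k J i i = \<zero>\<^bsub>A\<^esub>" using L quad * by metis
      fix j assume j: "j \<in> {1..n}" "i < j"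
      then have "quad_sum q k J j i - (- q) \<odot>\<^bsub>F\<^esub> quad_sum q k J i j \<in> hyp_rels q n M"
        unfolding hyp_rels_def using * by blast
      then show "A.quad \<phi> q k J j i = (- q) \<odot>\<^bsub>A\<^esub> A.quad \<phi> q k J i j" using L rel * j by metis
    qed
  next
    assume R: "A.hyp_family q n M \<phi>"
    show "\<forall>x\<in>hyp_rels q n M. h x = \<zero>\<^bsub>A\<^esub>"
      unfolding hyp_rels_def
    proof (intro ballI, elim UnE CollectE exE conjE)
      fix x k J i assume "x = quad_sum q k J i i" "k < M" "J \<in> pair_boxes n (M - 1)" "i \<in> {1..n}"
      then show "h x = \<zero>\<^bsub>A\<^esub>" using quad A.hyp_familyD(2)[OF R] by simp
    next
      fix x k J i j
      assume "x = quad_sum q k J j i - (- q) \<odot>\<^bsub>F\<^esub> quad_sum q k J i j" "k < M"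
        "J \<in> pair_boxes n (M - 1)" "i \<in> {1..n}" "j \<in> {1..n}" "i < j"
      then show "h x = \<zero>\<^bsub>A\<^esub>" using rel A.hyp_familyD(3)[OF R] by metis
    qed
  qed
qed

text \<open>The projection kills the relations, so by \<open>hom_hyp_rels_iff\<close> the generators satisfy them.\<close>

theorem hyp_gen_family: "H.hyp_family q n M (hyp_gen q n)"
proof (subst hom_hyp_rels_iff[symmetric, OF H.unital_alg_axioms proj_hom])
  show "\<forall>x\<in>hyp_rels q n M. hyp_ideal q n M +>\<^bsub>F\<^esub> x = \<zero>\<^bsub>H\<^esub>"
  proof
    fix x assume x: "x \<in> hyp_rels q n M"
    then have "x \<in> hyp_ideal q n M" using F.genideal_self[OF hyp_rels_closed] by (auto simp: hyp_ideal_def)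
    then show "hyp_ideal q n M +>\<^bsub>F\<^esub> x = \<zero>\<^bsub>H\<^esub>"
      by (simp add: hyp_alg_def FactRing_def I.a_rcos_const)
  qed
qed (simp add: hyp_gen_eq)

theorem hyp_alg_universal:
  assumes A: "unital_alg A" and \<phi>: "unital_alg.hyp_family A q n M \<phi>"
  shows "\<exists>h\<in>alg_hom H A. \<forall>\<alpha>\<in>multi_indices n M. h (hyp_gen q n \<alpha>) = \<phi> \<alpha>"
proof -
  interpret A: unital_alg A by fact
  obtain h where h: "h \<in> alg_hom F A" "\<And>\<alpha>. \<alpha> \<in> multi_indices n M \<Longrightarrow> h (single [\<alpha>] 1) = \<phi> \<alpha>"
    using A.free_alg_universal[of "multi_indices n M" \<phi>] A.hyp_familyD(1)[OF \<phi>] by blast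
  have "\<forall>x\<in>hyp_rels q n M. h x = \<zero>\<^bsub>A\<^esub>" using hom_hyp_rels_iff[OF A h] \<phi> by simp
  then have "h x = \<zero>\<^bsub>A\<^esub>" if "x \<in> hyp_ideal q n M" for x
    using alg_hom_zero_on_Idl[OF F.unital_alg_axioms A h(1) hyp_rels_closed] that
    by (auto simp: hyp_ideal_def)
  then obtain h' where h': "h' \<in> alg_hom H A" "\<forall>x\<in>carrier F. h' (hyp_ideal q n M +>\<^bsub>F\<^esub> x) = h x"
    using I.factor_through_quot[OF A h(1)] unfolding hyp_alg_def by blast
  have "h' (hyp_gen q n \<alpha>) = \<phi> \<alpha>" if \<alpha>: "\<alpha> \<in> multi_indices n M" for \<alpha>
  proof -
    have "single [\<alpha>] 1 \<in> carrier F" using \<alpha> by (intro single_in_free_alg) simp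
    then show ?thesis using h' h(2) \<alpha> by (simp add: hyp_gen_eq)
  qed
  then show ?thesis using h' by blast
qed

end

section \<open>Convolution of hypermatrix families\<close>

lemma splittings_lengths: "(\<alpha>, \<beta>) \<in> splittings J \<Longrightarrow> length \<alpha> = length J \<and> length \<beta> = length J"
  by (auto simp: splittings_def)

lemma inv_pair_append:
  assumes "length \<alpha> = length \<beta>"
  shows "inv_pair (\<alpha> @ \<alpha>') (\<beta> @ \<beta>') = inv_pair \<alpha> \<beta> + inv_pair \<alpha>' \<beta>'"
proof -
  let ?N = "length \<alpha>"
  let ?P = "{s. s < length \<alpha> \<and> \<alpha> ! s > \<beta> ! s}" and ?R = "{s. s < length \<alpha>' \<and> \<alpha>' ! s > \<beta>' ! s}"
  have "{s. s < length (\<alpha> @ \<alpha>') \<and> (\<alpha> @ \<alpha>') ! s > (\<beta> @ \<beta>') ! s} = ?P \<union> (+) ?N ` ?R" (is "?L = _")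
  proof (intro subset_antisym subsetI)
    fix s assume s: "s \<in> ?L"
    show "s \<in> ?P \<union> (+) ?N ` ?R"
    proof (cases "s < ?N")
      case True
      then show ?thesis using s assms by (simp add: nth_append)
    next
      case False
      then have "s - ?N \<in> ?R" "s = ?N + (s - ?N)" using s assms by (auto simp: nth_append)
      then show ?thesis by blast
    qed
  qed (auto simp: nth_append assms)
  moreover have "card (?P \<union> (+) ?N ` ?R) = card ?P + card ((+) ?N ` ?R)"
    by (rule card_Un_disjoint) auto
  moreover have "card ((+) ?N ` ?R) = card ?R" by (rule card_image) simp
  ultimately show ?thesis by (simp add: inv_pair_def)
qed

text \<open>In terms of \<open>map2\<close>, concatenation of boxes is immediate.\<close>

lemma splittings_iff:
  "(\<alpha>, \<beta>) \<in> splittings J \<longleftrightarrow> length \<alpha> = length \<beta> \<and> map2 (\<lambda>a b. {a, b}) \<alpha> \<beta> = J"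
  by (auto simp: splittings_def list_eq_iff_nth_eq simp del: insert_iff)

lemma bij_splittings_append:
  "bij_betw (\<lambda>((\<alpha>, \<beta>), (\<alpha>', \<beta>')). (\<alpha> @ \<alpha>', \<beta> @ \<beta>')) (splittings J \<times> splittings J') (splittings (J @ J'))"
proof (rule bij_betwI[where g = "\<lambda>(\<gamma>, \<delta>). ((take (length J) \<gamma>, take (length J) \<delta>), (drop (length J) \<gamma>, drop (length J) \<delta>))"])
  show "(\<lambda>(\<gamma>, \<delta>). ((take (length J) \<gamma>, take (length J) \<delta>), (drop (length J) \<gamma>, drop (length J) \<delta>)))
      \<in> splittings (J @ J') \<rightarrow> splittings J \<times> splittings J'"
    by (auto simp: splittings_iff simp flip: take_zip drop_zip take_map drop_map)
qed (auto simp: splittings_iff)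

lemma splittings_pair:
  assumes "u \<noteq> v"
  shows "splittings [{u, v}] = {([u], [v]), ([v], [u])}"
proof -
  have "p \<in> splittings [{u, v}] \<longleftrightarrow> p = ([u], [v]) \<or> p = ([v], [u])" for p
    using assms by (cases p) (auto simp: splittings_def length_Suc_conv doubleton_eq_iff)
  then show ?thesis by auto
qed

context unital_alg
begin

lemma split_sum_closed [intro]:
  "(\<And>\<alpha> \<beta>. (\<alpha>, \<beta>) \<in> splittings J \<Longrightarrow> G \<alpha> \<beta> \<in> carrier A) \<Longrightarrow> split_sum q J G \<in> carrier A"
  unfolding split_sum_def by (intro finsum_closed) auto

lemma split_sum_cong:
  assumes "\<And>\<alpha> \<beta>. (\<alpha>, \<beta>) \<in> splittings J \<Longrightarrow> G \<alpha> \<beta> = G' \<alpha> \<beta>"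
    "\<And>\<alpha> \<beta>. (\<alpha>, \<beta>) \<in> splittings J \<Longrightarrow> G' \<alpha> \<beta> \<in> carrier A"
  shows "split_sum q J G = split_sum q J G'"
  unfolding split_sum_def by (rule finsum_cong') (use assms in auto)

lemma split_sum_finsum:
  assumes "finite X" "\<And>S. S \<in> set J \<Longrightarrow> finite S"
    "\<And>x \<alpha> \<beta>. x \<in> X \<Longrightarrow> (\<alpha>, \<beta>) \<in> splittings J \<Longrightarrow> G x \<alpha> \<beta> \<in> carrier A"
  shows "split_sum q J (\<lambda>\<alpha> \<beta>. \<Oplus>x\<in>X. G x \<alpha> \<beta>) = (\<Oplus>x\<in>X. split_sum q J (G x))"
proof -
  have "split_sum q J (\<lambda>\<alpha> \<beta>. \<Oplus>x\<in>X. G x \<alpha> \<beta>)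
      = (\<Oplus>p\<in>splittings J. \<Oplus>x\<in>X. (- q) ^ inv_pair (fst p) (snd p) \<odot> G x (fst p) (snd p))"
    unfolding split_sum_def by (rule finsum_cong') (use assms in \<open>auto simp: smult_finsum\<close>)
  also have "\<dots> = (\<Oplus>x\<in>X. split_sum q J (G x))"
    unfolding split_sum_def using assms by (intro finsum_swap finite_splittings) auto
  finally show ?thesis .
qed

lemma split_sum_add:
  assumes "\<And>\<alpha> \<beta>. (\<alpha>, \<beta>) \<in> splittings J \<Longrightarrow> G \<alpha> \<beta> \<in> carrier A"
    "\<And>\<alpha> \<beta>. (\<alpha>, \<beta>) \<in> splittings J \<Longrightarrow> G' \<alpha> \<beta> \<in> carrier A"
  shows "split_sum q J (\<lambda>\<alpha> \<beta>. G \<alpha> \<beta> \<oplus> G' \<alpha> \<beta>) = split_sum q J G \<oplus> split_sum q J G'"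
proof -
  have "split_sum q J (\<lambda>\<alpha> \<beta>. G \<alpha> \<beta> \<oplus> G' \<alpha> \<beta>) = (\<Oplus>p\<in>splittings J.
      (- q) ^ inv_pair (fst p) (snd p) \<odot> G (fst p) (snd p) \<oplus> (- q) ^ inv_pair (fst p) (snd p) \<odot> G' (fst p) (snd p))"
    unfolding split_sum_def by (rule finsum_cong') (use assms in \<open>auto simp: smult_add_right\<close>)
  also have "\<dots> = split_sum q J G \<oplus> split_sum q J G'"
    unfolding split_sum_def by (rule finsum_addf) (use assms in auto)
  finally show ?thesis .
qed

lemma split_sum_smult:
  assumes "\<And>\<alpha> \<beta>. (\<alpha>, \<beta>) \<in> splittings J \<Longrightarrow> G \<alpha> \<beta> \<in> carrier A"
  shows "split_sum q J (\<lambda>\<alpha> \<beta>. c \<odot> G \<alpha> \<beta>) = c \<odot> split_sum q J G"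
  unfolding split_sum_def using assms
  by (subst smult_finsum) (auto simp: smult_smult mult.commute intro!: finsum_cong')

text \<open>A weighted sum over a product of boxes is iterated, because \<open>inv_pair\<close> is additive.\<close>

lemma split_sum_append:
  assumes fin: "\<And>S. S \<in> set J \<union> set J' \<Longrightarrow> finite S"
    and G: "\<And>\<alpha> \<beta> \<alpha>' \<beta>'. \<lbrakk>(\<alpha>, \<beta>) \<in> splittings J; (\<alpha>', \<beta>') \<in> splittings J'\<rbrakk> \<Longrightarrow> G (\<alpha> @ \<alpha>') (\<beta> @ \<beta>') \<in> carrier A"
  shows "split_sum q (J @ J') G = split_sum q J (\<lambda>\<alpha> \<beta>. split_sum q J' (\<lambda>\<alpha>' \<beta>'. G (\<alpha> @ \<alpha>') (\<beta> @ \<beta>')))"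
proof -
  let ?i = "\<lambda>p. (- q) ^ inv_pair (fst p) (snd p)"
  let ?G = "\<lambda>p p'. G (fst p @ fst p') (snd p @ snd p')"
  let ?h = "\<lambda>((\<alpha>, \<beta>), (\<alpha>', \<beta>')). (\<alpha> @ \<alpha>', \<beta> @ \<beta>')"
  have G': "?G p p' \<in> carrier A" if "p \<in> splittings J" "p' \<in> splittings J'" for p p'
    using G[of "fst p" "snd p" "fst p'" "snd p'"] that by simp
  have inv: "?i (?h (p, p')) = ?i p * ?i p'" if "p \<in> splittings J" for p p'
    using that splittings_lengths[of "fst p" "snd p" J]
    by (simp add: case_prod_beta inv_pair_append power_add)
  have *: "G (fst p) (snd p) \<in> carrier A" if "p \<in> splittings (J @ J')" for p
  proof -
    have "p \<in> ?h ` (splittings J \<times> splittings J')"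
      using bij_splittings_append[of J J'] that by (simp add: bij_betw_def)
    then show ?thesis using G by auto
  qed
  have "split_sum q (J @ J') G = (\<Oplus>x\<in>splittings J \<times> splittings J'. ?i (?h x) \<odot> G (fst (?h x)) (snd (?h x)))"
    unfolding split_sum_def using * by (intro finsum_bij[OF bij_splittings_append]) auto
  also have "\<dots> = (\<Oplus>x\<in>splittings J \<times> splittings J'. ?i (fst x) \<odot> (?i (snd x) \<odot> ?G (fst x) (snd x)))"
  proof (rule finsum_cong', rule refl)
    fix x assume x: "x \<in> splittings J \<times> splittings J'"
    then have "?i (?h x) = ?i (fst x) * ?i (snd x)" using inv[of "fst x" "snd x"] by auto
    then show "?i (?h x) \<odot> G (fst (?h x)) (snd (?h x)) = ?i (fst x) \<odot> (?i (snd x) \<odot> ?G (fst x) (snd x))"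
      using x G'[of "fst x" "snd x"] by (auto simp: smult_smult)
  qed (use G' in auto)
  also have "\<dots> = (\<Oplus>p\<in>splittings J. \<Oplus>p'\<in>splittings J'. ?i p \<odot> (?i p' \<odot> ?G p p'))"
    using fin G' by (intro finsum_cartesian finite_splittings) auto
  also have "\<dots> = (\<Oplus>p\<in>splittings J. ?i p \<odot> (\<Oplus>p'\<in>splittings J'. ?i p' \<odot> ?G p p'))"
    using G' by (intro finsum_cong' smult_finsum[symmetric]) auto
  finally show ?thesis by (simp add: split_sum_def)
qed

lemma split_sum_pair:
  assumes "u < v" "G [u] [v] \<in> carrier A" "G [v] [u] \<in> carrier A"
  shows "split_sum q [{u, v}] G = G [u] [v] \<oplus> (- q) \<odot> G [v] [u]"
proof -
  have "{s. s < length [u] \<and> [u] ! s > [v] ! s} = {}" "{s. s < length [v] \<and> [v] ! s > [u] ! s} = {0}"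
    using assms by auto
  then have "inv_pair [u] [v] = 0" "inv_pair [v] [u] = 1"
    unfolding inv_pair_def by (simp_all only: card.empty card_1_singleton_iff) auto
  then show ?thesis
    using assms by (simp add: split_sum_def splittings_pair)
qed

end

lemma (in abelian_monoid) finsum_pairs:
  fixes X :: "'i::linorder set"
  assumes "finite X" "\<And>u v. u \<in> X \<Longrightarrow> v \<in> X \<Longrightarrow> f u v \<in> carrier G" "\<And>u. u \<in> X \<Longrightarrow> f u u = \<zero>"
  shows "(\<Oplus>p\<in>X \<times> X. f (fst p) (snd p))
    = (\<Oplus>p\<in>{p \<in> X \<times> X. fst p < snd p}. f (fst p) (snd p) \<oplus> f (snd p) (fst p))"
proof -
  let ?L = "{p \<in> X \<times> X. fst p < snd p}" and ?R = "{p \<in> X \<times> X. snd p < fst p}"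
  have fin: "finite ?L" "finite ?R" using assms(1) by auto
  have "(\<Oplus>p\<in>X \<times> X. f (fst p) (snd p)) = (\<Oplus>p\<in>?L \<union> ?R. f (fst p) (snd p))"
  proof (rule finsum_support)
    fix p assume "p \<in> X \<times> X - (?L \<union> ?R)"
    then have "fst p = snd p" "fst p \<in> X" by auto
    then show "f (fst p) (snd p) = \<zero>" using assms(3) by simp
  qed (use assms in auto)
  also have "\<dots> = (\<Oplus>p\<in>?L. f (fst p) (snd p)) \<oplus> (\<Oplus>p\<in>?R. f (fst p) (snd p))"
    by (rule finsum_Un_disjoint) (use fin assms in auto)
  also have "(\<Oplus>p\<in>?R. f (fst p) (snd p)) = (\<Oplus>p\<in>?L. f (snd p) (fst p))"
  proof -
    have "bij_betw prod.swap ?L ?R" by (rule bij_betwI[where g = prod.swap]) auto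
    from finsum_bij[OF this, of "\<lambda>p. f (fst p) (snd p)"] show ?thesis using assms by auto
  qed
  also have "(\<Oplus>p\<in>?L. f (fst p) (snd p)) \<oplus> (\<Oplus>p\<in>?L. f (snd p) (fst p))
      = (\<Oplus>p\<in>?L. f (fst p) (snd p) \<oplus> f (snd p) (fst p))"
    by (rule finsum_addf[symmetric]) (use assms in auto)
  finally show ?thesis .
qed

context alg_pairing
begin

text \<open>
  The collapse of a double sum whose right factors satisfy the \<open>q\<close>-exchange relation, with
  \<open>c = -q\<close>: the terms \<open>(u, v)\<close> and \<open>(v, u)\<close> merge and the diagonal disappears.
\<close>

lemma antisymmetric_right:
  fixes X :: "'i::linorder set"
  assumes "finite X" and P: "\<And>u v. u \<in> X \<Longrightarrow> v \<in> X \<Longrightarrow> P u v \<in> carrier B"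
    and R: "\<And>u v. u \<in> X \<Longrightarrow> v \<in> X \<Longrightarrow> R u v \<in> carrier C" "\<And>u. u \<in> X \<Longrightarrow> R u u = \<zero>\<^bsub>C\<^esub>"
      "\<And>u v. u \<in> X \<Longrightarrow> v \<in> X \<Longrightarrow> u < v \<Longrightarrow> R v u = c \<odot>\<^bsub>C\<^esub> R u v"
  shows "(\<Oplus>p\<in>X \<times> X. t (P (fst p) (snd p)) (R (fst p) (snd p)))
    = (\<Oplus>p\<in>{p \<in> X \<times> X. fst p < snd p}.
        t (P (fst p) (snd p) \<oplus>\<^bsub>B\<^esub> c \<odot>\<^bsub>B\<^esub> P (snd p) (fst p)) (R (fst p) (snd p)))"
proof -
  let ?L = "{p \<in> X \<times> X. fst p < snd p}"
  have "(\<Oplus>p\<in>X \<times> X. t (P (fst p) (snd p)) (R (fst p) (snd p)))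
    = (\<Oplus>p\<in>?L. t (P (fst p) (snd p)) (R (fst p) (snd p)) \<oplus> t (P (snd p) (fst p)) (R (snd p) (fst p)))"
    by (rule T.finsum_pairs[where f = "\<lambda>u v. t (P u v) (R u v)"]) (use assms in auto)
  also have "\<dots> = (\<Oplus>p\<in>?L. t (P (fst p) (snd p) \<oplus>\<^bsub>B\<^esub> c \<odot>\<^bsub>B\<^esub> P (snd p) (fst p)) (R (fst p) (snd p)))"
    by (rule T.finsum_cong') (use P R in \<open>auto simp: add_left smult_left smult_right\<close>)
  finally show ?thesis .
qed

lemma split_sum_pairing:
  assumes "\<And>S. S \<in> set J \<union> set J' \<Longrightarrow> finite S"
    and f: "\<And>\<alpha> \<beta>. (\<alpha>, \<beta>) \<in> splittings J \<Longrightarrow> f \<alpha> \<beta> \<in> carrier B"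
    and g: "\<And>\<alpha> \<beta>. (\<alpha>, \<beta>) \<in> splittings J' \<Longrightarrow> g \<alpha> \<beta> \<in> carrier C"
  shows "T.split_sum q J (\<lambda>\<alpha> \<beta>. T.split_sum q J' (\<lambda>\<alpha>' \<beta>'. t (f \<alpha> \<beta>) (g \<alpha>' \<beta>')))
    = t (B.split_sum q J f) (C.split_sum q J' g)"
proof -
  have inner: "t b (C.split_sum q J' g) = T.split_sum q J' (\<lambda>\<alpha>' \<beta>'. t b (g \<alpha>' \<beta>'))" if "b \<in> carrier B" for b
    unfolding C.split_sum_def T.split_sum_def using that g
    by (subst finsum_right) (auto simp: smult_right intro!: T.finsum_cong')
  have "t (B.split_sum q J f) (C.split_sum q J' g) = T.split_sum q J (\<lambda>\<alpha> \<beta>. t (f \<alpha> \<beta>) (C.split_sum q J' g))"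
    unfolding B.split_sum_def T.split_sum_def using f C.split_sum_closed[of J' g q] g
    by (subst finsum_left) (auto simp: smult_left intro!: T.finsum_cong')
  also have "\<dots> = T.split_sum q J (\<lambda>\<alpha> \<beta>. T.split_sum q J' (\<lambda>\<alpha>' \<beta>'. t (f \<alpha> \<beta>) (g \<alpha>' \<beta>')))"
    using f g by (intro T.split_sum_cong T.split_sum_closed) (auto simp: inner)
  finally show ?thesis by simp
qed

definition convolve :: "nat \<Rightarrow> nat \<Rightarrow> (nat list \<Rightarrow> 'b) \<Rightarrow> (nat list \<Rightarrow> 'c) \<Rightarrow> nat list \<Rightarrow> 't" where
  "convolve n m \<phi> \<psi> \<gamma> = (\<Oplus>u\<in>{1..n}. t (\<phi> (take m \<gamma> @ [u])) (\<psi> (u # drop m \<gamma>)))"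

lemma finsum_mult_finsum:
  assumes "finite X" and f: "\<And>u. u \<in> X \<Longrightarrow> f u \<in> carrier T" "\<And>u. u \<in> X \<Longrightarrow> g u \<in> carrier T"
  shows "(\<Oplus>u\<in>X. f u) \<otimes> (\<Oplus>u\<in>X. g u) = (\<Oplus>p\<in>X \<times> X. f (fst p) \<otimes> g (snd p))"
proof -
  have "(\<Oplus>u\<in>X. f u) \<otimes> (\<Oplus>u\<in>X. g u) = (\<Oplus>u\<in>X. f u \<otimes> (\<Oplus>v\<in>X. g v))"
    using assms by (intro T.finsum_mult_distrib_right) auto
  also have "\<dots> = (\<Oplus>u\<in>X. \<Oplus>v\<in>X. f u \<otimes> g v)"
    using assms by (intro T.finsum_cong' T.finsum_mult_distrib_left) auto
  also have "\<dots> = (\<Oplus>p\<in>X \<times> X. f (fst p) \<otimes> g (snd p))"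
    using assms by (subst T.finsum_cartesian) auto
  finally show ?thesis .
qed

text \<open>
  Separation of the quadratic sum of a convolution into a pairing of two sums. The functions
  \<open>e1\<close> and \<open>e2\<close> place the distinguished index: for a direction on the left of the cut \<open>e1\<close>
  inserts it and \<open>e2\<close> does nothing, for one on the right it is the other way round.
\<close>

lemma quad_convolve:
  fixes q :: 'f
  assumes J: "J' \<in> pair_boxes n N'" "J'' \<in> pair_boxes n N''"
    and \<phi>: "\<And>\<alpha>. \<alpha> \<in> multi_indices n (Suc m) \<Longrightarrow> \<phi> \<alpha> \<in> carrier B"
    and \<psi>: "\<And>\<alpha>. \<alpha> \<in> multi_indices n (Suc l) \<Longrightarrow> \<psi> \<alpha> \<in> carrier C"
    and ij: "i \<in> {1..n}" "j \<in> {1..n}"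
    and e: "\<And>i \<alpha> \<beta>. \<lbrakk>length \<alpha> = N'; length \<beta> = N''\<rbrakk> \<Longrightarrow> insert_at k i (\<alpha> @ \<beta>) = e1 i \<alpha> @ e2 i \<beta>"
    and e1: "\<And>i \<alpha>. \<lbrakk>i \<in> {1..n}; \<alpha> \<in> multi_indices n N'\<rbrakk> \<Longrightarrow> e1 i \<alpha> \<in> multi_indices n m"
    and e2: "\<And>i \<alpha>. \<lbrakk>i \<in> {1..n}; \<alpha> \<in> multi_indices n N''\<rbrakk> \<Longrightarrow> e2 i \<alpha> \<in> multi_indices n l"
  defines "P \<equiv> \<lambda>u v. B.split_sum q J' (\<lambda>\<alpha> \<beta>. \<phi> (e1 i \<alpha> @ [u]) \<otimes>\<^bsub>B\<^esub> \<phi> (e1 j \<beta> @ [v]))"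
    and "R \<equiv> \<lambda>u v. C.split_sum q J'' (\<lambda>\<alpha> \<beta>. \<psi> (u # e2 i \<alpha>) \<otimes>\<^bsub>C\<^esub> \<psi> (v # e2 j \<beta>))"
  shows "T.quad (convolve n m \<phi> \<psi>) q k (J' @ J'') i j
      = (\<Oplus>p\<in>{1..n} \<times> {1..n}. t (P (fst p) (snd p)) (R (fst p) (snd p)))"
    "\<And>u v. u \<in> {1..n} \<Longrightarrow> v \<in> {1..n} \<Longrightarrow> P u v \<in> carrier B \<and> R u v \<in> carrier C"
proof -
  let ?X = "{1..n}" and ?\<Phi> = "convolve n m \<phi> \<psi>"
  have fin: "finite S" if "S \<in> set J' \<union> set J''" for S
    using J that by (auto simp: pair_boxes_def intro: finite_subset)
  have \<phi>1: "\<phi> (e1 i' \<alpha> @ [u]) \<in> carrier B" if "i' \<in> ?X" "\<alpha> \<in> multi_indices n N'" "u \<in> ?X" for i' \<alpha> u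
    using \<phi> e1[OF that(1,2)] that(3) by (auto simp: multi_indices_def)
  have \<psi>1: "\<psi> (u # e2 i' \<alpha>) \<in> carrier C" if "i' \<in> ?X" "\<alpha> \<in> multi_indices n N''" "u \<in> ?X" for i' \<alpha> u
    using \<psi> e2[OF that(1,2)] that(3) by (auto simp: multi_indices_def)
  note mi = splittings_multi_indices[OF J(1)] splittings_multi_indices[OF J(2)]
  show PR: "P u v \<in> carrier B \<and> R u v \<in> carrier C" if "u \<in> ?X" "v \<in> ?X" for u v
    unfolding P_def R_def using that ij \<phi>1 \<psi>1 mi
    by (intro conjI B.split_sum_closed C.split_sum_closed B.m_closed C.m_closed \<phi>1 \<psi>1 mi)
  define E where "E p \<alpha> \<beta> \<alpha>' \<beta>' = t (\<phi> (e1 i \<alpha> @ [fst p]) \<otimes>\<^bsub>B\<^esub> \<phi> (e1 j \<beta> @ [snd p]))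
      (\<psi> (fst p # e2 i \<alpha>') \<otimes>\<^bsub>C\<^esub> \<psi> (snd p # e2 j \<beta>'))" for p \<alpha> \<beta> \<alpha>' \<beta>'
  have E: "E p \<alpha> \<beta> \<alpha>' \<beta>' \<in> carrier T"
    if "p \<in> ?X \<times> ?X" "(\<alpha>, \<beta>) \<in> splittings J'" "(\<alpha>', \<beta>') \<in> splittings J''" for p \<alpha> \<beta> \<alpha>' \<beta>'
    unfolding E_def using that ij mi(1,2)[OF that(2)] mi(3,4)[OF that(3)]
    by (intro closed B.m_closed C.m_closed \<phi>1 \<psi>1) auto
  have prod: "?\<Phi> (insert_at k i (\<alpha> @ \<alpha>')) \<otimes> ?\<Phi> (insert_at k j (\<beta> @ \<beta>'))
      = (\<Oplus>p\<in>?X \<times> ?X. E p \<alpha> \<beta> \<alpha>' \<beta>')"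
    if *: "(\<alpha>, \<beta>) \<in> splittings J'" "(\<alpha>', \<beta>') \<in> splittings J''" for \<alpha> \<beta> \<alpha>' \<beta>'
  proof -
    note mi' = mi(1,2)[OF *(1)] mi(3,4)[OF *(2)]
    have len: "length (e1 i \<alpha>) = m" "length (e1 j \<beta>) = m"
      using e1[OF ij(1) mi'(1)] e1[OF ij(2) mi'(2)] by (auto simp: multi_indices_def)
    have \<Phi>: "?\<Phi> (insert_at k i (\<alpha> @ \<alpha>')) = (\<Oplus>u\<in>?X. t (\<phi> (e1 i \<alpha> @ [u])) (\<psi> (u # e2 i \<alpha>')))"
      "?\<Phi> (insert_at k j (\<beta> @ \<beta>')) = (\<Oplus>u\<in>?X. t (\<phi> (e1 j \<beta> @ [u])) (\<psi> (u # e2 j \<beta>')))"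
      using mi' len by (auto simp: convolve_def e multi_indices_def)
    show ?thesis
      unfolding \<Phi> E_def using mi' ij \<phi>1 \<psi>1
      by (subst finsum_mult_finsum) (auto simp: mult intro!: T.finsum_cong')
  qed
  have "T.quad ?\<Phi> q k (J' @ J'') i j = T.split_sum q J' (\<lambda>\<alpha> \<beta>. T.split_sum q J'' (\<lambda>\<alpha>' \<beta>'.
      ?\<Phi> (insert_at k i (\<alpha> @ \<alpha>')) \<otimes> ?\<Phi> (insert_at k j (\<beta> @ \<beta>'))))"
    unfolding T.quad_def by (rule T.split_sum_append) (use fin prod E in \<open>auto intro!: T.finsum_closed\<close>)
  also have "\<dots> = T.split_sum q J' (\<lambda>\<alpha> \<beta>. T.split_sum q J'' (\<lambda>\<alpha>' \<beta>'. \<Oplus>p\<in>?X \<times> ?X. E p \<alpha> \<beta> \<alpha>' \<beta>'))"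
    by (intro T.split_sum_cong T.split_sum_closed) (use prod E in \<open>auto intro!: T.finsum_closed\<close>)
  also have "\<dots> = T.split_sum q J' (\<lambda>\<alpha> \<beta>. \<Oplus>p\<in>?X \<times> ?X. T.split_sum q J'' (\<lambda>\<alpha>' \<beta>'. E p \<alpha> \<beta> \<alpha>' \<beta>'))"
    by (intro T.split_sum_cong T.split_sum_finsum T.finsum_closed funcsetI T.split_sum_closed) (use fin E in auto)
  also have "\<dots> = (\<Oplus>p\<in>?X \<times> ?X. T.split_sum q J' (\<lambda>\<alpha> \<beta>. T.split_sum q J'' (\<lambda>\<alpha>' \<beta>'. E p \<alpha> \<beta> \<alpha>' \<beta>')))"
    by (intro T.split_sum_finsum T.split_sum_closed) (use fin E in auto)
  also have "\<dots> = (\<Oplus>p\<in>?X \<times> ?X. t (P (fst p) (snd p)) (R (fst p) (snd p)))"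
  proof (rule T.finsum_cong', rule refl)
    show "T.split_sum q J' (\<lambda>\<alpha> \<beta>. T.split_sum q J'' (\<lambda>\<alpha>' \<beta>'. E p \<alpha> \<beta> \<alpha>' \<beta>')) = t (P (fst p) (snd p)) (R (fst p) (snd p))"
      if p: "p \<in> ?X \<times> ?X" for p
      unfolding E_def P_def R_def
    proof (rule split_sum_pairing)
      show "\<phi> (e1 i \<alpha> @ [fst p]) \<otimes>\<^bsub>B\<^esub> \<phi> (e1 j \<beta> @ [snd p]) \<in> carrier B" if "(\<alpha>, \<beta>) \<in> splittings J'" for \<alpha> \<beta>
        using mi(1,2)[OF that] p ij by (intro B.m_closed \<phi>1) auto
      show "\<psi> (fst p # e2 i \<alpha>) \<otimes>\<^bsub>C\<^esub> \<psi> (snd p # e2 j \<beta>) \<in> carrier C" if "(\<alpha>, \<beta>) \<in> splittings J''" for \<alpha> \<beta>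
        using mi(3,4)[OF that] p ij by (intro C.m_closed \<psi>1) auto
    qed (use fin in auto)
  qed (use PR in auto)
  finally show "T.quad ?\<Phi> q k (J' @ J'') i j
      = (\<Oplus>p\<in>?X \<times> ?X. t (P (fst p) (snd p)) (R (fst p) (snd p)))" .
qed

end

context unital_alg
begin

text \<open>
  The pair \<open>{u, v}\<close> as a last factor of the box splits in two ways, of which only
  \<open>(v, u)\<close> has an inversion. This recognises the combinations \<open>P(u, v) - q P(v, u)\<close> left
  over by \<open>antisymmetric_right\<close> as quadratic sums over a larger box. The lemma \<open>quad_Cons\<close>
  does the same for a first factor.
\<close>

lemma quad_snoc:
  assumes J: "J \<in> pair_boxes n N" and k: "k \<le> N" and X: "i \<in> {1..n}" "j \<in> {1..n}" "u \<in> {1..n}" "v \<in> {1..n}" "u < v"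
    and \<phi>: "\<And>\<alpha>. \<alpha> \<in> multi_indices n (Suc (Suc N)) \<Longrightarrow> \<phi> \<alpha> \<in> carrier A"
  shows "quad \<phi> q k (J @ [{u, v}]) i j =
    split_sum q J (\<lambda>\<alpha> \<beta>. \<phi> (insert_at k i \<alpha> @ [u]) \<otimes> \<phi> (insert_at k j \<beta> @ [v])) \<oplus>
    (- q) \<odot> split_sum q J (\<lambda>\<alpha> \<beta>. \<phi> (insert_at k i \<alpha> @ [v]) \<otimes> \<phi> (insert_at k j \<beta> @ [u]))"
proof -
  let ?G = "\<lambda>u v \<alpha> \<beta>. \<phi> (insert_at k i \<alpha> @ [u]) \<otimes> \<phi> (insert_at k j \<beta> @ [v])"
  have ins: "insert_at k i (\<alpha> @ [w]) = insert_at k i \<alpha> @ [w]" if "length \<alpha> = N" for i w \<alpha>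
    using that k by (simp add: insert_at_def)
  have cl: "?G w w' \<alpha> \<beta> \<in> carrier A" if "(\<alpha>, \<beta>) \<in> splittings J" "w \<in> {1..n}" "w' \<in> {1..n}" for w w' \<alpha> \<beta>
  proof -
    have "insert_at k i \<alpha> \<in> multi_indices n (Suc N)" "insert_at k j \<beta> \<in> multi_indices n (Suc N)"
      using splittings_multi_indices[OF J that(1)] X insert_at_multi_indices by auto
    then show ?thesis using that by (intro m_closed \<phi>) (auto simp: multi_indices_def)
  qed
  have len: "length \<alpha> = N \<and> length \<beta> = N" if "(\<alpha>, \<beta>) \<in> splittings J" for \<alpha> \<beta>
    using splittings_lengths[OF that] J by (simp add: pair_boxes_def)
  have pair: "splittings [{u, v}] = {([u], [v]), ([v], [u])}"
    using \<open>u < v\<close> by (intro splittings_pair) simp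
  have "quad \<phi> q k (J @ [{u, v}]) i j = split_sum q J (\<lambda>\<alpha> \<beta>. split_sum q [{u, v}]
      (\<lambda>\<alpha>' \<beta>'. \<phi> (insert_at k i (\<alpha> @ \<alpha>')) \<otimes> \<phi> (insert_at k j (\<beta> @ \<beta>'))))"
    unfolding quad_def
    by (rule split_sum_append) (use finite_pair_boxes[OF J] cl X len in \<open>auto simp: pair ins\<close>)
  also have "\<dots> = split_sum q J (\<lambda>\<alpha> \<beta>. ?G u v \<alpha> \<beta> \<oplus> (- q) \<odot> ?G v u \<alpha> \<beta>)"
  proof (rule split_sum_cong)
    fix \<alpha> \<beta> assume *: "(\<alpha>, \<beta>) \<in> splittings J"
    note cl' = cl[OF * X(3,4)] cl[OF * X(4,3)]
    show "split_sum q [{u, v}] (\<lambda>\<alpha>' \<beta>'. \<phi> (insert_at k i (\<alpha> @ \<alpha>')) \<otimes> \<phi> (insert_at k j (\<beta> @ \<beta>')))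
        = ?G u v \<alpha> \<beta> \<oplus> (- q) \<odot> ?G v u \<alpha> \<beta>"
      using cl' len[OF *] \<open>u < v\<close> by (subst split_sum_pair) (simp_all add: ins)
    show "?G u v \<alpha> \<beta> \<oplus> (- q) \<odot> ?G v u \<alpha> \<beta> \<in> carrier A" using cl' by simp
  qed
  also have "\<dots> = split_sum q J (?G u v) \<oplus> split_sum q J (\<lambda>\<alpha> \<beta>. (- q) \<odot> ?G v u \<alpha> \<beta>)"
    using cl X by (intro split_sum_add) auto
  also have "split_sum q J (\<lambda>\<alpha> \<beta>. (- q) \<odot> ?G v u \<alpha> \<beta>) = (- q) \<odot> split_sum q J (?G v u)"
    using cl X by (intro split_sum_smult) auto
  finally show ?thesis .
qed

lemma quad_Cons:
  assumes J: "J \<in> pair_boxes n N" and X: "i \<in> {1..n}" "j \<in> {1..n}" "u \<in> {1..n}" "v \<in> {1..n}" "u < v"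
    and \<phi>: "\<And>\<alpha>. \<alpha> \<in> multi_indices n (Suc (Suc N)) \<Longrightarrow> \<phi> \<alpha> \<in> carrier A"
  shows "quad \<phi> q (Suc k) ({u, v} # J) i j =
    split_sum q J (\<lambda>\<alpha> \<beta>. \<phi> (u # insert_at k i \<alpha>) \<otimes> \<phi> (v # insert_at k j \<beta>)) \<oplus>
    (- q) \<odot> split_sum q J (\<lambda>\<alpha> \<beta>. \<phi> (v # insert_at k i \<alpha>) \<otimes> \<phi> (u # insert_at k j \<beta>))"
proof -
  let ?G = "\<lambda>u v \<alpha> \<beta>. \<phi> (u # insert_at k i \<alpha>) \<otimes> \<phi> (v # insert_at k j \<beta>)"
  have ins: "insert_at (Suc k) i (w # \<alpha>) = w # insert_at k i \<alpha>" for i w \<alpha>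
    by (simp add: insert_at_def)
  have cl: "?G w w' \<alpha> \<beta> \<in> carrier A" if "(\<alpha>, \<beta>) \<in> splittings J" "w \<in> {1..n}" "w' \<in> {1..n}" for w w' \<alpha> \<beta>
  proof -
    have "insert_at k i \<alpha> \<in> multi_indices n (Suc N)" "insert_at k j \<beta> \<in> multi_indices n (Suc N)"
      using splittings_multi_indices[OF J that(1)] X insert_at_multi_indices by auto
    then show ?thesis using that by (intro m_closed \<phi>) (auto simp: multi_indices_def)
  qed
  have pair: "splittings [{u, v}] = {([u], [v]), ([v], [u])}"
    using \<open>u < v\<close> by (intro splittings_pair) simp
  have "quad \<phi> q (Suc k) ([{u, v}] @ J) i j = split_sum q [{u, v}] (\<lambda>\<alpha> \<beta>. split_sum q J
      (\<lambda>\<alpha>' \<beta>'. \<phi> (insert_at (Suc k) i (\<alpha> @ \<alpha>')) \<otimes> \<phi> (insert_at (Suc k) j (\<beta> @ \<beta>'))))"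
    unfolding quad_def
    by (rule split_sum_append) (use finite_pair_boxes[OF J] cl X in \<open>auto simp: pair ins\<close>)
  also have "\<dots> = split_sum q J (?G u v) \<oplus> (- q) \<odot> split_sum q J (?G v u)"
    using cl X by (subst split_sum_pair) (auto simp: ins)
  finally show ?thesis by simp
qed

end

context alg_pairing
begin

text \<open>
  The case of a direction belonging to the first family: the collapse is caused by the second
  family, whose first direction is the contracted one. In \<open>quad_convolve_right\<close> the last
  direction of the first family causes it.
\<close>

lemma quad_convolve_left:
  assumes \<phi>: "B.hyp_family q n (Suc m) \<phi>" and \<psi>: "C.hyp_family q n (Suc l) \<psi>" and k: "k < m"
    and J: "J' \<in> pair_boxes n (m - 1)" "J'' \<in> pair_boxes n l" and ij: "i \<in> {1..n}" "j \<in> {1..n}"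
  shows "T.quad (convolve n m \<phi> \<psi>) q k (J' @ J'') i j =
    (\<Oplus>p\<in>{p \<in> {1..n} \<times> {1..n}. fst p < snd p}.
      t (B.quad \<phi> q k (J' @ [{fst p, snd p}]) i j) (C.quad \<psi> q 0 J'' (fst p) (snd p)))"
proof -
  let ?X = "{1..n}"
  note \<phi>_in = B.hyp_familyD(1)[OF \<phi>] and \<psi>_in = C.hyp_familyD(1)[OF \<psi>]
  let ?P = "\<lambda>u v. B.split_sum q J' (\<lambda>\<alpha> \<beta>. \<phi> (insert_at k i \<alpha> @ [u]) \<otimes>\<^bsub>B\<^esub> \<phi> (insert_at k j \<beta> @ [v]))"
  let ?R = "\<lambda>u v. C.quad \<psi> q 0 J'' u v"
  have R: "?R u v = C.split_sum q J'' (\<lambda>\<alpha> \<beta>. \<psi> (u # \<alpha>) \<otimes>\<^bsub>C\<^esub> \<psi> (v # \<beta>))" for u v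
    by (simp add: C.quad_def insert_at_def)
  have m: "Suc (m - 1) = m" using k by simp
  have e: "insert_at k i (\<alpha> @ \<beta>) = insert_at k i \<alpha> @ \<beta>"
    if "length \<alpha> = m - 1" "length \<beta> = l" for i \<alpha> and \<beta> :: "nat list"
    using that k by (simp add: insert_at_def)
  have e1: "insert_at k i \<alpha> \<in> multi_indices n m" if "i \<in> ?X" "\<alpha> \<in> multi_indices n (m - 1)" for i \<alpha>
    using insert_at_multi_indices[OF that(2,1)] m by simp
  note qc = quad_convolve[where m = m and l = l and \<phi> = \<phi> and \<psi> = \<psi> and n = n and q = q and k = k
      and ?e1.0 = "insert_at k" and ?e2.0 = "\<lambda>_ \<beta>. \<beta>", OF J _ _ ij]
  have closed: "?P u v \<in> carrier B \<and> ?R u v \<in> carrier C" if "u \<in> ?X" "v \<in> ?X" for u v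
    unfolding R by (rule qc(2)) (use \<phi>_in \<psi>_in e e1 that in auto)
  have quad: "?P u v \<oplus>\<^bsub>B\<^esub> (- q) \<odot>\<^bsub>B\<^esub> ?P v u = B.quad \<phi> q k (J' @ [{u, v}]) i j"
    if "u \<in> ?X" "v \<in> ?X" "u < v" for u v
    using that k m \<phi>_in by (intro B.quad_snoc[OF J(1) _ ij, symmetric]) auto
  have "T.quad (convolve n m \<phi> \<psi>) q k (J' @ J'') i j
      = (\<Oplus>p\<in>?X \<times> ?X. t (?P (fst p) (snd p)) (?R (fst p) (snd p)))"
    unfolding R by (rule qc(1)) (use \<phi>_in \<psi>_in e e1 in auto)
  also have "\<dots> = (\<Oplus>p\<in>{p \<in> ?X \<times> ?X. fst p < snd p}.
        t (?P (fst p) (snd p) \<oplus>\<^bsub>B\<^esub> (- q) \<odot>\<^bsub>B\<^esub> ?P (snd p) (fst p)) (?R (fst p) (snd p)))"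
    by (rule antisymmetric_right) (use closed C.hyp_familyD(2,3)[OF \<psi>] J in auto)
  also have "\<dots> = (\<Oplus>p\<in>{p \<in> ?X \<times> ?X. fst p < snd p}.
      t (B.quad \<phi> q k (J' @ [{fst p, snd p}]) i j) (?R (fst p) (snd p)))"
  proof (rule T.finsum_cong', rule refl)
    fix p assume p: "p \<in> {p \<in> ?X \<times> ?X. fst p < snd p}"
    then have "fst p \<in> ?X" "snd p \<in> ?X" "fst p < snd p" by auto
    then show "t (?P (fst p) (snd p) \<oplus>\<^bsub>B\<^esub> (- q) \<odot>\<^bsub>B\<^esub> ?P (snd p) (fst p)) (?R (fst p) (snd p))
        = t (B.quad \<phi> q k (J' @ [{fst p, snd p}]) i j) (?R (fst p) (snd p))"
      using quad p by simp
  qed (use closed in \<open>auto simp flip: quad\<close>)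
  finally show ?thesis .
qed

lemmas antisymmetric_left = alg_pairing.antisymmetric_right[OF flip]

lemma quad_convolve_right:
  assumes \<phi>: "B.hyp_family q n (Suc m) \<phi>" and \<psi>: "C.hyp_family q n (Suc l) \<psi>" and k: "k < l"
    and J: "J' \<in> pair_boxes n m" "J'' \<in> pair_boxes n (l - 1)" and ij: "i \<in> {1..n}" "j \<in> {1..n}"
  shows "T.quad (convolve n m \<phi> \<psi>) q (m + k) (J' @ J'') i j =
    (\<Oplus>p\<in>{p \<in> {1..n} \<times> {1..n}. fst p < snd p}.
      t (B.quad \<phi> q m J' (fst p) (snd p)) (C.quad \<psi> q (Suc k) ({fst p, snd p} # J'') i j))"
proof -
  let ?X = "{1..n}"
  note \<phi>_in = B.hyp_familyD(1)[OF \<phi>] and \<psi>_in = C.hyp_familyD(1)[OF \<psi>]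
  let ?P = "\<lambda>u v. B.split_sum q J' (\<lambda>\<alpha> \<beta>. \<phi> (\<alpha> @ [u]) \<otimes>\<^bsub>B\<^esub> \<phi> (\<beta> @ [v]))"
  let ?R = "\<lambda>u v. C.split_sum q J'' (\<lambda>\<alpha> \<beta>. \<psi> (u # insert_at k i \<alpha>) \<otimes>\<^bsub>C\<^esub> \<psi> (v # insert_at k j \<beta>))"
  have l: "Suc (l - 1) = l" using k by simp
  have P: "B.quad \<phi> q m J' u v = ?P u v" if "u \<in> ?X" "v \<in> ?X" for u v
    unfolding B.quad_def
  proof (rule B.split_sum_cong)
    fix \<alpha> \<beta> assume "(\<alpha>, \<beta>) \<in> splittings J'"
    note mi = splittings_multi_indices[OF J(1) this]
    then show "\<phi> (insert_at m u \<alpha>) \<otimes>\<^bsub>B\<^esub> \<phi> (insert_at m v \<beta>) = \<phi> (\<alpha> @ [u]) \<otimes>\<^bsub>B\<^esub> \<phi> (\<beta> @ [v])"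
      by (simp add: insert_at_def multi_indices_def)
    show "\<phi> (\<alpha> @ [u]) \<otimes>\<^bsub>B\<^esub> \<phi> (\<beta> @ [v]) \<in> carrier B"
      using mi that by (intro B.m_closed \<phi>_in) (auto simp: multi_indices_def)
  qed
  have e: "insert_at (m + k) i (\<alpha> @ \<beta>) = \<alpha> @ insert_at k i \<beta>"
    if "length \<alpha> = m" for i \<alpha> and \<beta> :: "nat list"
    using that by (simp add: insert_at_def)
  have e2: "insert_at k i \<alpha> \<in> multi_indices n l" if "i \<in> ?X" "\<alpha> \<in> multi_indices n (l - 1)" for i \<alpha>
    using insert_at_multi_indices[OF that(2,1)] l by simp
  note qc = quad_convolve[where m = m and l = l and \<phi> = \<phi> and \<psi> = \<psi> and n = n and q = q and k = "m + k"
      and ?e1.0 = "\<lambda>_ \<alpha>. \<alpha>" and ?e2.0 = "insert_at k", OF J _ _ ij]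
  have closed: "?P u v \<in> carrier B \<and> ?R u v \<in> carrier C" if "u \<in> ?X" "v \<in> ?X" for u v
    by (rule qc(2)) (use \<phi>_in \<psi>_in e e2 that in auto)
  have quad: "?R u v \<oplus>\<^bsub>C\<^esub> (- q) \<odot>\<^bsub>C\<^esub> ?R v u = C.quad \<psi> q (Suc k) ({u, v} # J'') i j"
    if "u \<in> ?X" "v \<in> ?X" "u < v" for u v
    using that k l \<psi>_in by (intro C.quad_Cons[OF J(2) ij, symmetric]) auto
  have "T.quad (convolve n m \<phi> \<psi>) q (m + k) (J' @ J'') i j
      = (\<Oplus>p\<in>?X \<times> ?X. t (?P (fst p) (snd p)) (?R (fst p) (snd p)))"
    by (rule qc(1)) (use \<phi>_in \<psi>_in e e2 in auto)
  also have "\<dots> = (\<Oplus>p\<in>{p \<in> ?X \<times> ?X. fst p < snd p}.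
        t (?P (fst p) (snd p)) (?R (fst p) (snd p) \<oplus>\<^bsub>C\<^esub> (- q) \<odot>\<^bsub>C\<^esub> ?R (snd p) (fst p)))"
    by (rule antisymmetric_left) (use closed B.hyp_familyD(2,3)[OF \<phi>, of m J'] J P in auto)
  also have "\<dots> = (\<Oplus>p\<in>{p \<in> ?X \<times> ?X. fst p < snd p}.
      t (B.quad \<phi> q m J' (fst p) (snd p)) (C.quad \<psi> q (Suc k) ({fst p, snd p} # J'') i j))"
  proof (rule T.finsum_cong', rule refl)
    fix p assume p: "p \<in> {p \<in> ?X \<times> ?X. fst p < snd p}"
    then have "fst p \<in> ?X" "snd p \<in> ?X" "fst p < snd p" by auto
    then show "t (?P (fst p) (snd p)) (?R (fst p) (snd p) \<oplus>\<^bsub>C\<^esub> (- q) \<odot>\<^bsub>C\<^esub> ?R (snd p) (fst p))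
        = t (B.quad \<phi> q m J' (fst p) (snd p)) (C.quad \<psi> q (Suc k) ({fst p, snd p} # J'') i j)"
      using quad P by simp
  qed (use closed P in \<open>auto simp flip: quad\<close>)
  finally show ?thesis .
qed

lemma finsum_pairing_smult:
  assumes "\<And>p. p \<in> S \<Longrightarrow> b p \<in> carrier B" "\<And>p. p \<in> S \<Longrightarrow> c p \<in> carrier C"
  shows "(\<Oplus>p\<in>S. t (d \<odot>\<^bsub>B\<^esub> b p) (c p)) = d \<odot> (\<Oplus>p\<in>S. t (b p) (c p))"
    "(\<Oplus>p\<in>S. t (b p) (d \<odot>\<^bsub>C\<^esub> c p)) = d \<odot> (\<Oplus>p\<in>S. t (b p) (c p))"
  using assms by (auto simp: T.smult_finsum smult_left smult_right intro!: T.finsum_cong')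

text \<open>
  In both cases the quadratic sum of the convolution is a sum of pairings in which one factor
  is a quadratic sum for the entries \<open>i, j\<close> and the other does not involve
  \<open>i\<close> and \<open>j\<close>. The relations of the first kind of factor hold termwise and pass to the sum.
\<close>

theorem hyp_family_convolve:
  assumes \<phi>: "B.hyp_family q n (m + 1) \<phi>" and \<psi>: "C.hyp_family q n (1 + l) \<psi>"
  shows "T.hyp_family q n (m + l) (convolve n m \<phi> \<psi>)"
proof -
  let ?X = "{1..n}" and ?\<Phi> = "convolve n m \<phi> \<psi>"
  let ?L = "{p \<in> ?X \<times> ?X. fst p < snd p}"
  note \<phi>' = \<phi>[simplified] and \<psi>' = \<psi>[simplified]
  note \<phi>_in = B.hyp_familyD(1)[OF \<phi>'] and \<psi>_in = C.hyp_familyD(1)[OF \<psi>']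
  have closed: "?\<Phi> \<gamma> \<in> carrier T" if "\<gamma> \<in> multi_indices n (m + l)" for \<gamma>
    unfolding convolve_def using that set_take_subset[of m \<gamma>] set_drop_subset[of m \<gamma>]
    by (intro T.finsum_closed funcsetI closed \<phi>_in \<psi>_in) (auto simp: multi_indices_def)
  have pair: "{u, v} \<subseteq> ?X \<and> card {u, v} = 2" if "u \<in> ?X" "v \<in> ?X" "u < v" for u v
    using that by auto
  have rels: "T.quad ?\<Phi> q k J i i = \<zero> \<and>
      (i < j \<longrightarrow> T.quad ?\<Phi> q k J j i = (- q) \<odot> T.quad ?\<Phi> q k J i j)"
    if k: "k < m + l" and J: "J \<in> pair_boxes n (m + l - 1)" and ij: "i \<in> ?X" "j \<in> ?X" for k J i j
  proof (cases "k < m")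
    case True
    \<comment> \<open>The box omits direction \<open>k\<close>, so only its first \<open>m - 1\<close> sides belong to \<open>\<phi>\<close>; the pair
      \<open>{u, v}\<close> supplies the missing side of a box for \<open>\<phi>\<close>.\<close>
    define J1 J2 where "J1 = take (m - 1) J" and "J2 = drop (m - 1) J"
    have J12: "J = J1 @ J2" by (simp add: J1_def J2_def)
    have J1: "J1 \<in> pair_boxes n (m - 1)" and J2: "J2 \<in> pair_boxes n l"
      using J True by (auto simp: J1_def J2_def pair_boxes_def dest: in_set_takeD in_set_dropD)
    have box: "J1 @ [{u, v}] \<in> pair_boxes n m" if "u \<in> ?X" "v \<in> ?X" "u < v" for u v
      using J1 pair[OF that] True by (auto simp: pair_boxes_def)
    note q = quad_convolve_left[OF \<phi>' \<psi>' True J1 J2, folded J12]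
    have cl: "B.quad \<phi> q k (J1 @ [{fst p, snd p}]) i j \<in> carrier B"
      "B.quad \<phi> q k (J1 @ [{fst p, snd p}]) j i \<in> carrier B"
      "C.quad \<psi> q 0 J2 (fst p) (snd p) \<in> carrier C" if "p \<in> ?L" for p
      using that box ij by (auto intro!: B.quad_closed[OF \<phi>'] C.quad_closed[OF \<psi>'] simp: J2)
    show ?thesis
    proof (intro conjI impI)
      have "T.quad ?\<Phi> q k J i i = (\<Oplus>p\<in>?L. \<zero>)"
        unfolding q[OF ij(1) ij(1)]
        by (rule T.finsum_cong') (use cl ij box True B.hyp_familyD(2)[OF \<phi>', of k] in auto)
      then show "T.quad ?\<Phi> q k J i i = \<zero>" by simp
      assume "i < j"
      have "T.quad ?\<Phi> q k J j i = (\<Oplus>p\<in>?L.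
          t ((- q) \<odot>\<^bsub>B\<^esub> B.quad \<phi> q k (J1 @ [{fst p, snd p}]) i j) (C.quad \<psi> q 0 J2 (fst p) (snd p)))"
        unfolding q[OF ij(2,1)] using cl ij box True \<open>i < j\<close> B.hyp_familyD(3)[OF \<phi>', of k]
        by (intro T.finsum_cong') auto
      also have "\<dots> = (- q) \<odot> T.quad ?\<Phi> q k J i j"
        unfolding q[OF ij] using cl ij by (intro finsum_pairing_smult)
      finally show "T.quad ?\<Phi> q k J j i = (- q) \<odot> T.quad ?\<Phi> q k J i j" .
    qed
  next
    case False
    \<comment> \<open>Here \<open>\<psi>\<close> gets the enlarged box. Its direction is \<open>Suc k'\<close> since position 0 holds the
      contracted index.\<close>
    define k' where "k' = k - m"
    have k': "k = m + k'" "k' < l" using False k by (auto simp: k'_def)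
    define J1 J2 where "J1 = take m J" and "J2 = drop m J"
    have J12: "J = J1 @ J2" by (simp add: J1_def J2_def)
    have J1: "J1 \<in> pair_boxes n m" and J2: "J2 \<in> pair_boxes n (l - 1)"
      using J k' by (auto simp: J1_def J2_def pair_boxes_def dest: in_set_takeD in_set_dropD)
    have box: "{u, v} # J2 \<in> pair_boxes n l" if "u \<in> ?X" "v \<in> ?X" "u < v" for u v
      using J2 pair[OF that] k' by (auto simp: pair_boxes_def)
    note q = quad_convolve_right[OF \<phi>' \<psi>' k'(2) J1 J2, folded J12 k'(1)]
    have cl: "C.quad \<psi> q (Suc k') ({fst p, snd p} # J2) i j \<in> carrier C"
      "C.quad \<psi> q (Suc k') ({fst p, snd p} # J2) j i \<in> carrier C"
      "B.quad \<phi> q m J1 (fst p) (snd p) \<in> carrier B" if "p \<in> ?L" for p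
      using that box ij by (auto intro!: B.quad_closed[OF \<phi>'] C.quad_closed[OF \<psi>'] simp: J1)
    show ?thesis
    proof (intro conjI impI)
      have "T.quad ?\<Phi> q k J i i = (\<Oplus>p\<in>?L. \<zero>)"
        unfolding q[OF ij(1) ij(1)]
        by (rule T.finsum_cong') (use cl ij box k' C.hyp_familyD(2)[OF \<psi>', of "Suc k'"] in auto)
      then show "T.quad ?\<Phi> q k J i i = \<zero>" by simp
      assume "i < j"
      have "T.quad ?\<Phi> q k J j i = (\<Oplus>p\<in>?L.
          t (B.quad \<phi> q m J1 (fst p) (snd p)) ((- q) \<odot>\<^bsub>C\<^esub> C.quad \<psi> q (Suc k') ({fst p, snd p} # J2) i j))"
        unfolding q[OF ij(2,1)] using cl ij box k' \<open>i < j\<close> C.hyp_familyD(3)[OF \<psi>', of "Suc k'"]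
        by (intro T.finsum_cong') auto
      also have "\<dots> = (- q) \<odot> T.quad ?\<Phi> q k J i j"
        unfolding q[OF ij] using cl ij by (intro finsum_pairing_smult)
      finally show "T.quad ?\<Phi> q k J j i = (- q) \<odot> T.quad ?\<Phi> q k J i j" .
    qed
  qed
  show ?thesis
    unfolding T.hyp_family_def using closed rels by blast
qed

end

section \<open>Inversions, arrangements and flips\<close>

text \<open>
  Applying the transposition to positions turns the inversions of \<open>f\<close> into inversions of the
  composite; the only further one is the pair \<open>(p, Suc p)\<close> itself.
\<close>

lemma inversions_adjacent_transpose:
  assumes p: "Suc p < r" and f: "f p < f (Suc p)"
  shows "inversions r (f \<circ> transpose p (Suc p)) = Suc (inversions r f)"
proof -
  define s where "s = transpose p (Suc p)"
  have s_s [simp]: "s (s a) = a" for a by (simp add: s_def)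
  have s_lt: "s a < r \<longleftrightarrow> a < r" for a using p by (auto simp: s_def transpose_def)
  have s_mono: "s a < s b" if "a < b" "(a, b) \<noteq> (p, Suc p)" for a b
    using that by (auto simp: s_def transpose_def)
  define Inv where "Inv g = {(a, b). a < b \<and> b < r \<and> g a > g b}" for g :: "nat \<Rightarrow> nat"
  have fin: "finite (Inv f)"
    by (rule finite_subset[of _ "{..<r} \<times> {..<r}"]) (auto simp: Inv_def)
  have s_p: "s p = Suc p" "s (Suc p) = p" by (simp_all add: s_def)
  have "Inv (f \<circ> s) = insert (p, Suc p) (map_prod s s ` Inv f)"
  proof (intro subset_antisym subsetI)
    fix x assume x: "x \<in> Inv (f \<circ> s)"
    obtain a b where ab: "x = (a, b)" by (cases x)
    show "x \<in> insert (p, Suc p) (map_prod s s ` Inv f)"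
    proof (cases "x = (p, Suc p)")
      case False
      then have "(s a, s b) \<in> Inv f" using x ab s_mono[of a b] s_lt by (auto simp: Inv_def)
      then have "map_prod s s (s a, s b) \<in> map_prod s s ` Inv f" by (rule imageI)
      then show ?thesis using ab by simp
    qed simp
  next
    fix x assume "x \<in> insert (p, Suc p) (map_prod s s ` Inv f)"
    then consider "x = (p, Suc p)" | a b where "(a, b) \<in> Inv f" "x = (s a, s b)" by auto
    then show "x \<in> Inv (f \<circ> s)"
    proof cases
      case 1
      then show ?thesis using p f by (simp add: Inv_def s_p)
    next
      case 2
      then have "(a, b) \<noteq> (p, Suc p)" using f by (auto simp: Inv_def)
      then show ?thesis using 2 s_mono[of a b] s_lt by (auto simp: Inv_def)
    qed
  qed
  moreover have "(p, Suc p) \<notin> map_prod s s ` Inv f"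
  proof
    assume "(p, Suc p) \<in> map_prod s s ` Inv f"
    then obtain a b where "(a, b) \<in> Inv f" "s a = p" "s b = Suc p" by auto
    then have "a = Suc p" "b = p" using s_s[of a] s_s[of b] s_p by auto
    then show False using \<open>(a, b) \<in> Inv f\<close> by (simp add: Inv_def)
  qed
  moreover have "card (map_prod s s ` Inv f) = card (Inv f)"
    by (rule card_image, rule inj_on_inverseI[where g = "map_prod s s"]) auto
  ultimately have "card (Inv (f \<circ> s)) = Suc (card (Inv f))" using fin by simp
  then show ?thesis unfolding inversions_def s_def Inv_def by simp
qed

definition list_inversions :: "nat list \<Rightarrow> nat" where
  "list_inversions ks = inversions (length ks) ((!) ks)"

lemma list_inversions_swap:
  assumes "i < j"
  shows "list_inversions (xs @ j # i # ys) = Suc (list_inversions (xs @ i # j # ys))"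
proof -
  let ?p = "length xs" and ?L = "xs @ i # j # ys"
  have "(xs @ j # i # ys) ! a = ((!) ?L \<circ> transpose ?p (Suc ?p)) a" for a
  proof -
    consider "a < ?p" | "a = ?p" | "a = Suc ?p" | "a > Suc ?p" by linarith
    then show ?thesis
    proof cases
      case 4
      then obtain b where "a = Suc (Suc (?p + b))" using less_imp_Suc_add[OF 4] by auto
      then show ?thesis by (simp add: nth_append)
    qed (simp_all add: nth_append)
  qed
  then have "(!) (xs @ j # i # ys) = (!) ?L \<circ> transpose ?p (Suc ?p)" by (rule ext)
  then have "list_inversions (xs @ j # i # ys) = inversions (length ?L) ((!) ?L \<circ> transpose ?p (Suc ?p))"
    by (simp only: list_inversions_def length_append length_Cons)
  also have "\<dots> = Suc (list_inversions ?L)"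
    unfolding list_inversions_def
    by (rule inversions_adjacent_transpose) (use assms in \<open>simp_all add: nth_append\<close>)
  finally show ?thesis .
qed

lemma list_inversions_sorted: "sorted ks \<Longrightarrow> list_inversions ks = 0"
proof -
  assume "sorted ks"
  then have "\<not> ks ! a > ks ! b" if "a < b" "b < length ks" for a b
    using sorted_nth_mono[of ks a b] that by simp
  then have "{(a, b). a < b \<and> b < length ks \<and> ks ! a > ks ! b} = {}" by blast
  then show ?thesis unfolding list_inversions_def inversions_def by (simp only: card.empty)
qed

lemma list_decompose_adjacent:
  assumes "Suc p < length ks"
  shows "ks = take p ks @ ks ! p # ks ! Suc p # drop (Suc (Suc p)) ks"
  using assms by (simp add: Cons_nth_drop_Suc)

lemma not_sorted_decompose:
  assumes "\<not> sorted (ks :: nat list)"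
  obtains xs i j ys where "ks = xs @ j # i # ys" "i < j"
proof -
  obtain p where "Suc p < length ks" "ks ! p > ks ! Suc p"
    using assms by (auto simp: sorted_iff_nth_Suc not_le)
  then show thesis using that list_decompose_adjacent by blast
qed

lemma sorted_not_distinct_decompose:
  assumes "sorted (ks :: nat list)" "\<not> distinct ks"
  obtains xs i ys where "ks = xs @ i # i # ys"
proof -
  have "\<not> sorted_wrt (<) ks" using assms by (simp add: strict_sorted_iff)
  then obtain p where p: "Suc p < length ks" "\<not> ks ! p < ks ! Suc p"
    by (auto simp: sorted_wrt_iff_nth_Suc_transp)
  moreover have "ks ! p \<le> ks ! Suc p" using assms(1) p(1) by (simp add: sorted_iff_nth_Suc)
  ultimately have "ks ! p = ks ! Suc p" by simp
  then show thesis using that list_decompose_adjacent[OF p(1)] by metis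
qed

lemma finite_subsets_of_card: "finite (subsets_of_card n r)"
  by (rule finite_subset[of _ "Pow {1..n}"]) (auto simp: subsets_of_card_def)

lemma subsets_of_cardD:
  assumes "K \<in> subsets_of_card n r"
  shows "finite K" "K \<subseteq> {1..n}" "length (sorted_list_of_set K) = r"
    "set (sorted_list_of_set K) = K"
proof -
  show "K \<subseteq> {1..n}" using assms by (simp add: subsets_of_card_def)
  then show "finite K" by (rule finite_subset) simp
  then show "length (sorted_list_of_set K) = r" "set (sorted_list_of_set K) = K"
    using assms by (simp_all add: subsets_of_card_def)
qed

lemma sorted_list_nth_less_iff:
  assumes "K \<in> subsets_of_card n r" "a < r" "b < r"
  shows "sorted_list_of_set K ! a < sorted_list_of_set K ! b \<longleftrightarrow> a < b"
proof -
  have *: "sorted_list_of_set K ! a < sorted_list_of_set K ! b" if "a < b" "b < r" for a b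
    using subsets_of_cardD(3)[OF assms(1)] that strict_sorted_list_of_set[of K]
    by (simp add: sorted_wrt_iff_nth_less)
  show ?thesis using *[of a b] *[of b a] assms by (cases a b rule: linorder_cases) auto
qed

lemma sorted_list_nth_in:
  assumes "K \<in> subsets_of_card n r" "a < r"
  shows "sorted_list_of_set K ! a \<in> {1..n}"
  using subsets_of_cardD[OF assms(1)] nth_mem[of a "sorted_list_of_set K"] assms(2) by auto

definition arrange :: "nat \<Rightarrow> nat set \<Rightarrow> (nat \<Rightarrow> nat) \<Rightarrow> nat list" where
  "arrange r K \<sigma> = map (\<lambda>p. sorted_list_of_set K ! \<sigma> p) [0..<r]"

lemma arrange_permute_list:
  "K \<in> subsets_of_card n r \<Longrightarrow> arrange r K \<sigma> = permute_list \<sigma> (sorted_list_of_set K)"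
  by (simp add: arrange_def permute_list_def subsets_of_cardD(3) del: length_sorted_list_of_set)

lemma arrange_props:
  assumes K: "K \<in> subsets_of_card n r" and \<sigma>: "\<sigma> permutes {..<r}"
  shows "length (arrange r K \<sigma>) = r" "set (arrange r K \<sigma>) = K" "distinct (arrange r K \<sigma>)"
    "sort (arrange r K \<sigma>) = sorted_list_of_set K" "list_inversions (arrange r K \<sigma>) = inversions r \<sigma>"
proof -
  note K' = subsets_of_cardD[OF K]
  have mset: "mset (arrange r K \<sigma>) = mset (sorted_list_of_set K)"
    using \<sigma> K'(3) by (simp add: arrange_permute_list[OF K])
  show len: "length (arrange r K \<sigma>) = r" by (simp add: arrange_def)
  show "set (arrange r K \<sigma>) = K" using mset K'(4) by (metis set_mset_mset)
  show "distinct (arrange r K \<sigma>)" using mset by (metis mset_eq_imp_distinct_iff distinct_sorted_list_of_set)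
  show "sort (arrange r K \<sigma>) = sorted_list_of_set K" using mset by (intro properties_for_sort) auto
  have \<sigma>_lt: "\<sigma> a < r" if "a < r" for a using permutes_in_image[OF \<sigma>, of a] that by simp
  have "(arrange r K \<sigma> ! a > arrange r K \<sigma> ! b) = (\<sigma> a > \<sigma> b)" if "a < r" "b < r" for a b
    using that sorted_list_nth_less_iff[OF K \<sigma>_lt \<sigma>_lt] by (simp add: arrange_def)
  then show "list_inversions (arrange r K \<sigma>) = inversions r \<sigma>"
    unfolding list_inversions_def inversions_def len
    by (intro arg_cong[where f = card]) auto
qed

text \<open>
  A sequence without repetition is determined by its set of entries and by the permutation
  that rearranges their increasing enumeration into it.
\<close>

lemma bij_arrange:
  "bij_betw (\<lambda>(K, \<sigma>). arrange r K \<sigma>) (subsets_of_card n r \<times> {\<sigma>. \<sigma> permutes {..<r}})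
    {ks \<in> multi_indices n r. distinct ks}"
proof (rule bij_betwI')
  fix x y assume "x \<in> subsets_of_card n r \<times> {\<sigma>. \<sigma> permutes {..<r}}" "y \<in> subsets_of_card n r \<times> {\<sigma>. \<sigma> permutes {..<r}}"
  then obtain K \<sigma> K' \<sigma>' where xy: "x = (K, \<sigma>)" "y = (K', \<sigma>')"
    and K: "K \<in> subsets_of_card n r" "K' \<in> subsets_of_card n r"
    and \<sigma>: "\<sigma> permutes {..<r}" "\<sigma>' permutes {..<r}" by auto
  have "K = K' \<and> \<sigma> = \<sigma>'" if eq: "arrange r K \<sigma> = arrange r K' \<sigma>'"
  proof
    show KK: "K = K'" using eq arrange_props(2) K \<sigma> by metis
    show "\<sigma> = \<sigma>'"
    proof
      fix a
      show "\<sigma> a = \<sigma>' a"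
      proof (cases "a < r")
        case True
        then have lt: "\<sigma> a < r" "\<sigma>' a < r" using \<sigma> permutes_in_image[of _ "{..<r}" a] by auto
        have "arrange r K \<sigma> ! a = arrange r K \<sigma>' ! a" using eq KK by simp
        then have "sorted_list_of_set K ! \<sigma> a = sorted_list_of_set K ! \<sigma>' a"
          using True by (simp add: arrange_def)
        then show ?thesis
          using sorted_list_nth_less_iff[OF K(1) lt] sorted_list_nth_less_iff[OF K(1) lt(2) lt(1)] by auto
      next
        case False
        then show ?thesis using \<sigma> by (simp add: permutes_def)
      qed
    qed
  qed
  then show "((case x of (K, \<sigma>) \<Rightarrow> arrange r K \<sigma>) = (case y of (K, \<sigma>) \<Rightarrow> arrange r K \<sigma>)) = (x = y)"
    using xy by auto
next
  fix x assume "x \<in> subsets_of_card n r \<times> {\<sigma>. \<sigma> permutes {..<r}}"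
  then obtain K \<sigma> where x: "x = (K, \<sigma>)" "K \<in> subsets_of_card n r" "\<sigma> permutes {..<r}" by auto
  then show "(case x of (K, \<sigma>) \<Rightarrow> arrange r K \<sigma>) \<in> {ks \<in> multi_indices n r. distinct ks}"
    using arrange_props[OF x(2,3)] subsets_of_cardD(2)[OF x(2)] by (auto simp: multi_indices_def)
next
  fix ks assume ks: "ks \<in> {ks \<in> multi_indices n r. distinct ks}"
  define K where "K = set ks"
  have K: "K \<in> subsets_of_card n r"
    using ks by (auto simp: K_def subsets_of_card_def multi_indices_def distinct_card)
  have "mset ks = mset (sorted_list_of_set K)"
    using ks by (simp add: K_def sorted_list_of_set_sort_remdups distinct_remdups_id)
  then obtain \<sigma> where \<sigma>: "\<sigma> permutes {..<length (sorted_list_of_set K)}" "permute_list \<sigma> (sorted_list_of_set K) = ks"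
    by (rule mset_eq_permutation)
  then show "\<exists>x\<in>subsets_of_card n r \<times> {\<sigma>. \<sigma> permutes {..<r}}. ks = (case x of (K, \<sigma>) \<Rightarrow> arrange r K \<sigma>)"
    using K arrange_permute_list[OF K] subsets_of_cardD(3)[OF K]
    by (intro bexI[of _ "(K, \<sigma>)"]) auto
qed

lemma finite_perm_lists: "finite (perm_lists r N)"
proof -
  have "perm_lists r N = {\<sigma>s. set \<sigma>s \<subseteq> {\<sigma>. \<sigma> permutes {..<r}} \<and> length \<sigma>s = N}"
    by (auto simp: perm_lists_def)
  then show ?thesis by (simp add: finite_lists_length_eq finite_permutations)
qed

lemma perm_lists_nth: "\<lbrakk>\<sigma>s \<in> perm_lists r N; s < N\<rbrakk> \<Longrightarrow> (\<sigma>s ! s) permutes {..<r}"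
  by (auto simp: perm_lists_def)

lemma bij_perm_lists_append:
  "bij_betw (\<lambda>(\<sigma>s, \<tau>s). \<sigma>s @ \<tau>s) (perm_lists r M \<times> perm_lists r N) (perm_lists r (M + N))"
  by (rule bij_betwI[where g = "\<lambda>\<sigma>s. (take M \<sigma>s, drop M \<sigma>s)"])
    (auto simp: perm_lists_def dest: in_set_takeD in_set_dropD)

lemma bij_perm_lists_snoc:
  "bij_betw (\<lambda>(\<sigma>s, \<sigma>). \<sigma>s @ [\<sigma>]) (perm_lists r N \<times> {\<sigma>. \<sigma> permutes {..<r}}) (perm_lists r (Suc N))"
  by (rule bij_betwI[where g = "\<lambda>\<sigma>s. (butlast \<sigma>s, last \<sigma>s)"])
    (auto simp: perm_lists_def length_Suc_conv_rev dest: in_set_butlastD)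

lemma id_Cons_perm_lists: "\<sigma>s \<in> perm_lists r N \<Longrightarrow> id # \<sigma>s \<in> perm_lists r (Suc N)"
  by (auto simp: perm_lists_def permutes_id)

text \<open>
  Composition with the transposition of \<open>p\<close> and \<open>Suc p\<close> in those coordinates where \<open>bs\<close> is
  true. Every tuple of permutations is such a modification of exactly one tuple that ascends at
  \<open>p\<close> in every coordinate (\<open>bij_flips\<close>).
\<close>

definition flips :: "nat \<Rightarrow> (nat \<Rightarrow> nat) list \<Rightarrow> bool list \<Rightarrow> (nat \<Rightarrow> nat) list" where
  "flips p \<tau>s bs = map2 (\<lambda>\<tau> b. if b then \<tau> \<circ> transpose p (Suc p) else \<tau>) \<tau>s bs"

definition ascending_perm_lists :: "nat \<Rightarrow> nat \<Rightarrow> nat \<Rightarrow> (nat \<Rightarrow> nat) list set" where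
  "ascending_perm_lists r N p = {\<tau>s \<in> perm_lists r N. \<forall>\<tau>\<in>set \<tau>s. \<tau> p < \<tau> (Suc p)}"

lemma length_flips [simp]: "length \<tau>s = N \<Longrightarrow> length bs = N \<Longrightarrow> length (flips p \<tau>s bs) = N"
  by (simp add: flips_def)

lemma nth_flips: "\<lbrakk>length \<tau>s = N; length bs = N; s < N\<rbrakk> \<Longrightarrow>
    flips p \<tau>s bs ! s = (if bs ! s then \<tau>s ! s \<circ> transpose p (Suc p) else \<tau>s ! s)"
  by (simp add: flips_def)

lemma finite_ascending_perm_lists: "finite (ascending_perm_lists r N p)"
  using finite_perm_lists by (simp add: ascending_perm_lists_def)

lemma finite_bool_lists: "finite {bs :: bool list. length bs = N}"
  using finite_lists_length_eq[of "UNIV :: bool set" N] by simp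

lemma ascending_perm_listsD:
  assumes "\<tau>s \<in> ascending_perm_lists r N p" "s < N"
  shows "(\<tau>s ! s) permutes {..<r}" "(\<tau>s ! s) p < (\<tau>s ! s) (Suc p)"
  using assms by (auto simp: ascending_perm_lists_def perm_lists_def)

lemma bij_flips:
  assumes p: "Suc p < r"
  shows "bij_betw (\<lambda>(\<tau>s, bs). flips p \<tau>s bs)
    (ascending_perm_lists r N p \<times> {bs. length bs = N}) (perm_lists r N)"
proof (rule bij_betwI[where g = "\<lambda>\<sigma>s. (map (\<lambda>\<sigma>. if \<sigma> p < \<sigma> (Suc p) then \<sigma> else \<sigma> \<circ> transpose p (Suc p)) \<sigma>s,
    map (\<lambda>\<sigma>. \<not> \<sigma> p < \<sigma> (Suc p)) \<sigma>s)"])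
  let ?s = "transpose p (Suc p)"
  have s: "?s permutes {..<r}" using p by (intro permutes_swap_id) auto
  have ne: "\<sigma> p \<noteq> \<sigma> (Suc p)" if "\<sigma> permutes {..<r}" for \<sigma>
    using permutes_inj[OF that] by (simp add: inj_eq)
  let ?g = "\<lambda>\<sigma>s. (map (\<lambda>\<sigma>. if \<sigma> p < \<sigma> (Suc p) then \<sigma> else \<sigma> \<circ> ?s) \<sigma>s, map (\<lambda>\<sigma>. \<not> \<sigma> p < \<sigma> (Suc p)) \<sigma>s)"
  show "(\<lambda>(\<tau>s, bs). flips p \<tau>s bs) \<in> ascending_perm_lists r N p \<times> {bs. length bs = N} \<rightarrow> perm_lists r N"
  proof (clarsimp, goal_cases)
    case (1 \<tau>s bs)
    then have "length \<tau>s = N" by (simp add: ascending_perm_lists_def perm_lists_def)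
    then have "(flips p \<tau>s bs ! s) permutes {..<r}" if "s < length bs" for s
      using 1 that ascending_perm_listsD(1)[OF 1(1) that] permutes_compose[OF s] by (simp add: nth_flips)
    then show ?case
      using 1 \<open>length \<tau>s = N\<close> by (auto simp: perm_lists_def in_set_conv_nth)
  qed
  show "?g \<in> perm_lists r N \<rightarrow> ascending_perm_lists r N p \<times> {bs. length bs = N}"
  proof
    fix \<sigma>s assume \<sigma>s: "\<sigma>s \<in> perm_lists r N"
    then have "\<sigma> p > \<sigma> (Suc p)" if "\<sigma> \<in> set \<sigma>s" "\<not> \<sigma> p < \<sigma> (Suc p)" for \<sigma>
      using that ne[of \<sigma>] by (auto simp: perm_lists_def)
    then show "?g \<sigma>s \<in> ascending_perm_lists r N p \<times> {bs. length bs = N}"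
      using \<sigma>s s by (auto simp: ascending_perm_lists_def perm_lists_def permutes_compose)
  qed
  show "(case ?g \<sigma>s of (\<tau>s, bs) \<Rightarrow> flips p \<tau>s bs) = \<sigma>s" if "\<sigma>s \<in> perm_lists r N" for \<sigma>s
    by (auto simp: flips_def list_eq_iff_nth_eq comp_assoc)
  show "?g (case x of (\<tau>s, bs) \<Rightarrow> flips p \<tau>s bs) = x"
    if x_in: "x \<in> ascending_perm_lists r N p \<times> {bs. length bs = N}" for x
  proof -
    obtain \<tau>s bs where x: "x = (\<tau>s, bs)" "\<tau>s \<in> ascending_perm_lists r N p" "length bs = N" using x_in by (cases x) auto
    then have "length \<tau>s = N" by (simp add: ascending_perm_lists_def perm_lists_def)
    moreover have "(\<tau>s ! s) p < (\<tau>s ! s) (Suc p)" "\<not> (\<tau>s ! s) (Suc p) < (\<tau>s ! s) p" if "s < N" for s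
      using ascending_perm_listsD(2)[OF x(2) that] by simp_all
    ultimately show ?thesis
      using x by (auto simp: list_eq_iff_nth_eq nth_flips comp_assoc)
  qed
qed

lemma sum_list_inversions_flips:
  assumes p: "Suc p < r" and \<tau>s: "\<tau>s \<in> ascending_perm_lists r N p" and bs: "length bs = N"
  shows "sum_list (map (inversions r) (flips p \<tau>s bs))
    = sum_list (map (inversions r) \<tau>s) + card {s. s < N \<and> bs ! s}"
proof -
  have len: "length \<tau>s = N" using \<tau>s by (simp add: ascending_perm_lists_def perm_lists_def)
  have "sum_list (map (inversions r) (flips p \<tau>s bs)) = (\<Sum>s<N. inversions r (flips p \<tau>s bs ! s))"
    using len bs by (simp add: sum_list_sum_nth atLeast0LessThan)
  also have "\<dots> = (\<Sum>s<N. inversions r (\<tau>s ! s) + (if bs ! s then 1 else 0))"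
    using len bs ascending_perm_listsD[OF \<tau>s] inversions_adjacent_transpose[OF p]
    by (intro sum.cong) (auto simp: nth_flips)
  also have "\<dots> = (\<Sum>s<N. inversions r (\<tau>s ! s)) + card {s. s < N \<and> bs ! s}"
    by (simp add: sum.distrib sum.If_cases Int_def)
  also have "(\<Sum>s<N. inversions r (\<tau>s ! s)) = sum_list (map (inversions r) \<tau>s)"
    using len by (simp add: sum_list_sum_nth atLeast0LessThan)
  finally show ?thesis .
qed

text \<open>
  The multi-index formed by the entries at position \<open>p\<close> of the rearranged index sets: the
  index of the \<open>p\<close>-th factor in the expansion of a minor.
\<close>

definition pick :: "nat set list \<Rightarrow> (nat \<Rightarrow> nat) list \<Rightarrow> nat \<Rightarrow> nat list" where
  "pick Is \<sigma>s p = map2 (\<lambda>I \<sigma>. sorted_list_of_set I ! \<sigma> p) Is \<sigma>s"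

lemma pick_append:
  "length Is = length \<sigma>s \<Longrightarrow> pick (Is @ Js) (\<sigma>s @ \<tau>s) p = pick Is \<sigma>s p @ pick Js \<tau>s p"
  by (simp add: pick_def)

lemma pick_multi_indices:
  assumes "set Is \<subseteq> subsets_of_card n r" "length Is = N" "\<sigma>s \<in> perm_lists r N" "p < r"
  shows "pick Is \<sigma>s p \<in> multi_indices n N"
proof -
  have len: "length \<sigma>s = N" using assms by (simp add: perm_lists_def)
  have "pick Is \<sigma>s p ! s \<in> {1..n}" if "s < N" for s
  proof -
    have "(\<sigma>s ! s) p < r" using permutes_in_image[OF perm_lists_nth[OF assms(3) that], of p] assms(4) by simp
    moreover have "Is ! s \<in> subsets_of_card n r" using assms that by auto
    ultimately show ?thesis
      using sorted_list_nth_in that assms(2) len by (simp add: pick_def del: atLeastAtMost_iff)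
  qed
  then show ?thesis using assms len by (auto simp: multi_indices_def pick_def in_set_conv_nth)
qed

text \<open>
  The box in which flips move the multi-indices at the positions \<open>p\<close> and \<open>Suc p\<close>. Its
  splittings correspond to the flips of \<open>\<tau>s\<close> (\<open>bij_pick_flips\<close>).
\<close>

definition pick_pairs :: "nat set list \<Rightarrow> (nat \<Rightarrow> nat) list \<Rightarrow> nat \<Rightarrow> nat set list" where
  "pick_pairs Is \<tau>s p = map2 (\<lambda>I \<tau>. {sorted_list_of_set I ! \<tau> p, sorted_list_of_set I ! \<tau> (Suc p)}) Is \<tau>s"

context
  fixes Is n r N \<tau>s p
  assumes Is: "set Is \<subseteq> subsets_of_card n r" "length Is = N"
    and p: "Suc p < r" and \<tau>s: "\<tau>s \<in> ascending_perm_lists r N p"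
begin

lemma length_perms: "length \<tau>s = N"
  using \<tau>s by (simp add: ascending_perm_lists_def perm_lists_def)

lemma nth_subset_of_card: "s < N \<Longrightarrow> Is ! s \<in> subsets_of_card n r"
  using Is nth_mem[of s Is] by blast

lemma pick_less:
  assumes "s < N"
  shows "sorted_list_of_set (Is ! s) ! (\<tau>s ! s) p < sorted_list_of_set (Is ! s) ! (\<tau>s ! s) (Suc p)"
proof -
  have "(\<tau>s ! s) p < r" "(\<tau>s ! s) (Suc p) < r"
    using permutes_in_image[OF ascending_perm_listsD(1)[OF \<tau>s assms]] p by auto
  then show ?thesis
    using sorted_list_nth_less_iff[OF nth_subset_of_card[OF assms]] ascending_perm_listsD(2)[OF \<tau>s assms] by simp
qed

lemma pick_pairs_box: "pick_pairs Is \<tau>s p \<in> pair_boxes n N"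
proof -
  have "pick_pairs Is \<tau>s p ! s \<subseteq> {1..n} \<and> card (pick_pairs Is \<tau>s p ! s) = 2" if "s < N" for s
  proof -
    have "(\<tau>s ! s) p < r" "(\<tau>s ! s) (Suc p) < r"
      using permutes_in_image[OF ascending_perm_listsD(1)[OF \<tau>s that]] p by auto
    then have "sorted_list_of_set (Is ! s) ! (\<tau>s ! s) p \<in> {1..n}" "sorted_list_of_set (Is ! s) ! (\<tau>s ! s) (Suc p) \<in> {1..n}"
      using sorted_list_nth_in[OF nth_subset_of_card[OF that]] by blast+
    then show ?thesis
      using pick_less[OF that] that Is(2) length_perms by (auto simp: pick_pairs_def)
  qed
  then show ?thesis
    using Is(2) length_perms by (auto simp: pair_boxes_def in_set_conv_nth pick_pairs_def)
qed

lemma nth_pick_flips: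
  assumes "length bs = N" "s < N"
  shows "pick Is (flips p \<tau>s bs) p ! s = sorted_list_of_set (Is ! s) ! (\<tau>s ! s) (if bs ! s then Suc p else p)"
    "pick Is (flips p \<tau>s bs) (Suc p) ! s = sorted_list_of_set (Is ! s) ! (\<tau>s ! s) (if bs ! s then p else Suc p)"
  using assms Is(2) length_perms by (auto simp: pick_def nth_flips)

lemma pick_flips_other:
  assumes "length bs = N" "a \<noteq> p" "a \<noteq> Suc p"
  shows "pick Is (flips p \<tau>s bs) a = pick Is \<tau>s a"
  using assms Is(2) length_perms by (intro nth_equalityI) (auto simp: pick_def nth_flips transpose_apply_other)

lemma inv_pair_pick_flips:
  assumes "length bs = N"
  shows "inv_pair (pick Is (flips p \<tau>s bs) p) (pick Is (flips p \<tau>s bs) (Suc p)) = card {s. s < N \<and> bs ! s}"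
proof -
  have "length (pick Is (flips p \<tau>s bs) p) = N" using assms Is(2) length_perms by (simp add: pick_def)
  moreover have "(pick Is (flips p \<tau>s bs) p ! s > pick Is (flips p \<tau>s bs) (Suc p) ! s) = bs ! s" if "s < N" for s
    using pick_less[OF that] by (auto simp: nth_pick_flips[OF assms that])
  ultimately show ?thesis unfolding inv_pair_def by (intro arg_cong[where f = card]) auto
qed

lemma bij_pick_flips:
  "bij_betw (\<lambda>bs. (pick Is (flips p \<tau>s bs) p, pick Is (flips p \<tau>s bs) (Suc p)))
    {bs. length bs = N} (splittings (pick_pairs Is \<tau>s p))"
proof (rule bij_betwI[where g = "\<lambda>(\<alpha>, \<beta>). map2 (>) \<alpha> \<beta>"])
  have len: "length (pick Is (flips p \<tau>s bs) a) = N" if "length bs = N" for bs a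
    using that Is(2) length_perms by (simp add: pick_def)
  have len': "length (pick_pairs Is \<tau>s p) = N" using Is(2) length_perms by (simp add: pick_pairs_def)
  have pairs: "pick_pairs Is \<tau>s p ! s = {sorted_list_of_set (Is ! s) ! (\<tau>s ! s) p, sorted_list_of_set (Is ! s) ! (\<tau>s ! s) (Suc p)}"
    if "s < N" for s using that Is(2) length_perms by (simp add: pick_pairs_def)
  show "(\<lambda>bs. (pick Is (flips p \<tau>s bs) p, pick Is (flips p \<tau>s bs) (Suc p)))
      \<in> {bs. length bs = N} \<rightarrow> splittings (pick_pairs Is \<tau>s p)"
    using len len' by (auto simp: splittings_def pairs nth_pick_flips simp del: insert_iff)
  show "(\<lambda>(\<alpha>, \<beta>). map2 (>) \<alpha> \<beta>) \<in> splittings (pick_pairs Is \<tau>s p) \<rightarrow> {bs. length bs = N}"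
    using len' by (auto simp: splittings_def)
  let ?g = "\<lambda>bs. case (pick Is (flips p \<tau>s bs) p, pick Is (flips p \<tau>s bs) (Suc p)) of (\<alpha>, \<beta>) \<Rightarrow> map2 (>) \<alpha> \<beta>"
  show "?g bs = bs" if "bs \<in> {bs. length bs = N}" for bs
  proof (rule nth_equalityI)
    show "length (?g bs) = length bs" using that len by simp
    fix s assume "s < length (?g bs)"
    then have s: "s < N" using that len by simp
    show "?g bs ! s = bs ! s" using that len s pick_less[OF s] by (simp add: nth_pick_flips)
  qed
  show "(pick Is (flips p \<tau>s (case x of (\<alpha>, \<beta>) \<Rightarrow> map2 (>) \<alpha> \<beta>)) p,
      pick Is (flips p \<tau>s (case x of (\<alpha>, \<beta>) \<Rightarrow> map2 (>) \<alpha> \<beta>)) (Suc p)) = x"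
    if "x \<in> splittings (pick_pairs Is \<tau>s p)" for x
  proof -
    obtain \<alpha> \<beta> where x: "x = (\<alpha>, \<beta>)" by (cases x)
    then have l: "length \<alpha> = N" "length \<beta> = N"
      and eq: "\<And>s. s < N \<Longrightarrow> {\<alpha> ! s, \<beta> ! s} = pick_pairs Is \<tau>s p ! s"
      using that len' by (auto simp: splittings_def simp del: insert_iff)
    have lb: "length (map2 (>) \<alpha> \<beta>) = N" using l by simp
    have "pick Is (flips p \<tau>s (map2 (>) \<alpha> \<beta>)) p ! s = \<alpha> ! s \<and> pick Is (flips p \<tau>s (map2 (>) \<alpha> \<beta>)) (Suc p) ! s = \<beta> ! s"
      if "s < N" for s
      unfolding nth_pick_flips[OF lb that]
      using eq[OF that] pairs[OF that] pick_less[OF that] l that by (auto simp: doubleton_eq_iff)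
    then have "pick Is (flips p \<tau>s (map2 (>) \<alpha> \<beta>)) p = \<alpha>" "pick Is (flips p \<tau>s (map2 (>) \<alpha> \<beta>)) (Suc p) = \<beta>"
      using len[OF lb, of p] len[OF lb, of "Suc p"] l by (simp_all add: list_eq_iff_nth_eq)
    then show ?thesis using x by simp
  qed
qed

end

section \<open>Minors with a free row of indices\<close>

context unital_alg
begin

definition alternating :: "'f \<Rightarrow> nat \<Rightarrow> nat \<Rightarrow> (nat list \<Rightarrow> 'a) \<Rightarrow> bool" where
  "alternating q n r f \<longleftrightarrow> (\<forall>ks\<in>multi_indices n r. f ks \<in> carrier A) \<and>
     (\<forall>xs i ys. xs @ i # i # ys \<in> multi_indices n r \<longrightarrow> f (xs @ i # i # ys) = \<zero>) \<and>
     (\<forall>xs i j ys. i < j \<longrightarrow> xs @ i # j # ys \<in> multi_indices n r \<longrightarrow>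
        f (xs @ j # i # ys) = (- q) \<odot> f (xs @ i # j # ys))"

text \<open>
  Bubble sort: each swap of an adjacent descent removes one inversion and one factor \<open>-q\<close>.
  If the sorted sequence has a repetition, then it has one in adjacent places.
\<close>

lemma alternating_sort:
  assumes f: "alternating q n r f" and ks: "ks \<in> multi_indices n r"
  shows "(\<not> distinct ks \<longrightarrow> f ks = \<zero>) \<and>
    (distinct ks \<longrightarrow> f ks = (- q) ^ list_inversions ks \<odot> f (sort ks))"
  using ks
proof (induction "list_inversions ks" arbitrary: ks rule: less_induct)
  case less
  show ?case
  proof (cases "sorted ks")
    case True
    have "f ks = \<zero>" if nd: "\<not> distinct ks"
    proof -
      obtain xs i ys where "ks = xs @ i # i # ys" by (rule sorted_not_distinct_decompose[OF True nd])
      then show ?thesis using f less.prems by (auto simp: alternating_def)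
    qed
    moreover have "f ks = (- q) ^ list_inversions ks \<odot> f (sort ks)"
      using True f less.prems by (simp add: sort_key_id_if_sorted list_inversions_sorted alternating_def)
    ultimately show ?thesis by simp
  next
    case False
    then obtain xs i j ys where ks: "ks = xs @ j # i # ys" "i < j" by (rule not_sorted_decompose)
    let ?ks = "xs @ i # j # ys"
    have mi: "?ks \<in> multi_indices n r" using less.prems ks by (auto simp: multi_indices_def)
    have inv: "list_inversions ks = Suc (list_inversions ?ks)" using list_inversions_swap ks by simp
    have "f ks = (- q) \<odot> f ?ks" using f ks mi by (simp add: alternating_def)
    moreover have "sort ks = sort ?ks" using ks by (intro properties_for_sort) auto
    moreover have "distinct ks = distinct ?ks" using ks by auto
    moreover have "sort ?ks \<in> multi_indices n r" using mi by (simp add: multi_indices_def)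
    then have "f (sort ?ks) \<in> carrier A" using f by (simp add: alternating_def)
    ultimately show ?thesis
      using less.hyps[OF _ mi] inv by (auto simp: smult_smult)
  qed
qed

lemma alternating_arrange:
  assumes "alternating q n r f" "K \<in> subsets_of_card n r" "\<sigma> permutes {..<r}"
  shows "f (arrange r K \<sigma>) = (- q) ^ inversions r \<sigma> \<odot> f (sorted_list_of_set K)"
  using alternating_sort[OF assms(1), of "arrange r K \<sigma>"] arrange_props[OF assms(2,3)]
    subsets_of_cardD(2)[OF assms(2)] by (simp add: multi_indices_def)

definition row_product :: "(nat list \<Rightarrow> 'a) \<Rightarrow> nat \<Rightarrow> (nat \<Rightarrow> nat list) \<Rightarrow> 'a" where
  "row_product \<phi> r \<alpha> = lprod (map (\<lambda>p. \<phi> (\<alpha> p)) [0..<r])"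

definition minor :: "(nat list \<Rightarrow> 'a) \<Rightarrow> 'f \<Rightarrow> nat \<Rightarrow> nat set list \<Rightarrow> 'a" where
  "minor \<phi> q r Is = (\<Oplus>\<sigma>s\<in>perm_lists r (length Is - 1).
     (- q) ^ sum_list (map (inversions r) \<sigma>s) \<odot> row_product \<phi> r (pick Is (id # \<sigma>s)))"

text \<open>
  The minor in which the first index of the \<open>p\<close>-th factor is the \<open>p\<close>-th entry of an arbitrary
  sequence \<open>ks\<close>; for an increasing sequence it is an ordinary minor.
\<close>

definition row_minor :: "(nat list \<Rightarrow> 'a) \<Rightarrow> 'f \<Rightarrow> nat \<Rightarrow> nat set list \<Rightarrow> nat list \<Rightarrow> 'a" where
  "row_minor \<psi> q r Js ks = (\<Oplus>\<tau>s\<in>perm_lists r (length Js).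
     (- q) ^ sum_list (map (inversions r) \<tau>s) \<odot> row_product \<psi> r (\<lambda>p. ks ! p # pick Js \<tau>s p))"

lemma row_product_closed:
  "(\<And>p. p < r \<Longrightarrow> \<phi> (\<alpha> p) \<in> carrier A) \<Longrightarrow> row_product \<phi> r \<alpha> \<in> carrier A"
  unfolding row_product_def by (rule lprod_closed) auto

lemma row_product_cong:
  "(\<And>p. p < r \<Longrightarrow> \<phi> (\<alpha> p) = \<psi> (\<beta> p)) \<Longrightarrow> row_product \<phi> r \<alpha> = row_product \<psi> r \<beta>"
  unfolding row_product_def by (rule arg_cong[where f = lprod]) auto

lemma row_minor_sorted:
  "row_minor \<psi> q r Js (sorted_list_of_set K) = minor \<psi> q r (K # Js)"
  by (simp add: row_minor_def minor_def pick_def[abs_def])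

text \<open>Positions \<open>p\<close> and \<open>Suc p\<close> are the ones on which the quadratic relations will act.\<close>

lemma row_product_split:
  assumes p: "Suc p < r" and \<phi>: "\<And>a. a < r \<Longrightarrow> \<phi> (\<alpha> a) \<in> carrier A"
  shows "row_product \<phi> r \<alpha> = lprod (map (\<lambda>a. \<phi> (\<alpha> a)) [0..<p]) \<otimes> (\<phi> (\<alpha> p) \<otimes> \<phi> (\<alpha> (Suc p))) \<otimes>
    lprod (map (\<lambda>a. \<phi> (\<alpha> a)) [Suc (Suc p)..<r])"
proof -
  have "[0..<r] = [0..<p] @ p # Suc p # [Suc (Suc p)..<r]"
    using p upt_add_eq_append[of 0 p "r - p"] by (simp add: upt_conv_Cons)
  then have "row_product \<phi> r \<alpha> = lprod (map (\<lambda>a. \<phi> (\<alpha> a)) [0..<p]) \<otimes>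
      (\<phi> (\<alpha> p) \<otimes> (\<phi> (\<alpha> (Suc p)) \<otimes> lprod (map (\<lambda>a. \<phi> (\<alpha> a)) [Suc (Suc p)..<r])))"
    unfolding row_product_def using \<phi> p by (simp add: lprod_append image_subset_iff)
  moreover have "lprod (map (\<lambda>a. \<phi> (\<alpha> a)) [0..<p]) \<in> carrier A"
    "lprod (map (\<lambda>a. \<phi> (\<alpha> a)) [Suc (Suc p)..<r]) \<in> carrier A"
    using \<phi> p by (auto intro!: lprod_closed)
  ultimately show ?thesis using \<phi> p by (simp add: m_assoc)
qed

text \<open>
  The factors at two adjacent positions are isolated. Tuples of permutations are grouped by
  their ascending representatives at this place: within a group the outer factors \<open>L\<close> and \<open>M\<close>
  are constant, and the middle ones sum to the quadratic sum over \<open>pick_pairs\<close>. Since \<open>c\<close>,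
  \<open>L\<close> and \<open>M\<close> do not depend on \<open>i\<close> and \<open>j\<close>, the exchange relations of the quadratic
  sums carry over to the minor.
\<close>

lemma row_minor_adjacent:
  assumes \<psi>: "hyp_family q n (Suc l) \<psi>" and Js: "set Js \<subseteq> subsets_of_card n r" "length Js = l"
    and ks: "set xs \<subseteq> {1..n}" "set ys \<subseteq> {1..n}" "r = Suc (Suc (length xs + length ys))"
  obtains c L M where "\<And>\<tau>s. \<tau>s \<in> ascending_perm_lists r l (length xs) \<Longrightarrow> L \<tau>s \<in> carrier A"
    "\<And>\<tau>s. \<tau>s \<in> ascending_perm_lists r l (length xs) \<Longrightarrow> M \<tau>s \<in> carrier A"
    "\<And>i j. \<lbrakk>i \<in> {1..n}; j \<in> {1..n}\<rbrakk> \<Longrightarrow> row_minor \<psi> q r Js (xs @ i # j # ys) =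
      (\<Oplus>\<tau>s\<in>ascending_perm_lists r l (length xs).
        c \<tau>s \<odot> (L \<tau>s \<otimes> quad \<psi> q 0 (pick_pairs Js \<tau>s (length xs)) i j \<otimes> M \<tau>s))"
proof -
  let ?p = "length xs"
  let ?Asc = "ascending_perm_lists r l ?p" and ?Bs = "{bs :: bool list. length bs = l}"
  define L where "L \<tau>s = lprod (map (\<lambda>a. \<psi> (xs ! a # pick Js \<tau>s a)) [0..<?p])" for \<tau>s
  define M where "M \<tau>s = lprod (map (\<lambda>a. \<psi> (ys ! (a - Suc (Suc ?p)) # pick Js \<tau>s a)) [Suc (Suc ?p)..<r])" for \<tau>s
  let ?e = "\<lambda>\<sigma>s. (- q) ^ sum_list (map (inversions r) \<sigma>s)"
  let ?\<alpha> = "\<lambda>\<tau>s bs. pick Js (flips ?p \<tau>s bs) ?p" and ?\<beta> = "\<lambda>\<tau>s bs. pick Js (flips ?p \<tau>s bs) (Suc ?p)"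
  have r: "Suc ?p < r" using ks by simp
  have \<psi>_in: "\<psi> (k # pick Js \<sigma>s a) \<in> carrier A" if "\<sigma>s \<in> perm_lists r l" "a < r" "k \<in> {1..n}" for k \<sigma>s a
    using pick_multi_indices[OF Js that(1,2)] that(3)
    by (intro hyp_familyD(1)[OF \<psi>]) (auto simp: multi_indices_def)
  have Asc: "\<tau>s \<in> perm_lists r l" if "\<tau>s \<in> ?Asc" for \<tau>s
    using that by (simp add: ascending_perm_lists_def)
  have flips_in: "flips ?p \<tau>s bs \<in> perm_lists r l" if "\<tau>s \<in> ?Asc" "bs \<in> ?Bs" for \<tau>s bs
    using bij_flips[OF r, of l] that by (auto simp: bij_betw_def)
  have L_in: "L \<tau>s \<in> carrier A" if "\<tau>s \<in> ?Asc" for \<tau>s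
    unfolding L_def
  proof (intro lprod_closed, clarsimp)
    fix a assume "a < ?p"
    then show "\<psi> (xs ! a # pick Js \<tau>s a) \<in> carrier A"
      using ks r by (intro \<psi>_in Asc that) (auto simp: subset_iff)
  qed
  have M_in: "M \<tau>s \<in> carrier A" if "\<tau>s \<in> ?Asc" for \<tau>s
    unfolding M_def
  proof (intro lprod_closed, clarsimp)
    fix a assume a: "Suc (Suc ?p) \<le> a" "a < r"
    then have "a - Suc (Suc ?p) < length ys" using ks by auto
    then have "ys ! (a - Suc (Suc ?p)) \<in> {1..n}" using ks nth_mem by blast
    then show "\<psi> (ys ! (a - Suc (Suc ?p)) # pick Js \<tau>s a) \<in> carrier A"
      using a by (intro \<psi>_in Asc that)
  qed
  have expansion: "row_minor \<psi> q r Js (xs @ i # j # ys) =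
      (\<Oplus>\<tau>s\<in>?Asc. ?e \<tau>s \<odot> (L \<tau>s \<otimes> quad \<psi> q 0 (pick_pairs Js \<tau>s ?p) i j \<otimes> M \<tau>s))"
    if X: "i \<in> {1..n}" "j \<in> {1..n}" for i j
  proof -
    let ?ks = "xs @ i # j # ys"
    have nth_ks: "?ks ! a \<in> {1..n}" if "a < r" for a
    proof -
      have "?ks ! a \<in> set ?ks" using that ks by (intro nth_mem) simp
      then show ?thesis using ks X by auto
    qed
    have prod: "row_product \<psi> r (\<lambda>a. ?ks ! a # pick Js (flips ?p \<tau>s bs) a)
        = L \<tau>s \<otimes> (\<psi> (i # ?\<alpha> \<tau>s bs) \<otimes> \<psi> (j # ?\<beta> \<tau>s bs)) \<otimes> M \<tau>s"
      if \<tau>s: "\<tau>s \<in> ?Asc" and bs: "bs \<in> ?Bs" for \<tau>s bs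
    proof -
      note other = pick_flips_other[OF Js r \<tau>s, of bs]
      have "map (\<lambda>a. \<psi> (?ks ! a # pick Js (flips ?p \<tau>s bs) a)) [0..<?p]
          = map (\<lambda>a. \<psi> (xs ! a # pick Js \<tau>s a)) [0..<?p]"
        using other bs by (auto simp: nth_append)
      moreover have "map (\<lambda>a. \<psi> (?ks ! a # pick Js (flips ?p \<tau>s bs) a)) [Suc (Suc ?p)..<r]
          = map (\<lambda>a. \<psi> (ys ! (a - Suc (Suc ?p)) # pick Js \<tau>s a)) [Suc (Suc ?p)..<r]"
        using other bs by (auto simp: nth_append nth_Cons' numeral_2_eq_2)
      moreover have "row_product \<psi> r (\<lambda>a. ?ks ! a # pick Js (flips ?p \<tau>s bs) a) =
          lprod (map (\<lambda>a. \<psi> (?ks ! a # pick Js (flips ?p \<tau>s bs) a)) [0..<?p]) \<otimes>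
          (\<psi> (?ks ! ?p # ?\<alpha> \<tau>s bs) \<otimes> \<psi> (?ks ! Suc ?p # ?\<beta> \<tau>s bs)) \<otimes>
          lprod (map (\<lambda>a. \<psi> (?ks ! a # pick Js (flips ?p \<tau>s bs) a)) [Suc (Suc ?p)..<r])"
        by (rule row_product_split[OF r]) (rule \<psi>_in[OF flips_in[OF \<tau>s bs] _ nth_ks])
      moreover have "?ks ! ?p = i" "?ks ! Suc ?p = j" by (simp_all add: nth_append)
      ultimately show ?thesis by (simp only: L_def M_def)
    qed
    have pair_in: "\<psi> (i # ?\<alpha> \<tau>s bs) \<otimes> \<psi> (j # ?\<beta> \<tau>s bs) \<in> carrier A" if "\<tau>s \<in> ?Asc" "bs \<in> ?Bs" for \<tau>s bs
      using \<psi>_in[OF flips_in[OF that]] X r by simp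
    have term_in: "L \<tau>s \<otimes> (\<psi> (i # ?\<alpha> \<tau>s bs) \<otimes> \<psi> (j # ?\<beta> \<tau>s bs)) \<otimes> M \<tau>s \<in> carrier A"
      if "\<tau>s \<in> ?Asc" "bs \<in> ?Bs" for \<tau>s bs
      using pair_in[OF that] L_in M_in that by simp
    have inner: "(\<Oplus>bs\<in>?Bs. ?e (flips ?p \<tau>s bs) \<odot> (L \<tau>s \<otimes> (\<psi> (i # ?\<alpha> \<tau>s bs) \<otimes> \<psi> (j # ?\<beta> \<tau>s bs)) \<otimes> M \<tau>s))
        = ?e \<tau>s \<odot> (L \<tau>s \<otimes> quad \<psi> q 0 (pick_pairs Js \<tau>s ?p) i j \<otimes> M \<tau>s)" if \<tau>s: "\<tau>s \<in> ?Asc" for \<tau>s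
    proof -
      let ?c = "\<lambda>bs. (- q) ^ inv_pair (?\<alpha> \<tau>s bs) (?\<beta> \<tau>s bs)"
      let ?t = "\<lambda>bs. \<psi> (i # ?\<alpha> \<tau>s bs) \<otimes> \<psi> (j # ?\<beta> \<tau>s bs)"
      have cl: "\<psi> (insert_at 0 i (fst x)) \<otimes> \<psi> (insert_at 0 j (snd x)) \<in> carrier A"
        if "x \<in> splittings (pick_pairs Js \<tau>s ?p)" for x
        using that X splittings_insert_at[of _ n "Suc l"] pick_pairs_box[OF Js r \<tau>s]
        by (intro m_closed hyp_familyD(1)[OF \<psi>]) auto
      have "quad \<psi> q 0 (pick_pairs Js \<tau>s ?p) i j = (\<Oplus>bs\<in>?Bs. ?c bs \<odot> ?t bs)"
        unfolding quad_def split_sum_def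
        using cl by (subst finsum_bij[OF bij_pick_flips[OF Js r \<tau>s]]) (auto simp: insert_at_def)
      moreover have "L \<tau>s \<otimes> (\<Oplus>bs\<in>?Bs. ?c bs \<odot> ?t bs) = (\<Oplus>bs\<in>?Bs. L \<tau>s \<otimes> (?c bs \<odot> ?t bs))"
        by (intro finsum_mult_distrib_left smult_closed pair_in[OF \<tau>s] L_in[OF \<tau>s])
      moreover have "(\<Oplus>bs\<in>?Bs. L \<tau>s \<otimes> (?c bs \<odot> ?t bs)) \<otimes> M \<tau>s = (\<Oplus>bs\<in>?Bs. L \<tau>s \<otimes> (?c bs \<odot> ?t bs) \<otimes> M \<tau>s)"
        by (intro finsum_mult_distrib_right m_closed smult_closed pair_in[OF \<tau>s] L_in[OF \<tau>s] M_in[OF \<tau>s])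
      moreover have "?e \<tau>s \<odot> (\<Oplus>bs\<in>?Bs. L \<tau>s \<otimes> (?c bs \<odot> ?t bs) \<otimes> M \<tau>s)
          = (\<Oplus>bs\<in>?Bs. ?e \<tau>s \<odot> (L \<tau>s \<otimes> (?c bs \<odot> ?t bs) \<otimes> M \<tau>s))"
        by (intro smult_finsum m_closed smult_closed pair_in[OF \<tau>s] L_in[OF \<tau>s] M_in[OF \<tau>s])
      ultimately have "?e \<tau>s \<odot> (L \<tau>s \<otimes> quad \<psi> q 0 (pick_pairs Js \<tau>s ?p) i j \<otimes> M \<tau>s)
          = (\<Oplus>bs\<in>?Bs. ?e \<tau>s \<odot> (L \<tau>s \<otimes> (?c bs \<odot> ?t bs) \<otimes> M \<tau>s))"
        by simp
      also have "\<dots> = (\<Oplus>bs\<in>?Bs. ?e (flips ?p \<tau>s bs) \<odot> (L \<tau>s \<otimes> ?t bs \<otimes> M \<tau>s))"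
      proof (rule finsum_cong', rule refl)
        fix bs assume bs: "bs \<in> ?Bs"
        have "?e (flips ?p \<tau>s bs) = ?e \<tau>s * ?c bs"
          using bs sum_list_inversions_flips[OF r \<tau>s] inv_pair_pick_flips[OF Js r \<tau>s]
          by (simp add: power_add)
        then show "?e \<tau>s \<odot> (L \<tau>s \<otimes> (?c bs \<odot> ?t bs) \<otimes> M \<tau>s) = ?e (flips ?p \<tau>s bs) \<odot> (L \<tau>s \<otimes> ?t bs \<otimes> M \<tau>s)"
          using L_in[OF \<tau>s] M_in[OF \<tau>s] pair_in[OF \<tau>s bs] by (simp add: smult_mult_left smult_mult_right smult_smult)
      qed (use term_in[OF \<tau>s] in auto)
      finally show ?thesis by simp
    qed
    have "row_minor \<psi> q r Js ?ks = (\<Oplus>\<sigma>s\<in>perm_lists r l. ?e \<sigma>s \<odot> row_product \<psi> r (\<lambda>a. ?ks ! a # pick Js \<sigma>s a))"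
      by (simp add: row_minor_def Js)
    also have "\<dots> = (\<Oplus>x\<in>?Asc \<times> ?Bs. ?e (flips ?p (fst x) (snd x)) \<odot>
        row_product \<psi> r (\<lambda>a. ?ks ! a # pick Js (flips ?p (fst x) (snd x)) a))"
      using \<psi>_in nth_ks by (subst finsum_bij[OF bij_flips[OF r, of l]])
        (auto simp: case_prod_beta intro!: smult_closed row_product_closed)
    also have "\<dots> = (\<Oplus>x\<in>?Asc \<times> ?Bs. ?e (flips ?p (fst x) (snd x)) \<odot>
        (L (fst x) \<otimes> (\<psi> (i # ?\<alpha> (fst x) (snd x)) \<otimes> \<psi> (j # ?\<beta> (fst x) (snd x))) \<otimes> M (fst x)))"
      by (rule finsum_cong') (use prod term_in in auto)
    also have "\<dots> = (\<Oplus>\<tau>s\<in>?Asc. \<Oplus>bs\<in>?Bs. ?e (flips ?p \<tau>s bs) \<odot>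
        (L \<tau>s \<otimes> (\<psi> (i # ?\<alpha> \<tau>s bs) \<otimes> \<psi> (j # ?\<beta> \<tau>s bs)) \<otimes> M \<tau>s))"
      by (rule finsum_cartesian) (use term_in finite_ascending_perm_lists finite_bool_lists in auto)
    also have "\<dots> = (\<Oplus>\<tau>s\<in>?Asc. ?e \<tau>s \<odot> (L \<tau>s \<otimes> quad \<psi> q 0 (pick_pairs Js \<tau>s ?p) i j \<otimes> M \<tau>s))"
    proof (rule finsum_cong', rule refl)
      have "quad \<psi> q 0 (pick_pairs Js \<tau>s ?p) i j \<in> carrier A" if "\<tau>s \<in> ?Asc" for \<tau>s
        using pick_pairs_box[OF Js r that] X by (intro quad_closed[OF \<psi>]) auto
      then show "(\<lambda>\<tau>s. ?e \<tau>s \<odot> (L \<tau>s \<otimes> quad \<psi> q 0 (pick_pairs Js \<tau>s ?p) i j \<otimes> M \<tau>s)) \<in> ?Asc \<rightarrow> carrier A"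
        using L_in M_in by auto
    qed (rule inner)
    finally show ?thesis .
  qed
  show thesis by (rule that[OF L_in M_in expansion])
qed

theorem row_minor_alternating:
  assumes \<psi>: "hyp_family q n (Suc l) \<psi>" and Js: "set Js \<subseteq> subsets_of_card n r" "length Js = l"
  shows "alternating q n r (row_minor \<psi> q r Js)"
proof -
  have swap: "(i = j \<longrightarrow> row_minor \<psi> q r Js (xs @ i # j # ys) = \<zero>) \<and>
      (i < j \<longrightarrow> row_minor \<psi> q r Js (xs @ j # i # ys) = (- q) \<odot> row_minor \<psi> q r Js (xs @ i # j # ys))"
    if ks: "xs @ i # j # ys \<in> multi_indices n r" for xs i j ys
  proof -
    have *: "set xs \<subseteq> {1..n}" "set ys \<subseteq> {1..n}" "r = Suc (Suc (length xs + length ys))"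
      and X: "i \<in> {1..n}" "j \<in> {1..n}" using ks by (auto simp: multi_indices_def)
    have p: "Suc (length xs) < r" using * by simp
    obtain c L M where LM: "\<And>\<tau>s. \<tau>s \<in> ascending_perm_lists r l (length xs) \<Longrightarrow> L \<tau>s \<in> carrier A"
      "\<And>\<tau>s. \<tau>s \<in> ascending_perm_lists r l (length xs) \<Longrightarrow> M \<tau>s \<in> carrier A"
      "\<And>i j. \<lbrakk>i \<in> {1..n}; j \<in> {1..n}\<rbrakk> \<Longrightarrow> row_minor \<psi> q r Js (xs @ i # j # ys) =
        (\<Oplus>\<tau>s\<in>ascending_perm_lists r l (length xs).
          c \<tau>s \<odot> (L \<tau>s \<otimes> quad \<psi> q 0 (pick_pairs Js \<tau>s (length xs)) i j \<otimes> M \<tau>s))"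
      by (rule row_minor_adjacent[OF \<psi> Js *]) (rule that)
    let ?Asc = "ascending_perm_lists r l (length xs)" and ?quad = "\<lambda>\<tau>s. quad \<psi> q 0 (pick_pairs Js \<tau>s (length xs))"
    have quad_in: "?quad \<tau>s i j \<in> carrier A" if "\<tau>s \<in> ?Asc" for \<tau>s
      using pick_pairs_box[OF Js p that] X by (intro quad_closed[OF \<psi>]) auto
    have "row_minor \<psi> q r Js (xs @ i # j # ys) = \<zero>" if "i = j"
    proof -
      have "row_minor \<psi> q r Js (xs @ i # j # ys) = (\<Oplus>\<tau>s\<in>?Asc. \<zero>)"
        unfolding LM(3)[OF X]
        by (intro finsum_cong')
          (use that LM(1,2) hyp_familyD(2)[OF \<psi>, of 0] pick_pairs_box[OF Js p] X in auto)
      then show ?thesis by simp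
    qed
    moreover have "row_minor \<psi> q r Js (xs @ j # i # ys) = (- q) \<odot> row_minor \<psi> q r Js (xs @ i # j # ys)"
      if ij: "i < j"
    proof -
      have quad: "?quad \<tau>s j i = (- q) \<odot> ?quad \<tau>s i j" if "\<tau>s \<in> ?Asc" for \<tau>s
        using hyp_familyD(3)[OF \<psi>, of 0] pick_pairs_box[OF Js p that] X ij by auto
      have "row_minor \<psi> q r Js (xs @ j # i # ys) = (\<Oplus>\<tau>s\<in>?Asc. (- q) \<odot> (c \<tau>s \<odot> (L \<tau>s \<otimes> ?quad \<tau>s i j \<otimes> M \<tau>s)))"
        unfolding LM(3)[OF X(2,1)]
        by (rule finsum_cong')
          (use LM(1,2) quad quad_in in \<open>auto simp: smult_mult_left smult_mult_right smult_smult mult.commute\<close>)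
      also have "\<dots> = (- q) \<odot> row_minor \<psi> q r Js (xs @ i # j # ys)"
        unfolding LM(3)[OF X] by (rule smult_finsum[symmetric]) (use LM(1,2) quad quad_in in auto)
      finally show ?thesis .
    qed
    ultimately show ?thesis by blast
  qed
  have closed: "row_minor \<psi> q r Js ks \<in> carrier A" if ks: "ks \<in> multi_indices n r" for ks
    unfolding row_minor_def
  proof (intro finsum_closed funcsetI smult_closed row_product_closed hyp_familyD(1)[OF \<psi>])
    fix \<tau>s p assume "\<tau>s \<in> perm_lists r (length Js)" "p < r"
    then show "ks ! p # pick Js \<tau>s p \<in> multi_indices n (Suc l)"
      using pick_multi_indices[OF Js, of \<tau>s p] ks nth_mem[of p ks] Js by (auto simp: multi_indices_def simp del: nth_mem)
  qed
  show ?thesis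
    unfolding alternating_def using closed swap by blast
qed

end

section \<open>The Cauchy-Binet formula\<close>

context unital_alg
begin

definition col_minor :: "(nat list \<Rightarrow> 'a) \<Rightarrow> 'f \<Rightarrow> nat \<Rightarrow> nat set list \<Rightarrow> nat list \<Rightarrow> 'a" where
  "col_minor \<phi> q r Is ks = (\<Oplus>\<sigma>s\<in>perm_lists r (length Is - 1).
     (- q) ^ sum_list (map (inversions r) \<sigma>s) \<odot>
       row_product \<phi> r (\<lambda>p. pick Is (id # \<sigma>s) p @ [ks ! p]))"

text \<open>
  The last permutation in a minor only rearranges the last indices, so the minor is the
  weighted sum of its versions with a free last index over the arrangements of \<open>K\<close>.
\<close>

lemma minor_snoc:
  assumes \<phi>: "\<And>\<alpha>. \<alpha> \<in> multi_indices n (Suc (length Is)) \<Longrightarrow> \<phi> \<alpha> \<in> carrier A"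
    and Is: "Is \<noteq> []" "set Is \<subseteq> subsets_of_card n r" and K: "K \<in> subsets_of_card n r"
  shows "minor \<phi> q r (Is @ [K])
    = (\<Oplus>\<sigma>\<in>{\<sigma>. \<sigma> permutes {..<r}}. (- q) ^ inversions r \<sigma> \<odot> col_minor \<phi> q r Is (arrange r K \<sigma>))"
proof -
  let ?e = "\<lambda>\<sigma>s. (- q) ^ sum_list (map (inversions r) \<sigma>s)"
  let ?Perm = "{\<sigma>. \<sigma> permutes {..<r}}"
  let ?rp = "\<lambda>\<sigma>s \<sigma>. row_product \<phi> r (\<lambda>p. pick Is (id # \<sigma>s) p @ [arrange r K \<sigma> ! p])"
  obtain N where N: "length Is = Suc N" using Is(1) by (cases Is) auto
  have rp: "row_product \<phi> r (pick (Is @ [K]) (id # \<sigma>s @ [\<sigma>])) = ?rp \<sigma>s \<sigma>" if "\<sigma>s \<in> perm_lists r N" for \<sigma>s \<sigma>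
  proof (rule row_product_cong)
    fix p assume "p < r"
    moreover have "pick (Is @ [K]) ((id # \<sigma>s) @ [\<sigma>]) p = pick Is (id # \<sigma>s) p @ pick [K] [\<sigma>] p"
      using that N by (intro pick_append) (simp add: perm_lists_def)
    ultimately show "\<phi> (pick (Is @ [K]) (id # \<sigma>s @ [\<sigma>]) p) = \<phi> (pick Is (id # \<sigma>s) p @ [arrange r K \<sigma> ! p])"
      by (simp add: pick_def[of "[K]"] arrange_def)
  qed
  have in_mi: "pick Is (id # \<sigma>s) p @ [arrange r K \<sigma> ! p] \<in> multi_indices n (Suc (length Is))"
    if "\<sigma>s \<in> perm_lists r N" "\<sigma> permutes {..<r}" "p < r" for \<sigma>s \<sigma> p
  proof -
    have "pick Is (id # \<sigma>s) p \<in> multi_indices n (length Is)"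
      using pick_multi_indices[OF Is(2) N id_Cons_perm_lists[OF that(1)] that(3)] N by simp
    moreover have "arrange r K \<sigma> ! p \<in> {1..n}"
    proof -
      have "arrange r K \<sigma> ! p \<in> set (arrange r K \<sigma>)"
        using arrange_props(1)[OF K that(2)] that(3) by (intro nth_mem) simp
      then show ?thesis using arrange_props(2)[OF K that(2)] subsets_of_cardD(2)[OF K] by auto
    qed
    ultimately show ?thesis by (auto simp: multi_indices_def)
  qed
  have rp_in: "?rp \<sigma>s \<sigma> \<in> carrier A" if "\<sigma>s \<in> perm_lists r N" "\<sigma> permutes {..<r}" for \<sigma>s \<sigma>
    using in_mi[OF that] by (intro row_product_closed \<phi>)
  have fin: "finite ?Perm" by (rule finite_permutations) simp
  have "minor \<phi> q r (Is @ [K]) = (\<Oplus>\<rho>s\<in>perm_lists r (Suc N). ?e \<rho>s \<odot> row_product \<phi> r (pick (Is @ [K]) (id # \<rho>s)))"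
    using N by (simp add: minor_def)
  also have "\<dots> = (\<Oplus>x\<in>perm_lists r N \<times> ?Perm. ?e (fst x @ [snd x]) \<odot> row_product \<phi> r (pick (Is @ [K]) (id # fst x @ [snd x])))"
  proof (subst finsum_bij[OF bij_perm_lists_snoc])
    fix \<rho>s assume "\<rho>s \<in> perm_lists r (Suc N)"
    then have "\<rho>s \<in> (\<lambda>(\<sigma>s, \<sigma>). \<sigma>s @ [\<sigma>]) ` (perm_lists r N \<times> ?Perm)"
      using bij_perm_lists_snoc[of r N] by (simp add: bij_betw_def)
    then obtain \<sigma>s \<sigma> where "\<rho>s = \<sigma>s @ [\<sigma>]" "\<sigma>s \<in> perm_lists r N" "\<sigma> permutes {..<r}" by auto
    then show "?e \<rho>s \<odot> row_product \<phi> r (pick (Is @ [K]) (id # \<rho>s)) \<in> carrier A"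
      using rp rp_in by simp
  qed (simp add: case_prod_beta)
  also have "\<dots> = (\<Oplus>x\<in>perm_lists r N \<times> ?Perm. (- q) ^ inversions r (snd x) \<odot> (?e (fst x) \<odot> ?rp (fst x) (snd x)))"
    by (rule finsum_cong') (use rp rp_in in \<open>auto simp: smult_smult power_add mult.commute\<close>)
  also have "\<dots> = (\<Oplus>\<sigma>s\<in>perm_lists r N. \<Oplus>\<sigma>\<in>?Perm. (- q) ^ inversions r \<sigma> \<odot> (?e \<sigma>s \<odot> ?rp \<sigma>s \<sigma>))"
    by (rule finsum_cartesian) (use rp_in fin finite_perm_lists in auto)
  also have "\<dots> = (\<Oplus>\<sigma>\<in>?Perm. \<Oplus>\<sigma>s\<in>perm_lists r N. (- q) ^ inversions r \<sigma> \<odot> (?e \<sigma>s \<odot> ?rp \<sigma>s \<sigma>))"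
    by (rule finsum_swap) (use rp_in fin finite_perm_lists in auto)
  also have "\<dots> = (\<Oplus>\<sigma>\<in>?Perm. (- q) ^ inversions r \<sigma> \<odot> col_minor \<phi> q r Is (arrange r K \<sigma>))"
    unfolding col_minor_def N diff_Suc_1 by (intro finsum_cong' smult_finsum[symmetric]) (use rp_in in auto)
  finally show ?thesis .
qed

lemma row_minor_term_closed:
  assumes \<psi>: "\<And>\<alpha>. \<alpha> \<in> multi_indices n (Suc l) \<Longrightarrow> \<psi> \<alpha> \<in> carrier A"
    and Js: "set Js \<subseteq> subsets_of_card n r" "length Js = l" and ks: "ks \<in> multi_indices n r"
    and \<tau>s: "\<tau>s \<in> perm_lists r l"
  shows "row_product \<psi> r (\<lambda>p. ks ! p # pick Js \<tau>s p) \<in> carrier A"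
proof (intro row_product_closed \<psi>)
  fix p assume "p < r"
  then have "ks ! p \<in> {1..n}" "pick Js \<tau>s p \<in> multi_indices n l"
    using ks pick_multi_indices[OF Js \<tau>s] nth_mem[of p ks] by (auto simp: multi_indices_def simp del: nth_mem)
  then show "ks ! p # pick Js \<tau>s p \<in> multi_indices n (Suc l)" by (auto simp: multi_indices_def)
qed

lemma col_minor_term_closed:
  assumes \<phi>: "\<And>\<alpha>. \<alpha> \<in> multi_indices n (Suc (length Is)) \<Longrightarrow> \<phi> \<alpha> \<in> carrier A"
    and Is: "Is \<noteq> []" "set Is \<subseteq> subsets_of_card n r" and ks: "ks \<in> multi_indices n r"
    and \<sigma>s: "\<sigma>s \<in> perm_lists r (length Is - 1)"
  shows "row_product \<phi> r (\<lambda>p. pick Is (id # \<sigma>s) p @ [ks ! p]) \<in> carrier A"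
proof (intro row_product_closed \<phi>)
  fix p assume p: "p < r"
  have "id # \<sigma>s \<in> perm_lists r (length Is)" using id_Cons_perm_lists[OF \<sigma>s] Is(1) by (cases Is) auto
  then have "ks ! p \<in> {1..n}" "pick Is (id # \<sigma>s) p \<in> multi_indices n (length Is)"
    using ks pick_multi_indices[OF Is(2) refl] p nth_mem[of p ks] by (auto simp: multi_indices_def simp del: nth_mem)
  then show "pick Is (id # \<sigma>s) p @ [ks ! p] \<in> multi_indices n (Suc (length Is))" by (auto simp: multi_indices_def)
qed

lemma minor_term_closed:
  assumes "\<And>\<alpha>. \<alpha> \<in> multi_indices n (length Is) \<Longrightarrow> \<phi> \<alpha> \<in> carrier A"
    "Is \<noteq> []" "set Is \<subseteq> subsets_of_card n r" "\<sigma>s \<in> perm_lists r (length Is - 1)" "p < r"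
  shows "pick Is (id # \<sigma>s) p \<in> multi_indices n (length Is)" "\<phi> (pick Is (id # \<sigma>s) p) \<in> carrier A"
proof -
  have "id # \<sigma>s \<in> perm_lists r (length Is)" using id_Cons_perm_lists[OF assms(4)] assms(2) by (cases Is) auto
  then show "pick Is (id # \<sigma>s) p \<in> multi_indices n (length Is)"
    using pick_multi_indices[OF assms(3) refl] assms(5) by simp
  then show "\<phi> (pick Is (id # \<sigma>s) p) \<in> carrier A" by (rule assms(1))
qed

lemma minor_closed:
  assumes "\<And>\<alpha>. \<alpha> \<in> multi_indices n (length Is) \<Longrightarrow> \<phi> \<alpha> \<in> carrier A"
    "Is \<noteq> []" "set Is \<subseteq> subsets_of_card n r"
  shows "minor \<phi> q r Is \<in> carrier A"
  unfolding minor_def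
  by (intro finsum_closed funcsetI smult_closed row_product_closed minor_term_closed(2)[OF assms])

lemma minor_cong:
  assumes "\<And>\<alpha>. \<alpha> \<in> multi_indices n (length Is) \<Longrightarrow> \<phi> \<alpha> = \<psi> \<alpha>"
    "\<And>\<alpha>. \<alpha> \<in> multi_indices n (length Is) \<Longrightarrow> \<psi> \<alpha> \<in> carrier A"
    "Is \<noteq> []" "set Is \<subseteq> subsets_of_card n r"
  shows "minor \<phi> q r Is = minor \<psi> q r Is"
  unfolding minor_def
proof (rule finsum_cong', rule refl)
  note * = minor_term_closed[OF assms(2-4)]
  fix \<sigma>s assume \<sigma>s: "\<sigma>s \<in> perm_lists r (length Is - 1)"
  have "row_product \<phi> r (pick Is (id # \<sigma>s)) = row_product \<psi> r (pick Is (id # \<sigma>s))"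
    by (intro row_product_cong assms(1) *(1)[OF _ \<sigma>s])
  then show "(- q) ^ sum_list (map (inversions r) \<sigma>s) \<odot> row_product \<phi> r (pick Is (id # \<sigma>s))
    = (- q) ^ sum_list (map (inversions r) \<sigma>s) \<odot> row_product \<psi> r (pick Is (id # \<sigma>s))" by simp
qed (auto intro!: row_product_closed minor_term_closed(2)[OF assms(2-4)])

end

lemma (in alg_homomorphism) hom_minor:
  assumes "\<And>\<alpha>. \<alpha> \<in> multi_indices n (length Is) \<Longrightarrow> \<phi> \<alpha> \<in> carrier A"
    "Is \<noteq> []" "set Is \<subseteq> subsets_of_card n r"
  shows "h (A.minor \<phi> q r Is) = B.minor (\<lambda>\<alpha>. h (\<phi> \<alpha>)) q r Is"
proof -
  note cl = A.minor_term_closed(2)[OF assms]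
  let ?e = "\<lambda>\<sigma>s. (- q) ^ sum_list (map (inversions r) \<sigma>s)"
  have rp: "A.row_product \<phi> r (pick Is (id # \<sigma>s)) \<in> carrier A"
    "h (A.row_product \<phi> r (pick Is (id # \<sigma>s))) = B.row_product (\<lambda>\<alpha>. h (\<phi> \<alpha>)) r (pick Is (id # \<sigma>s))"
    if "\<sigma>s \<in> perm_lists r (length Is - 1)" for \<sigma>s
  proof -
    show "A.row_product \<phi> r (pick Is (id # \<sigma>s)) \<in> carrier A"
      using cl that by (intro A.row_product_closed) auto
    have "set (map (\<lambda>p. \<phi> (pick Is (id # \<sigma>s) p)) [0..<r]) \<subseteq> carrier A" using cl that by auto
    from hom_lprod[OF this] show "h (A.row_product \<phi> r (pick Is (id # \<sigma>s))) = B.row_product (\<lambda>\<alpha>. h (\<phi> \<alpha>)) r (pick Is (id # \<sigma>s))"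
      by (simp add: A.row_product_def B.row_product_def comp_def)
  qed
  have "h (A.minor \<phi> q r Is) = (\<Oplus>\<^bsub>B\<^esub>\<sigma>s\<in>perm_lists r (length Is - 1). h (?e \<sigma>s \<odot>\<^bsub>A\<^esub> A.row_product \<phi> r (pick Is (id # \<sigma>s))))"
    unfolding A.minor_def by (rule hom_finsum) (use rp in auto)
  also have "\<dots> = B.minor (\<lambda>\<alpha>. h (\<phi> \<alpha>)) q r Is"
    unfolding B.minor_def
  proof (rule B.finsum_cong', rule refl)
    show "h (?e \<sigma>s \<odot>\<^bsub>A\<^esub> A.row_product \<phi> r (pick Is (id # \<sigma>s))) =
        ?e \<sigma>s \<odot>\<^bsub>B\<^esub> B.row_product (\<lambda>\<alpha>. h (\<phi> \<alpha>)) r (pick Is (id # \<sigma>s))"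
      if "\<sigma>s \<in> perm_lists r (length Is - 1)" for \<sigma>s
      using rp[OF that] by (simp add: hom_simps)
  qed (use rp in \<open>auto simp flip: rp(2)\<close>)
  finally show ?thesis .
qed

context alg_pairing
begin

lemma finsum_pairing:
  assumes "finite S" "finite S'" "\<And>x. x \<in> S \<Longrightarrow> f x \<in> carrier B" "\<And>y. y \<in> S' \<Longrightarrow> g y \<in> carrier C"
  shows "t (\<Oplus>\<^bsub>B\<^esub>x\<in>S. f x) (\<Oplus>\<^bsub>C\<^esub>y\<in>S'. g y) = (\<Oplus>p\<in>S \<times> S'. t (f (fst p)) (g (snd p)))"
proof -
  have "t (\<Oplus>\<^bsub>B\<^esub>x\<in>S. f x) (\<Oplus>\<^bsub>C\<^esub>y\<in>S'. g y) = (\<Oplus>x\<in>S. t (f x) (\<Oplus>\<^bsub>C\<^esub>y\<in>S'. g y))"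
    using assms by (intro finsum_left) auto
  also have "\<dots> = (\<Oplus>x\<in>S. \<Oplus>y\<in>S'. t (f x) (g y))"
    using assms by (intro T.finsum_cong' finsum_right) auto
  also have "\<dots> = (\<Oplus>p\<in>S \<times> S'. t (f (fst p)) (g (snd p)))"
    using assms by (intro T.finsum_cartesian[symmetric]) auto
  finally show ?thesis .
qed

text \<open>
  Choosing a summand in each of the \<open>r\<close> factors amounts to choosing the sequence \<open>ks\<close> of
  contracted indices.
\<close>

lemma row_product_convolve:
  assumes f: "\<And>p u. \<lbrakk>p < r; u \<in> {1..n}\<rbrakk> \<Longrightarrow> \<phi> (\<alpha> p @ [u]) \<in> carrier B"
    and g: "\<And>p u. \<lbrakk>p < r; u \<in> {1..n}\<rbrakk> \<Longrightarrow> \<psi> (u # \<beta> p) \<in> carrier C"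
    and len: "\<And>p. p < r \<Longrightarrow> length (\<alpha> p) = m"
  shows "T.row_product (convolve n m \<phi> \<psi>) r (\<lambda>p. \<alpha> p @ \<beta> p) =
    (\<Oplus>ks\<in>multi_indices n r. t (B.row_product \<phi> r (\<lambda>p. \<alpha> p @ [ks ! p])) (C.row_product \<psi> r (\<lambda>p. ks ! p # \<beta> p)))"
proof -
  let ?F = "\<lambda>p u. t (\<phi> (\<alpha> p @ [u])) (\<psi> (u # \<beta> p))"
  have mi: "{ks. length ks = length [0..<r] \<and> set ks \<subseteq> {1..n}} = multi_indices n r"
    by (auto simp: multi_indices_def)
  have "map (\<lambda>p. convolve n m \<phi> \<psi> (\<alpha> p @ \<beta> p)) [0..<r] = map (\<lambda>p. \<Oplus>u\<in>{1..n}. ?F p u) [0..<r]"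
    using len by (auto simp: convolve_def)
  then have "T.row_product (convolve n m \<phi> \<psi>) r (\<lambda>p. \<alpha> p @ \<beta> p) = (\<Oplus>ks\<in>multi_indices n r. T.lprod (map2 ?F [0..<r] ks))"
    by (simp only: T.row_product_def mi[symmetric]) (rule T.lprod_finsum, use f g in auto)
  also have "\<dots> = (\<Oplus>ks\<in>multi_indices n r. t (B.row_product \<phi> r (\<lambda>p. \<alpha> p @ [ks ! p])) (C.row_product \<psi> r (\<lambda>p. ks ! p # \<beta> p)))"
  proof (rule T.finsum_cong', rule refl)
    fix ks assume ks: "ks \<in> multi_indices n r"
    then have "map2 ?F [0..<r] ks = map (\<lambda>p. ?F p (ks ! p)) [0..<r]"
      by (intro nth_equalityI) (auto simp: multi_indices_def)
    moreover have nth: "ks ! p \<in> {1..n}" if "p < r" for p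
      using ks that nth_mem[of p ks] by (auto simp: multi_indices_def simp del: nth_mem)
    moreover have "T.lprod (map (\<lambda>p. ?F p (ks ! p)) [0..<r])
        = t (B.row_product \<phi> r (\<lambda>p. \<alpha> p @ [ks ! p])) (C.row_product \<psi> r (\<lambda>p. ks ! p # \<beta> p))"
      unfolding B.row_product_def C.row_product_def by (rule lprod) (use f g nth in auto)
    ultimately show "T.lprod (map2 ?F [0..<r] ks)
        = t (B.row_product \<phi> r (\<lambda>p. \<alpha> p @ [ks ! p])) (C.row_product \<psi> r (\<lambda>p. ks ! p # \<beta> p))"
      by simp
  next
    have nth: "ks ! p \<in> {1..n}" if "p < r" "ks \<in> multi_indices n r" for p ks
      using that nth_mem[of p ks] by (auto simp: multi_indices_def simp del: nth_mem)
    then show "(\<lambda>ks. t (B.row_product \<phi> r (\<lambda>p. \<alpha> p @ [ks ! p])) (C.row_product \<psi> r (\<lambda>p. ks ! p # \<beta> p)))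
      \<in> multi_indices n r \<rightarrow> carrier T"
      using f g by (intro funcsetI closed B.row_product_closed C.row_product_closed) auto
  qed
  finally show ?thesis .
qed

text \<open>
  The permutations for \<open>Is @ Js\<close> split into those for \<open>Is\<close> and those for \<open>Js\<close>. After
  exchanging the sums, the former affect only the left and the latter only the right factor.
\<close>

lemma minor_convolve_expand:
  assumes \<phi>: "\<And>\<alpha>. \<alpha> \<in> multi_indices n (Suc m) \<Longrightarrow> \<phi> \<alpha> \<in> carrier B"
    and \<psi>: "\<And>\<alpha>. \<alpha> \<in> multi_indices n (Suc l) \<Longrightarrow> \<psi> \<alpha> \<in> carrier C"
    and Is: "set Is \<subseteq> subsets_of_card n r" "length Is = m" "Is \<noteq> []"
    and Js: "set Js \<subseteq> subsets_of_card n r" "length Js = l"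
  shows "T.minor (convolve n m \<phi> \<psi>) q r (Is @ Js) =
    (\<Oplus>ks\<in>multi_indices n r. t (B.col_minor \<phi> q r Is ks) (C.row_minor \<psi> q r Js ks))"
proof -
  let ?\<Phi> = "convolve n m \<phi> \<psi>" and ?e = "\<lambda>\<sigma>s. (- q) ^ sum_list (map (inversions r) \<sigma>s)"
  \<comment> \<open>The first index set carries no permutation, so its block has one permutation less than
    index sets.\<close>
  obtain m' where m: "m = Suc m'" using Is by (cases Is) auto
  let ?S = "perm_lists r m'" and ?S' = "perm_lists r l" and ?mi = "multi_indices n r"
  let ?P = "\<lambda>\<sigma>s ks. B.row_product \<phi> r (\<lambda>p. pick Is (id # \<sigma>s) p @ [ks ! p])"
  let ?R = "\<lambda>\<tau>s ks. C.row_product \<psi> r (\<lambda>p. ks ! p # pick Js \<tau>s p)"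
  have P: "?P \<sigma>s ks \<in> carrier B" if "\<sigma>s \<in> ?S" "ks \<in> ?mi" for \<sigma>s ks
    by (rule B.col_minor_term_closed[of n]) (use that \<phi> Is m in auto)
  have R: "?R \<tau>s ks \<in> carrier C" if "\<tau>s \<in> ?S'" "ks \<in> ?mi" for \<tau>s ks
    by (rule C.row_minor_term_closed[of n l]) (use that \<psi> Js in auto)
  have N: "length (Is @ Js) - 1 = m' + l" using Is Js m by simp
  have rp: "T.row_product ?\<Phi> r (pick (Is @ Js) (id # \<sigma>s @ \<tau>s)) = (\<Oplus>ks\<in>?mi. t (?P \<sigma>s ks) (?R \<tau>s ks))"
    if S: "\<sigma>s \<in> ?S" "\<tau>s \<in> ?S'" for \<sigma>s \<tau>s
  proof -
    have id: "id # \<sigma>s \<in> perm_lists r m" using id_Cons_perm_lists[OF S(1)] m by simp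
    then have "pick (Is @ Js) ((id # \<sigma>s) @ \<tau>s) p = pick Is (id # \<sigma>s) p @ pick Js \<tau>s p" for p
      using Is by (intro pick_append) (simp add: perm_lists_def)
    then have "T.row_product ?\<Phi> r (pick (Is @ Js) (id # \<sigma>s @ \<tau>s)) = T.row_product ?\<Phi> r (\<lambda>p. pick Is (id # \<sigma>s) p @ pick Js \<tau>s p)"
      by (intro T.row_product_cong) simp
    also have "\<dots> = (\<Oplus>ks\<in>?mi. t (?P \<sigma>s ks) (?R \<tau>s ks))"
    proof (rule row_product_convolve)
      fix p assume p: "p < r"
      note mi = pick_multi_indices[OF Is(1,2) id p] pick_multi_indices[OF Js S(2) p]
      show "length (pick Is (id # \<sigma>s) p) = m" using mi by (simp add: multi_indices_def)
      fix u assume "u \<in> {1..n}"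
      then show "\<phi> (pick Is (id # \<sigma>s) p @ [u]) \<in> carrier B" "\<psi> (u # pick Js \<tau>s p) \<in> carrier C"
        using mi by (auto simp: multi_indices_def intro!: \<phi> \<psi>)
    qed
    finally show ?thesis .
  qed
  have "T.minor ?\<Phi> q r (Is @ Js) = (\<Oplus>\<rho>s\<in>perm_lists r (m' + l). ?e \<rho>s \<odot> T.row_product ?\<Phi> r (pick (Is @ Js) (id # \<rho>s)))"
    unfolding T.minor_def N ..
  also have "\<dots> = (\<Oplus>x\<in>?S \<times> ?S'. ?e (fst x @ snd x) \<odot> T.row_product ?\<Phi> r (pick (Is @ Js) (id # fst x @ snd x)))"
  proof (subst T.finsum_bij[OF bij_perm_lists_append])
    fix \<rho>s assume "\<rho>s \<in> perm_lists r (m' + l)"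
    then have "\<rho>s \<in> (\<lambda>(\<sigma>s, \<tau>s). \<sigma>s @ \<tau>s) ` (?S \<times> ?S')"
      using bij_perm_lists_append[of r m' l] by (simp add: bij_betw_def)
    then obtain \<sigma>s \<tau>s where "\<rho>s = \<sigma>s @ \<tau>s" "\<sigma>s \<in> ?S" "\<tau>s \<in> ?S'" by auto
    then show "?e \<rho>s \<odot> T.row_product ?\<Phi> r (pick (Is @ Js) (id # \<rho>s)) \<in> carrier T"
      using rp P R by (auto intro!: T.finsum_closed)
  qed (simp add: case_prod_beta)
  also have "\<dots> = (\<Oplus>x\<in>?S \<times> ?S'. \<Oplus>ks\<in>?mi. t (?e (fst x) \<odot>\<^bsub>B\<^esub> ?P (fst x) ks) (?e (snd x) \<odot>\<^bsub>C\<^esub> ?R (snd x) ks))"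
  proof (rule T.finsum_cong', rule refl)
    fix x assume x: "x \<in> ?S \<times> ?S'"
    have "?e (fst x @ snd x) \<odot> (\<Oplus>ks\<in>?mi. t (?P (fst x) ks) (?R (snd x) ks))
        = (\<Oplus>ks\<in>?mi. ?e (fst x @ snd x) \<odot> t (?P (fst x) ks) (?R (snd x) ks))"
      using x P R by (intro T.smult_finsum) auto
    also have "\<dots> = (\<Oplus>ks\<in>?mi. t (?e (fst x) \<odot>\<^bsub>B\<^esub> ?P (fst x) ks) (?e (snd x) \<odot>\<^bsub>C\<^esub> ?R (snd x) ks))"
      by (rule T.finsum_cong') (use x P R in \<open>auto simp: smult_left smult_right T.smult_smult power_add mult.commute\<close>)
    finally show "?e (fst x @ snd x) \<odot> T.row_product ?\<Phi> r (pick (Is @ Js) (id # fst x @ snd x))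
        = (\<Oplus>ks\<in>?mi. t (?e (fst x) \<odot>\<^bsub>B\<^esub> ?P (fst x) ks) (?e (snd x) \<odot>\<^bsub>C\<^esub> ?R (snd x) ks))"
      using rp[of "fst x" "snd x"] x by auto
  qed (use P R in \<open>auto intro!: T.finsum_closed\<close>)
  also have "\<dots> = (\<Oplus>ks\<in>?mi. \<Oplus>x\<in>?S \<times> ?S'. t (?e (fst x) \<odot>\<^bsub>B\<^esub> ?P (fst x) ks) (?e (snd x) \<odot>\<^bsub>C\<^esub> ?R (snd x) ks))"
    by (rule T.finsum_swap) (use P R finite_perm_lists finite_multi_indices in auto)
  also have "\<dots> = (\<Oplus>ks\<in>?mi. t (B.col_minor \<phi> q r Is ks) (C.row_minor \<psi> q r Js ks))"
    unfolding B.col_minor_def C.row_minor_def Is(2) Js(2) m diff_Suc_1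
    by (intro T.finsum_cong' finsum_pairing[symmetric])
      (use P R finite_perm_lists in \<open>auto intro!: B.finsum_closed C.finsum_closed\<close>)
  finally show ?thesis .
qed

text \<open>
  The \<open>q\<close>-alternation of the right factors reduces the sum over sequences \<open>ks\<close> to one over sets
  \<open>K\<close> and permutations; their weights then complete the left factors to the minors of
  \<open>minor_snoc\<close>.
\<close>

theorem minor_convolve:
  assumes \<phi>: "\<And>\<alpha>. \<alpha> \<in> multi_indices n (Suc m) \<Longrightarrow> \<phi> \<alpha> \<in> carrier B"
    and \<psi>: "C.hyp_family q n (Suc l) \<psi>"
    and Is: "set Is \<subseteq> subsets_of_card n r" "length Is = m" "Is \<noteq> []"
    and Js: "set Js \<subseteq> subsets_of_card n r" "length Js = l"
  shows "T.minor (convolve n m \<phi> \<psi>) q r (Is @ Js) =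
    (\<Oplus>K\<in>subsets_of_card n r. t (B.minor \<phi> q r (Is @ [K])) (C.minor \<psi> q r (K # Js)))"
proof -
  let ?P = "B.col_minor \<phi> q r Is" and ?R = "C.row_minor \<psi> q r Js"
  let ?Perm = "{\<sigma>. \<sigma> permutes {..<r}}" and ?Sub = "subsets_of_card n r"
  note \<psi>_in = C.hyp_familyD(1)[OF \<psi>]
  have alt: "C.alternating q n r ?R" by (rule C.row_minor_alternating[OF \<psi> Js])
  have P: "?P ks \<in> carrier B" if "ks \<in> multi_indices n r" for ks
    unfolding B.col_minor_def
    by (intro B.finsum_closed funcsetI B.smult_closed B.col_minor_term_closed[of n]) (use \<phi> Is that in auto)
  have R: "?R ks \<in> carrier C" if "ks \<in> multi_indices n r" for ks
    using alt that by (simp add: C.alternating_def)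
  have arr: "arrange r K \<sigma> \<in> multi_indices n r" if "K \<in> ?Sub" "\<sigma> \<in> ?Perm" for K \<sigma>
    using bij_arrange[of r n] that by (auto simp: bij_betw_def)
  have sorted_mi: "sorted_list_of_set K \<in> multi_indices n r" if "K \<in> ?Sub" for K
    using subsets_of_cardD[OF that] by (simp add: multi_indices_def)
  have fin: "finite ?Perm" by (rule finite_permutations) simp
  have "T.minor (convolve n m \<phi> \<psi>) q r (Is @ Js) = (\<Oplus>ks\<in>multi_indices n r. t (?P ks) (?R ks))"
    by (rule minor_convolve_expand[OF \<phi> \<psi>_in Is Js])
  also have "\<dots> = (\<Oplus>ks\<in>{ks \<in> multi_indices n r. distinct ks}. t (?P ks) (?R ks))"
    by (rule T.finsum_support) (use P R C.alternating_sort[OF alt] finite_multi_indices in auto)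
  also have "\<dots> = (\<Oplus>x\<in>?Sub \<times> ?Perm. t (?P (arrange r (fst x) (snd x))) (?R (arrange r (fst x) (snd x))))"
    using P R by (subst T.finsum_bij[OF bij_arrange]) (auto simp: case_prod_beta)
  also have "\<dots> = (\<Oplus>K\<in>?Sub. \<Oplus>\<sigma>\<in>?Perm. t (?P (arrange r K \<sigma>)) (?R (arrange r K \<sigma>)))"
    by (rule T.finsum_cartesian) (use P R arr fin finite_subsets_of_card in auto)
  also have "\<dots> = (\<Oplus>K\<in>?Sub. t (B.minor \<phi> q r (Is @ [K])) (C.minor \<psi> q r (K # Js)))"
  proof (rule T.finsum_cong', rule refl)
    fix K assume K: "K \<in> ?Sub"
    have R_K: "?R (sorted_list_of_set K) = C.minor \<psi> q r (K # Js)" by (rule C.row_minor_sorted)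
    have R_in: "C.minor \<psi> q r (K # Js) \<in> carrier C" using R[OF sorted_mi[OF K]] R_K by simp
    have "(\<Oplus>\<sigma>\<in>?Perm. t (?P (arrange r K \<sigma>)) (?R (arrange r K \<sigma>)))
        = (\<Oplus>\<sigma>\<in>?Perm. t ((- q) ^ inversions r \<sigma> \<odot>\<^bsub>B\<^esub> ?P (arrange r K \<sigma>)) (C.minor \<psi> q r (K # Js)))"
      by (rule T.finsum_cong')
        (use P arr[OF K] R_in C.alternating_arrange[OF alt K] R_K in \<open>auto simp: smult_left smult_right\<close>)
    also have "\<dots> = t (\<Oplus>\<^bsub>B\<^esub>\<sigma>\<in>?Perm. (- q) ^ inversions r \<sigma> \<odot>\<^bsub>B\<^esub> ?P (arrange r K \<sigma>)) (C.minor \<psi> q r (K # Js))"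
      by (rule finsum_left[symmetric]) (use P arr[OF K] R_in in auto)
    also have "(\<Oplus>\<^bsub>B\<^esub>\<sigma>\<in>?Perm. (- q) ^ inversions r \<sigma> \<odot>\<^bsub>B\<^esub> ?P (arrange r K \<sigma>)) = B.minor \<phi> q r (Is @ [K])"
      by (rule B.minor_snoc[symmetric]) (use \<phi> Is K in auto)
    finally show "(\<Oplus>\<sigma>\<in>?Perm. t (?P (arrange r K \<sigma>)) (?R (arrange r K \<sigma>)))
        = t (B.minor \<phi> q r (Is @ [K])) (C.minor \<psi> q r (K # Js))" .
  next
    show "(\<lambda>K. t (B.minor \<phi> q r (Is @ [K])) (C.minor \<psi> q r (K # Js))) \<in> ?Sub \<rightarrow> carrier T"
      using \<phi> \<psi>_in Is Js by (intro funcsetI closed B.minor_closed C.minor_closed) auto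
  qed
  finally show ?thesis .
qed

end

context hypermatrix_algebra
begin

lemma hyp_minor_eq: "length Is = M \<Longrightarrow> hyp_minor q n r Is = H.minor (hyp_gen q n) q r Is"
  by (simp add: hyp_minor_def Let_def H.minor_def H.row_product_def H.lprod_def pick_def)

lemma hyp_minor_closed:
  assumes "length Is = M" "Is \<noteq> []" "set Is \<subseteq> subsets_of_card n r"
  shows "hyp_minor q n r Is \<in> carrier H"
  unfolding hyp_minor_eq[OF assms(1)]
  by (rule H.minor_closed[of n]) (use assms H.hyp_familyD(1)[OF hyp_gen_family] in auto)

end

section \<open>Comultiplication, minors and determinants\<close>

theorem theorem3p3:
  fixes \<iota> :: "complex \<Rightarrow> 'f::field" and q :: complex and m l n :: nat
  assumes "\<iota> 1 = 1"
    and "\<And>x y. \<iota> (x + y) = \<iota> x + \<iota> y"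
    and "\<And>x y. \<iota> (x * y) = \<iota> x * \<iota> y"
    and "q \<noteq> 0"
    and "m \<ge> 1" and "l \<ge> 1" and "n \<ge> 1"
  shows
    "let Q = \<iota> q;
         A = hyp_alg Q n (m + l); B = hyp_alg Q n (m + 1); C = hyp_alg Q n (1 + l);
         T = tensor_alg B C;
         on_gens = (\<lambda>\<Delta>. \<forall>\<alpha>\<in>multi_indices n m. \<forall>\<beta>\<in>multi_indices n l.
            \<Delta> (hyp_gen Q n (\<alpha> @ \<beta>)) =
              (\<Oplus>\<^bsub>T\<^esub>j\<in>{1..n}. tensor B C (hyp_gen Q n (\<alpha> @ [j])) (hyp_gen Q n ([j] @ \<beta>))))
     in (\<exists>\<Delta>\<in>alg_hom A T. on_gens \<Delta>) \<and>
        (\<forall>\<Delta>\<in>alg_hom A T. on_gens \<Delta> \<longrightarrow>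
           (\<forall>r\<in>{1..n}. \<forall>I J.
              length I = m \<and> length J = l \<and>
              set I \<subseteq> subsets_of_card n r \<and> set J \<subseteq> subsets_of_card n r \<longrightarrow>
              \<Delta> (hyp_minor Q n r (I @ J)) =
                (\<Oplus>\<^bsub>T\<^esub>K\<in>subsets_of_card n r.
                   tensor B C (hyp_minor Q n r (I @ [K])) (hyp_minor Q n r ([K] @ J)))) \<and>
           \<Delta> (hyp_det Q n (m + l)) = tensor B C (hyp_det Q n (m + 1)) (hyp_det Q n (l + 1)))"
proof -
  define Q where "Q = \<iota> q"
  interpret A: hypermatrix_algebra Q n "m + l" .
  interpret B: hypermatrix_algebra Q n "m + 1" .
  interpret C: hypermatrix_algebra Q n "1 + l" .
  let ?B = "hyp_alg Q n (m + 1)" and ?C = "hyp_alg Q n (1 + l)"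
  interpret T: alg_pairing ?B ?C "tensor_alg ?B ?C" "tensor ?B ?C"
    by (rule alg_pairing_tensor[OF B.H.unital_alg_axioms C.H.unital_alg_axioms])
  let ?T = "tensor_alg ?B ?C"
  let ?g = "hyp_gen Q n"
  let ?\<Phi> = "T.convolve n m ?g ?g"
  let ?on_gens = "\<lambda>\<Delta>. \<forall>\<alpha>\<in>multi_indices n m. \<forall>\<beta>\<in>multi_indices n l.
      \<Delta> (?g (\<alpha> @ \<beta>)) = (\<Oplus>\<^bsub>?T\<^esub>j\<in>{1..n}. tensor ?B ?C (?g (\<alpha> @ [j])) (?g ([j] @ \<beta>)))"
  have \<Phi>: "T.T.hyp_family Q n (m + l) ?\<Phi>"
    by (rule T.hyp_family_convolve[OF B.hyp_gen_family C.hyp_gen_family])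
  have append_mi: "\<alpha> @ \<beta> \<in> multi_indices n (m + l)" if "\<alpha> \<in> multi_indices n m" "\<beta> \<in> multi_indices n l" for \<alpha> \<beta>
    using that by (auto simp: multi_indices_def)
  have \<Phi>_append: "?\<Phi> (\<alpha> @ \<beta>) = (\<Oplus>\<^bsub>?T\<^esub>j\<in>{1..n}. tensor ?B ?C (?g (\<alpha> @ [j])) (?g ([j] @ \<beta>)))"
    if "\<alpha> \<in> multi_indices n m" for \<alpha> \<beta>
    unfolding T.convolve_def using that by (simp add: multi_indices_def)
  have existence: "\<exists>\<Delta>\<in>alg_hom A.H ?T. ?on_gens \<Delta>"
  proof -
    obtain \<Delta> where \<Delta>: "\<Delta> \<in> alg_hom A.H ?T" "\<forall>\<gamma>\<in>multi_indices n (m + l). \<Delta> (?g \<gamma>) = ?\<Phi> \<gamma>"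
      using A.hyp_alg_universal[OF T.T.unital_alg_axioms \<Phi>] by blast
    have "\<Delta> (?g (\<alpha> @ \<beta>)) = ?\<Phi> (\<alpha> @ \<beta>)" if "\<alpha> \<in> multi_indices n m" "\<beta> \<in> multi_indices n l" for \<alpha> \<beta>
      by (rule bspec[OF \<Delta>(2) append_mi[OF that]])
    then show ?thesis using \<Delta>(1) \<Phi>_append by (intro bexI[of _ \<Delta>]) auto
  qed
  have minors: "\<Delta> (hyp_minor Q n r (I @ J)) =
      (\<Oplus>\<^bsub>?T\<^esub>K\<in>subsets_of_card n r. tensor ?B ?C (hyp_minor Q n r (I @ [K])) (hyp_minor Q n r ([K] @ J)))"
    if \<Delta>: "\<Delta> \<in> alg_hom A.H ?T" "?on_gens \<Delta>" and IJ: "length I = m" "length J = l"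
      "set I \<subseteq> subsets_of_card n r" "set J \<subseteq> subsets_of_card n r" for \<Delta> r I J
  proof -
    interpret \<Delta>: alg_homomorphism A.H ?T \<Delta> by unfold_locales fact
    have I_ne: "I \<noteq> []" using IJ assms(5) by auto
    have gen_A: "?g \<gamma> \<in> carrier A.H" if "\<gamma> \<in> multi_indices n (m + l)" for \<gamma>
      by (rule A.H.hyp_familyD(1)[OF A.hyp_gen_family that])
    have gen_eq: "\<Delta> (?g \<gamma>) = ?\<Phi> \<gamma>" if "\<gamma> \<in> multi_indices n (m + l)" for \<gamma>
    proof -
      have "take m \<gamma> \<in> multi_indices n m" "drop m \<gamma> \<in> multi_indices n l"
        using that by (auto simp: multi_indices_def dest: in_set_takeD in_set_dropD)
      then have "\<Delta> (?g (take m \<gamma> @ drop m \<gamma>)) = ?\<Phi> (take m \<gamma> @ drop m \<gamma>)"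
        unfolding \<Phi>_append[OF \<open>take m \<gamma> \<in> multi_indices n m\<close>] using \<Delta>(2) by blast
      then show ?thesis by simp
    qed
    have "\<Delta> (hyp_minor Q n r (I @ J)) = \<Delta> (A.H.minor ?g Q r (I @ J))"
      using IJ by (simp add: A.hyp_minor_eq)
    also have "\<dots> = T.T.minor (\<lambda>\<alpha>. \<Delta> (?g \<alpha>)) Q r (I @ J)"
      by (rule \<Delta>.hom_minor[of n]) (use gen_A IJ I_ne in auto)
    also have "\<dots> = T.T.minor ?\<Phi> Q r (I @ J)"
      by (rule T.T.minor_cong[of n]) (use gen_eq T.T.hyp_familyD(1)[OF \<Phi>] IJ I_ne in auto)
    also have "\<dots> = (\<Oplus>\<^bsub>?T\<^esub>K\<in>subsets_of_card n r. tensor ?B ?C (B.H.minor ?g Q r (I @ [K])) (C.H.minor ?g Q r (K # J)))"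
      by (rule T.minor_convolve[where l = l])
        (use B.H.hyp_familyD(1)[OF B.hyp_gen_family] C.hyp_gen_family IJ I_ne in auto)
    also have "\<dots> = (\<Oplus>\<^bsub>?T\<^esub>K\<in>subsets_of_card n r. tensor ?B ?C (hyp_minor Q n r (I @ [K])) (hyp_minor Q n r ([K] @ J)))"
      using IJ by (simp add: B.hyp_minor_eq C.hyp_minor_eq)
    finally show ?thesis .
  qed
  have det: "\<Delta> (hyp_det Q n (m + l)) = tensor ?B ?C (hyp_det Q n (m + 1)) (hyp_det Q n (l + 1))"
    if \<Delta>: "\<Delta> \<in> alg_hom A.H ?T" "?on_gens \<Delta>" for \<Delta>
  proof -
    have full: "subsets_of_card n n = {{1..n}}"
    proof -
      have "K = {1..n}" if "K \<in> subsets_of_card n n" for K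
        by (rule card_subset_eq) (use that in \<open>simp_all add: subsets_of_card_def\<close>)
      moreover have "{1..n} \<in> subsets_of_card n n" by (simp add: subsets_of_card_def)
      ultimately show ?thesis by blast
    qed
    let ?I = "replicate m {1..n}" and ?J = "replicate l {1..n}"
    have "\<Delta> (hyp_det Q n (m + l)) = \<Delta> (hyp_minor Q n n (?I @ ?J))"
      by (simp add: hyp_det_def replicate_add)
    also have "\<dots> = (\<Oplus>\<^bsub>?T\<^esub>K\<in>{{1..n}}. tensor ?B ?C (hyp_minor Q n n (?I @ [K])) (hyp_minor Q n n ([K] @ ?J)))"
      unfolding full[symmetric] by (rule minors[OF \<Delta>]) (auto simp: full)
    also have "\<dots> = tensor ?B ?C (hyp_minor Q n n (?I @ [{1..n}])) (hyp_minor Q n n ([{1..n}] @ ?J))"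
    proof -
      have "hyp_minor Q n n (?I @ [{1..n}]) \<in> carrier ?B"
        by (rule B.hyp_minor_closed) (auto simp: full)
      moreover have "hyp_minor Q n n ([{1..n}] @ ?J) \<in> carrier ?C"
        by (rule C.hyp_minor_closed) (auto simp: full)
      ultimately show ?thesis by (intro T.T.finsum_one_element T.closed)
    qed
    also have "\<dots> = tensor ?B ?C (hyp_det Q n (m + 1)) (hyp_det Q n (l + 1))"
      by (simp add: hyp_det_def replicate_append_same)
    finally show ?thesis .
  qed
  show ?thesis
    unfolding Let_def Q_def[symmetric] using existence minors det by blast
qed

end
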